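(* Let $f(z)=z+1+a(z)$ with $a(z)\in z^{-2}\mathbb{C}\{z^{-1}\}$, and let $\tilde\varphi(z),\tilde\psi(z)\in z^{-1}\mathbb{C}[[z^{-1}]]$ be the formal series such that $\tilde u=\mathrm{Id}+\tilde\varphi$ is the solution of $u^{-1}\circ f\circ u(z)=z+1$ and $\tilde v=\mathrm{Id}+\tilde\psi=\tilde u^{-1}$ is the solution of Abel's equation $v(f(z))=v(z)+1$. Then the formal Borel transforms $\hat\varphi(\zeta)$ and $\hat\psi(\zeta)$ of $\tilde\varphi$ and $\tilde\psi$ converge near the origin and extend holomorphically to $\mathcal{R}$, with at most exponential growth in the directions $\arg\zeta=\theta$, $\theta\notin\frac{\pi}{2}+\pi\mathbb{Z}$: for every $\theta_0\in\left]0,\frac{\pi}{2}\right[$, there exists $\tau>0$ such that $\hat\varphi$ and $\hat\psi$ have exponential type $\le\tau$ in the sectors $\{-\theta_0+n\pi\le\arg\zeta\le\theta_0+n\pi\}$, $n=0$ or $1$.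
   Context: Formal Borel transform: $\mathcal{B}:\sum_{n\ge0}c_nz^{-n-1}\in z^{-1}\mathbb{C}[[z^{-1}]]\mapsto\sum_{n\ge0}c_n\frac{\zeta^n}{n!}\in\mathbb{C}[[\zeta]]$; one writes $\hat\varphi=\mathcal{B}\tilde\varphi$, $\hat\psi=\mathcal{B}\tilde\psi$. Formal solutions: for $f$ as in the claim (a "non-degenerate parabolic germ at infinity with vanishing resiter") there is a unique $\tilde\varphi\in z^{-1}\mathbb{C}[[z^{-1}]]$ such that the formal transformation $\tilde u=\mathrm{Id}+\tilde\varphi$ satisfies $u^{-1}\circ f\circ u(z)=z+1$, i.e. $f(\tilde u(z))=\tilde u(z+1)$; its inverse for composition is the unique transformation $\tilde v(z)=z+\tilde\psi(z)$, $\tilde\psi\in z^{-1}\mathbb{C}[[z^{-1}]]$, such that $\tilde v(f(z))=\tilde v(z)+1$ (shifts and compositions of formal series are defined by Taylor expansion). $\mathcal{R}$ is the set of all homotopy classes (with fixed endpoints) of paths issuing from $0$ and lying in $\mathbb{C}\setminus2\pi\mathrm{i}\mathbb{Z}$ except for their initial point (the class of the constant path is the origin of $\mathcal{R}$), with the Riemann surface structure pulled back by the map $\mathcal{R}\to\mathbb{C}\setminus2\pi\mathrm{i}\mathbb{Z}^*$ sending a class to the extremity of its representatives. A germ in $\mathbb{C}\{\zeta\}$ "extends holomorphically to $\mathcal{R}$" if it admits analytic continuation along any path issuing from $0$ and lying (except for its starting point) in $\mathbb{C}\setminus2\pi\mathrm{i}\mathbb{Z}$. The sectors are in the principal sheet,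 i.e. they are viewed inside $\mathbb{C}\setminus\pm2\pi\mathrm{i}\left[1,+\infty\right[$, to which the germs extend by continuation along segments $[0,\zeta]$. A function $g$ has exponential type $\le\tau$ in a sector if $|g(\zeta)|\le\mathrm{const}\;\mathrm{e}^{\tau|\zeta|}$ there. *)

theory Defs
  imports "HOL-Complex_Analysis.Complex_Analysis"
begin

text \<open>
  A formal series \<open>\<Sum>\<^sub>n c\<^sub>n z\<^sup>-\<^sup>n\<close> in \<open>\<complex>[[z\<^sup>-\<^sup>1]]\<close> is represented by the formal power series whose
  coefficient of index \<open>n\<close> is \<open>c\<^sub>n\<close>; thus the variable \<^const>\<open>fps_X\<close> stands for \<open>z\<^sup>-\<^sup>1\<close>, the space
  \<open>z\<^sup>-\<^sup>k \<complex>[[z\<^sup>-\<^sup>1]]\<close> consists of the series whose coefficients of index below \<open>k\<close> vanish, and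
  \<open>\<complex>{z\<^sup>-\<^sup>1}\<close> consists of the series of positive convergence radius.
  The formal transformation \<open>z \<mapsto> z + c(z)\<close> with \<open>c \<in> \<complex>[[z\<^sup>-\<^sup>1]]\<close> is represented by \<open>c\<close> alone.
  In particular \<open>z \<mapsto> z\<close> is represented by \<open>0\<close> and \<open>z \<mapsto> z + 1\<close> by \<open>1\<close>.
\<close>

subsection \<open>Formal series in \<open>z\<^sup>-\<^sup>1\<close> and formal transformations\<close>

text \<open>The derivation \<open>d/dz = - w\<^sup>2 d/dw\<close>, where \<open>w = z\<^sup>-\<^sup>1\<close>.\<close>

definition dz :: "complex fps \<Rightarrow> complex fps" where
  "dz \<phi> = - (fps_X ^ 2 * fps_deriv \<phi>)"

text \<open>
  \<open>\<phi>(z + c(z)) = \<Sum>\<^sub>k c(z)\<^sup>k \<phi>\<^bsup>(k)\<^esup>(z) / k!\<close>, the sum being taken for the formal (\<open>z\<^sup>-\<^sup>1\<close>-adic) topology,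
  which is the one of the type of formal power series; it always converges, see below.
\<close>

definition fsubst :: "complex fps \<Rightarrow> complex fps \<Rightarrow> complex fps" where
  "fsubst \<phi> c = (\<Sum>k. fps_const (1 / fact k) * c ^ k * (dz ^^ k) \<phi>)"

text \<open>\<open>(Id + b) \<circ> (Id + c) = Id + (c + b \<circ> (Id + c))\<close>\<close>

definition fcomp :: "complex fps \<Rightarrow> complex fps \<Rightarrow> complex fps"  (infixl "\<odot>" 70) where
  "b \<odot> c = c + fsubst b c"

text \<open>The term of index \<open>n\<close> is the coefficient of \<open>z\<^sup>-\<^sup>n\<^sup>-\<^sup>1\<close> divided by \<open>n!\<close>; constant terms are ignored.\<close>

definition formal_borel :: "complex fps \<Rightarrow> complex fps" where
  "formal_borel \<phi> = Abs_fps (\<lambda>n. fps_nth \<phi> (Suc n) / fact n)"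

lemma fps_nth_dz: "fps_nth (dz \<phi>) n = (if n = 0 then 0 else - of_nat (n - 1) * fps_nth \<phi> (n - 1))"
proof (cases "n < 2")
  case True
  then have "n = 0 \<or> n = 1" by linarith
  then show ?thesis by (auto simp: dz_def fps_X_power_mult_nth)
next
  case False
  then obtain m where "n = Suc (Suc m)"
    by (metis add_2_eq_Suc le_Suc_ex not_less)
  then show ?thesis by (simp add: dz_def fps_X_power_mult_nth) (simp add: algebra_simps)
qed

lemma fps_nth_dz_funpow_eq_0: "n < k \<Longrightarrow> fps_nth ((dz ^^ k) \<phi>) n = 0"
  by (induction k arbitrary: n) (auto simp: fps_nth_dz)

lemma fps_nth_mult_dz_funpow_eq_0:
  assumes "n < k"
  shows "fps_nth (b * (dz ^^ k) \<phi>) n = 0"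
  using assms by (auto simp: fps_mult_nth intro!: sum.neutral fps_nth_dz_funpow_eq_0)

lemma fsubst_sums:
  "(\<lambda>k. fps_const (1 / fact k) * c ^ k * (dz ^^ k) \<phi>) sums fsubst \<phi> c"
  and fps_nth_fsubst:
  "fps_nth (fsubst \<phi> c) n = (\<Sum>k\<le>n. fps_nth (c ^ k * (dz ^^ k) \<phi>) n / fact k)"
proof -
  define T where "T = (\<lambda>k. fps_const (1 / fact k) * c ^ k * (dz ^^ k) \<phi>)"
  define S where "S = Abs_fps (\<lambda>n. \<Sum>k\<le>n. fps_nth (T k) n)"
  have T0: "fps_nth (T k) n = 0" if "n < k" for k n
    unfolding T_def using that by (rule fps_nth_mult_dz_funpow_eq_0)
  have sums: "T sums S"
    unfolding sums_def
  proof (rule tendsto_fpsI)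
    fix n
    show "\<forall>\<^sub>F N in sequentially. fps_nth (sum T {..<N}) n = fps_nth S n"
      using eventually_gt_at_top[of n]
    proof eventually_elim
      case (elim N)
      have "(\<Sum>k<N. fps_nth (T k) n) = (\<Sum>k\<le>n. fps_nth (T k) n)"
        using elim by (intro sum.mono_neutral_right) (auto intro: T0)
      then show ?case by (simp add: S_def fps_sum_nth)
    qed
  qed
  then have S: "fsubst \<phi> c = S"
    by (simp add: fsubst_def T_def sums_iff)
  show "(\<lambda>k. fps_const (1 / fact k) * c ^ k * (dz ^^ k) \<phi>) sums fsubst \<phi> c"
    using sums unfolding S by (simp add: T_def)
  show "fps_nth (fsubst \<phi> c) n = (\<Sum>k\<le>n. fps_nth (c ^ k * (dz ^^ k) \<phi>) n / fact k)"
    unfolding S by (simp add: S_def T_def mult.assoc)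
qed


subsection \<open>Analytic continuation\<close>

definition two_pi_i_Z :: "complex set" where
  "two_pi_i_Z = range (\<lambda>k::int. 2 * of_real pi * \<i> * of_int k)"

text \<open>
  A germ at \<open>\<zeta>\<^sub>0\<close> is given by its Taylor series in the local variable \<open>\<zeta> - \<zeta>\<^sub>0\<close>.  The family \<open>P\<close> of
  germs at the points \<open>\<gamma> t\<close> is coherent: the germ at \<open>\<gamma> s\<close> is the re-expansion of the germ at
  \<open>\<gamma> t\<close> for \<open>s\<close> close to \<open>t\<close>.  For \<open>s = t\<close> this forces the convergence radius to be positive.
\<close>

definition continuation_family ::
    "(real \<Rightarrow> complex) \<Rightarrow> (real \<Rightarrow> complex fps) \<Rightarrow> bool" where
  "continuation_family \<gamma> P \<longleftrightarrow>
     (\<forall>t\<in>{0..1}. \<exists>\<epsilon>>0. \<forall>s\<in>{0..1}. \<bar>s - t\<bar> < \<epsilon> \<longrightarrow>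
        ereal (norm (\<gamma> s - \<gamma> t)) < fps_conv_radius (P t) \<and>
        P s = fps_expansion (eval_fps (P t)) (\<gamma> s - \<gamma> t))"

definition continues_along ::
    "complex fps \<Rightarrow> (real \<Rightarrow> complex) \<Rightarrow> complex fps \<Rightarrow> bool" where
  "continues_along G \<gamma> H \<longleftrightarrow> (\<exists>P. continuation_family \<gamma> P \<and> P 0 = G \<and> P 1 = H)"

definition extends_to_R :: "complex fps \<Rightarrow> bool" where
  "extends_to_R G \<longleftrightarrow>
     (\<forall>\<gamma>. path \<gamma> \<and> pathstart \<gamma> = 0 \<and> (\<forall>t\<in>{0<..1}. \<gamma> t \<notin> two_pi_i_Z) \<longrightarrow>
        (\<exists>H. continues_along G \<gamma> H))"

definition cut_plane :: "complex set" where
  "cut_plane = - {\<i> * of_real t | t. \<bar>t\<bar> \<ge> 2 * pi}"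

text \<open>
  \<open>g\<close> is the holomorphic function on the cut plane obtained from the germ \<open>G\<close> at the origin by
  continuation along the segments \<open>[0,\<zeta>]\<close>.
\<close>

definition principal_branch :: "complex fps \<Rightarrow> (complex \<Rightarrow> complex) \<Rightarrow> bool" where
  "principal_branch G g \<longleftrightarrow>
     g holomorphic_on cut_plane \<and>
     (\<forall>\<zeta>\<in>cut_plane. continues_along G (linepath 0 \<zeta>) (fps_expansion g \<zeta>))"


subsection \<open>Exponential type in sectors\<close>

definition sector :: "real \<Rightarrow> nat \<Rightarrow> complex set" where
  "sector \<theta>\<^sub>0 n =
     {of_real r * cis \<alpha> | r \<alpha>. r > 0 \<and> - \<theta>\<^sub>0 + of_nat n * pi \<le> \<alpha> \<and> \<alpha> \<le> \<theta>\<^sub>0 + of_nat n * pi}"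

definition exp_type_le :: "(complex \<Rightarrow> complex) \<Rightarrow> real \<Rightarrow> complex set \<Rightarrow> bool" where
  "exp_type_le g \<tau> S \<longleftrightarrow> (\<exists>C. \<forall>\<zeta>\<in>S. norm (g \<zeta>) \<le> C * exp (\<tau> * norm \<zeta>))"

end

theory Submission
  imports Defs
begin

text \<open>
  Abel's equation \<open>v \<circ> f = v + 1\<close> is linear in \<open>v\<close>, and so is the equation for each exponential
  \<open>e\<^sup>\<lambda>\<^sup>v\<close>.  Put \<open>\<psi>\<^sub>1(z) = \<psi>(z + 1)\<close> and \<open>X\<^sub>\<lambda> = exp (\<lambda>\<psi>\<^sub>1)\<close>.  Since \<open>f(z) = (Id + a) (z) + 1\<close>, Abel's equation
  becomes \<open>\<psi>\<^sub>1(z - 1) = a(z) + \<psi>\<^sub>1(z + a(z))\<close>, and therefore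
  \<open>X\<^sub>\<lambda>(z - 1) = exp (\<lambda>a(z)) X\<^sub>\<lambda>(z + a(z))\<close>.

  The Borel transform turns \<open>z \<mapsto> z - 1\<close> into multiplication by \<open>e\<^sup>\<zeta>\<close>.  It turns
  \<open>H \<mapsto> exp (\<lambda>a) H(z + a(z)) - H\<close> into the integral operator with kernel \<open>K(\<lambda> - \<xi>, \<zeta> - \<xi>)\<close>, where
  \<open>K(x, \<cdot>)\<close> is the Borel transform of \<open>exp (xa) - 1\<close> (lemma \<open>formal_borel_twisted_fsubst\<close>).  As \<open>a\<close> converges,
  \<open>K\<close> is entire.  Hence the Borel transform \<open>G(\<lambda>, \<cdot>)\<close> of \<open>X\<^sub>\<lambda> - 1\<close> solves the linear Volterra equation
  \<open>(e\<^sup>\<zeta> - 1) G(\<lambda>, \<zeta>) = K(\<lambda>, \<zeta>) + \<integral>\<^sub>0\<^sup>\<zeta> K(\<lambda> - \<xi>, \<zeta> - \<xi>) G(\<lambda>, \<xi>) d\<xi>\<close>,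
  and the transform of \<open>\<psi>\<^sub>1\<close> solves the equation with \<open>\<lambda> = 0\<close> and with the transform of \<open>a\<close> in place of
  \<open>K(\<lambda>, \<zeta>)\<close>.  Conversely, the Taylor series of an analytic solution at \<open>0\<close> must be this formal Borel
  transform, because the formal difference equation has only one solution (\<open>state_fps_expansion\<close>).

  A linear Volterra equation with an entire kernel has solutions on every starlike region on which \<open>e\<^sup>\<zeta> - 1\<close>
  has no zeros besides a simple one at the centre (\<open>volterra_solution\<close>).  The integral over the part
  of the path already travelled is entire in \<open>\<zeta>\<close> and can be absorbed into the inhomogeneous term, so
  that one can proceed from disc to disc along any path avoiding \<open>2\<pi>i\<int>\<close> (\<open>state_step\<close>).
  This gives \<open>\<psi>\<close>.  For \<open>\<phi>\<close>, no convolution of multivalued functions is needed: Lagrange inversion reads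
  \<open>\<zeta> \<B>\<phi>(\<zeta>) = - e\<^sup>\<zeta> G(\<zeta>, \<zeta>)\<close> in the Borel plane (\<open>lagrange_inversion_borel\<close>, \<open>fps_expansion_diagonal\<close>),
  which continues wherever \<open>G\<close> does.

  For the growth in the right half-plane, \<open>1 / (e\<^sup>\<zeta> - 1)\<close> decays exponentially, and
  \<open>|K(x, \<eta>)| \<le> R (exp (C|x|/R\<^sup>2) - 1) exp (R|\<eta>|)\<close> for every large \<open>R\<close>.  Letting \<open>R\<close> grow like the square root
  of \<open>|x|/|\<zeta>|\<close> as \<open>\<zeta> \<rightarrow> 0\<close> makes the decay absorb the first exponential, while the integrated rate \<open>R\<close> remains
  of the order of \<open>|x| + |\<zeta>|\<close> (\<open>volterra_growth\<close>).  In the left half-plane \<open>1 / (e\<^sup>\<zeta> - 1)\<close> does not decay.  There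
  the result for the right half-plane is applied to \<open>z \<mapsto> - f\<^sup>-\<^sup>1(- z)\<close>, which has the same form as \<open>f\<close> and
  whose Fatou coordinates have the Borel transforms \<open>\<B>\<phi>(- \<zeta>)\<close> and \<open>\<B>\<psi>(- \<zeta>)\<close> (\<open>reflected_data\<close>).
\<close>

unbundle no vec_syntax
unbundle fps_syntax

section \<open>Formal shifts as compositions\<close>

lemma fps_nth_dz_funpow:
  "(dz ^^ k) F $ n = (if n < k then 0 else (-1) ^ k * pochhammer (of_nat (n - k)) k * F $ (n - k))"
proof (induction k arbitrary: n)
  case 0
  show ?case by simp
next
  case (Suc k)
  show ?case
  proof (cases "n \<le> k")
    case True
    then show ?thesis by (auto simp: fps_nth_dz Suc)
  next
    case False
    then obtain m where n: "n = Suc (k + m)"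
      by (metis add_Suc_right less_imp_Suc_add not_le)
    have "(dz ^^ Suc k) F $ n = - (of_nat (m + k) :: complex) * ((-1) ^ k * pochhammer (of_nat m) k * F $ m)"
      unfolding n by (simp add: fps_nth_dz Suc add.commute del: of_nat_add)
    then show ?thesis unfolding n by (simp add: pochhammer_Suc algebra_simps)
  qed
qed

text \<open>
  \<open>1 / (z + c(z))\<close> as a series in \<open>fps_X = z\<^sup>-\<^sup>1\<close>.  Substituting \<open>z + c\<close> for \<open>z\<close> is composition with it.
\<close>

definition inv_translate :: "complex fps \<Rightarrow> complex fps" where
  "inv_translate c = fps_X * inverse (1 + fps_X * c)"

lemma inv_translate_nth_0 [simp]: "inv_translate c $ 0 = 0"
  by (simp add: inv_translate_def)

lemma inverse_power_binomial:
  fixes b :: "complex fps"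
  assumes "b $ 0 = 0"
  shows "inverse (1 + b) ^ m = fps_binomial (- of_nat m) oo b"
proof -
  have "inverse (1 + fps_X) ^ m = (fps_binomial (- of_nat m) :: complex fps)"
    by (simp add: fps_binomial_minus_one [symmetric] fps_binomial_power)
  then have "fps_binomial (- of_nat m) oo b = (inverse (1 + fps_X) oo b) ^ m"
    using assms by (simp add: fps_compose_power)
  also have "inverse (1 + fps_X) oo b = inverse (1 + b)"
    using assms by (simp add: fps_inverse_compose fps_compose_add_distrib)
  finally show ?thesis by simp
qed

text \<open>
  Both sides are linear and continuous in \<open>F\<close>, and on \<open>F = fps_X ^ m\<close> Taylor's formula is the binomial series
  of \<open>(1 + fps_X * c)\<^sup>-\<^sup>m\<close>.  Composition of power series is associative and multiplicative, so the
  shifts inherit these properties.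
\<close>

lemma fsubst_conv_compose: "fsubst F c = F oo inv_translate c"
proof (rule fps_ext)
  fix N
  define t where "t = (\<lambda>k m. (-1) ^ k * pochhammer (of_nat m) k / fact k * F $ m * (c ^ k) $ (N - m - k))"
  have "(c ^ k * (dz ^^ k) F) $ N / fact k = (\<Sum>m\<le>N - k. t k m)" if "k \<le> N" for k
  proof -
    have "(c ^ k * (dz ^^ k) F) $ N = (\<Sum>i\<le>N. (c ^ k) $ (N - i) * (dz ^^ k) F $ i)"
      unfolding mult.commute[of "c ^ k"] fps_mult_nth by (simp add: mult.commute atLeast0AtMost)
    also have "\<dots> = (\<Sum>i\<in>{k..N}. (c ^ k) $ (N - i) * (dz ^^ k) F $ i)"
      by (rule sum.mono_neutral_right) (auto simp: fps_nth_dz_funpow)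
    also have "\<dots> = (\<Sum>m\<le>N - k. (c ^ k) $ (N - m - k) * ((-1) ^ k * pochhammer (of_nat m) k * F $ m))"
      by (rule sum.reindex_bij_witness[of _ "\<lambda>i. i + k" "\<lambda>i. i - k"])
        (use that in \<open>auto simp: fps_nth_dz_funpow\<close>)
    finally show ?thesis
      by (simp add: t_def sum_divide_distrib mult_ac)
  qed
  then have "fsubst F c $ N = (\<Sum>k\<le>N. \<Sum>m\<le>N - k. t k m)"
    by (simp add: fps_nth_fsubst)
  also have "\<dots> = (\<Sum>m\<le>N. \<Sum>k\<le>N - m. t k m)"
    unfolding sum.Sigma[OF finite_atMost ballI[OF finite_atMost]]
    by (rule sum.reindex_bij_witness[of _ prod.swap prod.swap]) auto
  also have "\<dots> = (F oo inv_translate c) $ N"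
  proof -
    have "(\<Sum>k\<le>N - m. t k m) = F $ m * (inv_translate c ^ m) $ N" if "m \<le> N" for m
    proof -
      have "(inv_translate c ^ m) $ N = (inverse (1 + fps_X * c) ^ m) $ (N - m)"
        using that by (simp add: inv_translate_def power_mult_distrib fps_X_power_mult_nth)
      also have "\<dots> = (\<Sum>k\<le>N - m. fps_binomial (- of_nat m) $ k * (fps_X ^ k * c ^ k) $ (N - m))"
        by (simp add: inverse_power_binomial fps_compose_nth power_mult_distrib atLeast0AtMost)
      also have "\<dots> = (\<Sum>k\<le>N - m. (-1) ^ k * pochhammer (of_nat m) k / fact k * (c ^ k) $ (N - m - k))"
        by (rule sum.cong) (auto simp: fps_X_power_mult_nth gbinomial_pochhammer)
      finally show ?thesis
        by (simp add: t_def sum_distrib_left mult_ac)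
    qed
    then show ?thesis by (simp add: fps_compose_nth atLeast0AtMost)
  qed
  finally show "fsubst F c $ N = (F oo inv_translate c) $ N" .
qed

text \<open>
  The map \<open>c \<mapsto> inv_translate c\<close> carries the composition law of formal transformations to
  composition of power series without constant term.
\<close>

lemma inv_translate_compose:
  "inv_translate c oo inv_translate d = inv_translate (d + fsubst c d)"
proof -
  have "inv_translate c oo inv_translate d
      = inv_translate d * inverse (1 + inv_translate d * (c oo inv_translate d))"
    unfolding inv_translate_def[of c]
    by (simp add: fps_compose_mult_distrib fps_inverse_compose fps_compose_add_distrib)
  also have "\<dots> = fps_X * (inverse (1 + fps_X * d) * inverse (1 + inv_translate d * (c oo inv_translate d)))"
    by (simp add: inv_translate_def mult_ac)
  also have "inverse (1 + fps_X * d) * inverse (1 + inv_translate d * (c oo inv_translate d))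
      = inverse ((1 + fps_X * d) * (1 + inv_translate d * (c oo inv_translate d)))"
    by (simp add: fps_inverse_mult)
  also have "(1 + fps_X * d) * (1 + inv_translate d * (c oo inv_translate d))
     = 1 + fps_X * d + fps_X * (inverse (1 + fps_X * d) * (1 + fps_X * d)) * (c oo inv_translate d)"
    by (simp add: inv_translate_def algebra_simps)
  also have "inverse (1 + fps_X * d) * (1 + fps_X * d) = 1"
    by (rule inverse_mult_eq_1) simp
  finally show ?thesis
    by (simp add: inv_translate_def fsubst_conv_compose algebra_simps)
qed

lemma fsubst_fsubst: "fsubst (fsubst F c) d = fsubst F (d + fsubst c d)"
  by (simp add: fsubst_conv_compose fps_compose_assoc flip: inv_translate_compose[unfolded fsubst_conv_compose])

lemma fsubst_0_right [simp]: "fsubst F 0 = F"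
  by (simp add: fsubst_conv_compose inv_translate_def)

lemma fsubst_add: "fsubst (F + G) c = fsubst F c + fsubst G c"
  by (simp add: fsubst_conv_compose fps_compose_add_distrib)

lemma fsubst_diff: "fsubst (F - G) c = fsubst F c - fsubst G c"
  by (simp add: fsubst_conv_compose fps_compose_sub_distrib)

lemma fsubst_1 [simp]: "fsubst 1 c = 1"
  by (simp add: fsubst_conv_compose)

lemma fsubst_nth_0 [simp]: "fsubst F c $ 0 = F $ 0"
  by (simp add: fsubst_conv_compose)

text \<open>
  Both sides solve the same first-order linear differential equation: multiplying the left-hand side by the
  inverse of the right-hand side gives a series with derivative zero.
\<close>

lemma fps_exp_compose_add:
  fixes p q :: "complex fps"
  assumes p: "p $ 0 = 0" and q: "q $ 0 = 0"
  shows "fps_exp l oo (p + q) = (fps_exp l oo p) * (fps_exp l oo q)"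
proof -
  have D: "fps_deriv (fps_exp l oo r) = fps_const l * (fps_exp l oo r) * fps_deriv r"
    if "r $ 0 = 0" for l and r :: "complex fps"
    using that by (simp add: fps_compose_deriv fps_compose_mult_distrib)
  have inv: "(fps_exp l oo r) * (fps_exp (- l) oo r) = 1" if "r $ 0 = 0" for r :: "complex fps"
    using that by (simp add: fps_exp_add_mult [symmetric] flip: fps_compose_mult_distrib)
  define W where "W = (fps_exp l oo (p + q)) * ((fps_exp (- l) oo p) * (fps_exp (- l) oo q))"
  have "fps_deriv W = 0"
    unfolding W_def fps_deriv_mult using p q
    by (simp add: D algebra_simps flip: fps_const_neg)
  then have "W = fps_const (W $ 0)"
    by (simp only: fps_deriv_eq_0_iff)
  also have "W $ 0 = 1"
    by (simp add: W_def)
  finally have "W = 1" by simp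
  then have "fps_exp l oo (p + q) =
      ((fps_exp l oo p) * (fps_exp (- l) oo p)) * ((fps_exp l oo q) * (fps_exp (- l) oo q)) * (fps_exp l oo (p + q))"
    by (simp add: inv p q)
  also have "\<dots> = (fps_exp l oo p) * (fps_exp l oo q) * W"
    unfolding W_def by (simp add: mult_ac)
  finally show ?thesis using \<open>W = 1\<close> by simp
qed

section \<open>The formal Borel transform\<close>

lemma formal_borel_nth: "formal_borel F $ n = F $ Suc n / fact n"
  by (simp add: formal_borel_def)

lemma formal_borel_surj: "\<exists>H. H $ 0 = 0 \<and> formal_borel H = F"
proof (intro exI conjI)
  show "formal_borel (Abs_fps (\<lambda>n. if n = 0 then 0 else F $ (n - 1) * fact (n - 1))) = F"
    by (rule fps_ext) (simp add: formal_borel_nth)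
qed simp

lemma formal_borel_inj:
  assumes "formal_borel F = formal_borel G" "F $ 0 = G $ 0"
  shows "F = G"
proof (rule fps_ext)
  fix n
  show "F $ n = G $ n"
    using assms(2) arg_cong[OF assms(1), of "\<lambda>F. F $ (n - 1)"] by (cases n) (simp_all add: formal_borel_nth)
qed

lemma formal_borel_add: "formal_borel (F + G) = formal_borel F + formal_borel G"
  by (rule fps_ext) (simp add: formal_borel_nth add_divide_distrib)

text \<open>
  The Borel transform turns \<open>d/dz\<close> into multiplication by \<open>- \<zeta>\<close>, so that a shift becomes multiplication
  by an exponential.
\<close>

lemma formal_borel_fsubst_const:
  "formal_borel (fsubst F (fps_const c)) = fps_exp (- c) * formal_borel F"
proof (rule fps_ext)
  fix N
  have "fsubst F (fps_const c) $ Suc N / fact N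
      = (\<Sum>k\<le>Suc N. c ^ k * (dz ^^ k) F $ Suc N / fact k / fact N)"
    by (simp add: fps_nth_fsubst fps_const_power sum_divide_distrib del: sum.atMost_Suc)
  also have "\<dots> = (\<Sum>k\<le>N. c ^ k * (dz ^^ k) F $ Suc N / fact k / fact N)"
    by (simp add: fps_nth_dz_funpow pochhammer_0_left)
  also have "\<dots> = (\<Sum>k\<le>N. (- c) ^ k / fact k * (F $ Suc (N - k) / fact (N - k)))"
  proof (rule sum.cong)
    fix k assume "k \<in> {..N}"
    then obtain m where N: "N = k + m" by (metis atMost_iff le_Suc_ex)
    have "pochhammer (1 + of_nat m :: complex) k = fact (k + m) / fact m"
      using pochhammer_product'[of "1::complex" m k]
      by (simp add: pochhammer_fact [symmetric] add.commute)
    then have "(dz ^^ k) F $ Suc N = (-1) ^ k * (fact N / fact m) * F $ Suc m"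
      by (simp add: fps_nth_dz_funpow N Suc_diff_le)
    then show "c ^ k * (dz ^^ k) F $ Suc N / fact k / fact N
        = (- c) ^ k / fact k * (F $ Suc (N - k) / fact (N - k))"
      by (simp add: N power_minus[of c] field_simps)
  qed auto
  finally show "formal_borel (fsubst F (fps_const c)) $ N = (fps_exp (- c) * formal_borel F) $ N"
    by (simp add: fps_mult_nth formal_borel_nth atLeast0AtMost)
qed

section \<open>Linear difference equations\<close>

lemma fsubst_compose:
  assumes "p $ 0 = 0"
  shows "fsubst (G oo p) c = G oo fsubst p c"
  using assms by (simp add: fsubst_conv_compose fps_compose_assoc)

text \<open>
  The two leading coefficients of a shifted series: only the constant term of \<open>c\<close> enters the second one.
\<close>

lemma fsubst_leading:
  assumes "\<And>i. i < k \<Longrightarrow> D $ i = 0"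
  shows fsubst_nth_below: "i < k \<Longrightarrow> fsubst D c $ i = 0"
    and fsubst_nth_leading: "fsubst D c $ Suc k = D $ Suc k - of_nat k * c $ 0 * D $ k"
proof -
  have 0: "(dz ^^ j) D $ i = 0" if "i < k + j" for i j
    using that assms by (auto simp: fps_nth_dz_funpow)
  show "fsubst D c $ i = 0" if "i < k"
    unfolding fps_nth_fsubst fps_mult_nth using that by (auto intro!: sum.neutral 0) linarith
  have "fsubst D c $ Suc k = (\<Sum>j\<in>{0, 1}. (c ^ j * (dz ^^ j) D) $ Suc k / fact j)"
    unfolding fps_nth_fsubst
  proof (rule sum.mono_neutral_right)
    show "\<forall>j\<in>{..Suc k} - {0, 1}. (c ^ j * (dz ^^ j) D) $ Suc k / fact j = 0"
    proof
      fix j assume "j \<in> {..Suc k} - {0, 1}"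
      then have "2 \<le> j" by auto
      then have "(dz ^^ j) D $ (Suc k - i) = 0" for i
        by (intro 0) linarith
      then show "(c ^ j * (dz ^^ j) D) $ Suc k / fact j = 0"
        by (simp add: fps_mult_nth)
    qed
  qed auto
  also have "\<dots> = D $ Suc k + (c * dz D) $ Suc k" by simp
  also have "(c * dz D) $ Suc k = (\<Sum>i\<in>{0}. c $ i * dz D $ (Suc k - i))"
    unfolding fps_mult_nth by (rule sum.mono_neutral_right) (use 0[where j = 1] in auto)
  finally show "fsubst D c $ Suc k = D $ Suc k - of_nat k * c $ 0 * D $ k"
    by (simp add: fps_nth_dz)
qed

text \<open>
  If \<open>D\<close> starts with \<open>d z\<^sup>-\<^sup>k\<close>, then \<open>D(z - 1) - D(z)\<close> starts with \<open>k d z\<^sup>-\<^sup>k\<^sup>-\<^sup>1\<close>, whereas \<open>E\<close> and \<open>a\<close> change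
  \<open>D\<close> only from the order \<open>z\<^sup>-\<^sup>k\<^sup>-\<^sup>2\<close> on.
\<close>

lemma difference_equation_unique:
  assumes eq: "fsubst D (- 1) = E * fsubst D a" and D0: "D $ 0 = 0"
    and E: "E $ 0 = 1" "E $ 1 = 0" and a0: "a $ 0 = 0"
  shows "D = 0"
proof (rule fps_ext)
  fix n
  show "D $ n = 0 $ n"
  proof (induction n rule: less_induct)
    case (less k)
    then have lt: "\<And>i. i < k \<Longrightarrow> D $ i = 0" by simp
    have "(E * fsubst D a) $ Suc k = (\<Sum>i\<in>{0, 1}. E $ i * fsubst D a $ (Suc k - i))"
      unfolding fps_mult_nth
      by (rule sum.mono_neutral_right) (auto intro!: fsubst_nth_below[OF lt])
    then have "(E * fsubst D a) $ Suc k = D $ Suc k"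
      using fsubst_nth_leading[OF lt] E a0 by simp
    then have "of_nat k * D $ k = 0"
      using fsubst_nth_leading[OF lt, where c = "-1"] eq by simp
    then show ?case using D0 by auto
  qed
qed

section \<open>The perturbed shift in the Borel plane\<close>

text \<open>
  The derivation \<open>d/dz\<close> conjugated by \<open>e\<^sup>l\<^sup>z\<close>.  Its powers collect the two exponential factors of
  \<open>exp (l a) H(z + a)\<close> into one: that series is \<open>\<Sum>\<^sub>n a\<^sup>n (l + d/dz)\<^sup>n H / n!\<close>.  On the Borel side, \<open>l + d/dz\<close> is
  multiplication by \<open>l - \<zeta>\<close>, which explains why the integral kernel depends on \<open>l\<close> through \<open>l - \<xi>\<close> only.
\<close>

definition dz_twisted :: "complex \<Rightarrow> complex fps \<Rightarrow> complex fps" where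
  "dz_twisted l F = fps_const l * F + dz F"

lemma dz_const_mult: "dz (fps_const l * F) = fps_const l * dz F"
  by (simp add: dz_def algebra_simps)

lemma dz_sum: "dz (sum f A) = (\<Sum>i\<in>A. dz (f i))"
  by (simp add: dz_def fps_deriv_sum sum_distrib_left sum_negf)

lemma dz_twisted_funpow:
  "(dz_twisted l ^^ n) F = (\<Sum>i\<le>n. fps_const (of_nat (n choose i) * l ^ i) * (dz ^^ (n - i)) F)"
proof (induction n)
  case (Suc n)
  define t where "t = (\<lambda>i j. fps_const (l ^ i) * (dz ^^ j) F)"
  have IH: "(dz_twisted l ^^ n) F = (\<Sum>i\<le>n. of_nat (n choose i) * t i (n - i))"
    by (simp add: Suc t_def fps_of_nat mult.assoc flip: fps_const_mult)
  have t1: "fps_const l * (of_nat c * t i j) = of_nat c * t (Suc i) j" for c i j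
    by (simp add: t_def mult_ac flip: fps_const_mult)
  have t2: "dz (of_nat c * t i j) = of_nat c * t i (Suc j)" for c i j
    by (simp add: t_def fps_of_nat [symmetric] dz_const_mult)
  have "(dz_twisted l ^^ Suc n) F =
     (\<Sum>i\<le>n. of_nat (n choose i) * t (Suc i) (n - i)) + (\<Sum>i\<le>n. of_nat (n choose i) * t i (Suc n - i))"
    by (simp add: IH dz_twisted_def[of l "sum _ _"] dz_sum t2 sum_distrib_left t1 Suc_diff_le)
  also have "(\<Sum>i\<le>n. of_nat (n choose i) * t i (Suc n - i)) =
     t 0 (Suc n) + (\<Sum>i\<le>n. of_nat (n choose Suc i) * t (Suc i) (n - i))"
  proof -
    have "(\<Sum>i\<le>n. of_nat (n choose i) * t i (Suc n - i)) = (\<Sum>i\<le>Suc n. of_nat (n choose i) * t i (Suc n - i))"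
      by simp
    also have "\<dots> = t 0 (Suc n) + (\<Sum>i\<le>n. of_nat (n choose Suc i) * t (Suc i) (n - i))"
      by (subst sum.atMost_Suc_shift) simp
    finally show ?thesis .
  qed
  finally have "(dz_twisted l ^^ Suc n) F = (\<Sum>i\<le>Suc n. of_nat (Suc n choose i) * t i (Suc n - i))"
    by (subst sum.atMost_Suc_shift) (simp add: sum.distrib algebra_simps)
  then show ?case
    by (simp add: t_def fps_of_nat mult.assoc flip: fps_const_mult)
qed simp

lemma twisted_fsubst_nth:
  assumes a0: "a $ 0 = 0"
  shows "((fps_exp l oo a) * fsubst H a) $ N = (\<Sum>n\<le>N. (a ^ n * (dz_twisted l ^^ n) H) $ N / fact n)"
proof -
  define s where "s = (\<lambda>i j. l ^ i / (fact i * fact j) * (a ^ (i + j) * (dz ^^ j) H) $ N)"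
  have s0: "s i j = 0" if "N < i + j" for i j
    unfolding s_def fps_mult_nth using a0 that
    by (auto intro!: sum.neutral startsby_zero_power_prefix[rule_format])
  have E: "(fps_exp l oo a) $ p = (\<Sum>i\<le>N. l ^ i / fact i * (a ^ i) $ p)" if "p \<le> N" for p
    unfolding fps_compose_nth fps_exp_nth using that a0
    by (intro sum.mono_neutral_cong_left) (auto intro: startsby_zero_power_prefix[rule_format])
  have S: "fsubst H a $ q = (\<Sum>j\<le>N. (a ^ j * (dz ^^ j) H) $ q / fact j)" if "q \<le> N" for q
    unfolding fps_nth_fsubst using that
    by (intro sum.mono_neutral_cong_left) (auto simp: fps_nth_mult_dz_funpow_eq_0)
  have "((fps_exp l oo a) * fsubst H a) $ N =
     (\<Sum>p\<le>N. \<Sum>i\<le>N. \<Sum>j\<le>N. l ^ i / (fact i * fact j) * ((a ^ i) $ p * (a ^ j * (dz ^^ j) H) $ (N - p)))"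
    unfolding fps_mult_nth[of "fps_exp l oo a"] atLeast0AtMost
    by (rule sum.cong) (simp_all add: E S sum_product field_simps)
  also have "\<dots> = (\<Sum>i\<le>N. \<Sum>j\<le>N. \<Sum>p\<le>N. l ^ i / (fact i * fact j) * ((a ^ i) $ p * (a ^ j * (dz ^^ j) H) $ (N - p)))"
    by (subst sum.swap, rule sum.cong[OF refl], subst sum.swap, simp)
  also have "\<dots> = (\<Sum>i\<le>N. \<Sum>j\<le>N. s i j)"
    unfolding s_def power_add mult.assoc
    by (simp add: fps_mult_nth[of "a ^ _" "a ^ _ * _"] atLeast0AtMost sum_distrib_left)
  \<comment> \<open>The square of indices may be cut down to a triangle because \<open>a ^ (i + j)\<close> starts at order \<open>i + j\<close>.\<close>
  also have "\<dots> = (\<Sum>i\<le>N. \<Sum>j\<le>N - i. s i j)"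
    by (intro sum.cong sum.mono_neutral_right) (auto intro: s0)
  also have "\<dots> = (\<Sum>n\<le>N. \<Sum>i\<le>n. s i (n - i))"
    unfolding sum.Sigma[OF finite_atMost ballI[OF finite_atMost]]
    by (rule sum.reindex_bij_witness[of _ "\<lambda>(n, i). (i, n - i)" "\<lambda>(i, j). (i + j, i)"]) auto
  also have "\<dots> = (\<Sum>n\<le>N. (a ^ n * (dz_twisted l ^^ n) H) $ N / fact n)"
  proof (rule sum.cong)
    fix n
    have "a ^ n * (dz_twisted l ^^ n) H
        = (\<Sum>i\<le>n. fps_const (of_nat (n choose i) * l ^ i) * (a ^ n * (dz ^^ (n - i)) H))"
      unfolding dz_twisted_funpow sum_distrib_left by (simp add: mult.left_commute)
    then have "(a ^ n * (dz_twisted l ^^ n) H) $ N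
        = (\<Sum>i\<le>n. (of_nat (n choose i) * l ^ i) * (a ^ n * (dz ^^ (n - i)) H) $ N)"
      by (simp add: fps_sum_nth)
    also have "\<dots> = (\<Sum>i\<le>n. s i (n - i)) * fact n"
      unfolding sum_distrib_right
      by (rule sum.cong) (auto simp: s_def binomial_fact)
    finally show "(\<Sum>i\<le>n. s i (n - i)) = (a ^ n * (dz_twisted l ^^ n) H) $ N / fact n"
      by (simp add: field_simps)
  qed auto
  finally show ?thesis .
qed

lemma formal_borel_dz_twisted:
  "formal_borel (dz_twisted l F) = (fps_const l - fps_X) * formal_borel F"
proof (rule fps_ext)
  fix n
  show "formal_borel (dz_twisted l F) $ n = ((fps_const l - fps_X) * formal_borel F) $ n"
    by (cases n) (simp_all add: formal_borel_nth dz_twisted_def fps_nth_dz algebra_simps add_divide_distrib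
        diff_divide_distrib del: of_nat_Suc)
qed

text \<open>
  Multiplication by \<open>z\<^sup>-\<^sup>1\<close> becomes integration from \<open>0\<close>.
\<close>

lemma fps_integral0_funpow_formal_borel:
  "(fps_integral0 ^^ k) (formal_borel F) $ N = (if N < k then 0 else F $ (Suc N - k) / fact N)"
proof (induction k arbitrary: N)
  case (Suc k)
  show ?case
    by (cases N) (simp_all add: Suc field_simps Suc_diff_le del: of_nat_Suc)
qed (simp add: formal_borel_nth)

text \<open>
  The coefficient of \<open>\<eta>\<^sup>m / m!\<close> in the kernel \<open>K(l - \<xi>, \<eta>)\<close>, as a polynomial in \<open>\<xi> = fps_X\<close>.
\<close>

definition kernel_poly :: "complex fps \<Rightarrow> complex \<Rightarrow> nat \<Rightarrow> complex fps" where
  "kernel_poly a l m = (\<Sum>n\<le>Suc m. fps_const ((a ^ n) $ Suc m / fact n) * (fps_const l - fps_X) ^ n)"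

lemma fps_integral0_funpow_linear:
  "(fps_integral0 ^^ k) (\<Sum>i\<in>A. fps_const (c i) * f i) = (\<Sum>i\<in>A. fps_const (c i :: complex) * (fps_integral0 ^^ k) (f i))"
  by (induction k) (simp_all add: fps_integral0_sum fps_integral0_fps_const_mult_left)

text \<open>
  The Volterra operator in formal terms.  The factor \<open>\<eta>\<^sup>m / m!\<close> of the kernel acts by convolution, that is,
  as an \<open>(m + 1)\<close>-fold integral.  The term of index \<open>m\<close> affects the coefficients of index greater than \<open>m\<close>
  only, which is why a finite sum suffices.
\<close>

lemma formal_borel_twisted_fsubst:
  assumes a0: "a $ 0 = 0" and H0: "H $ 0 = 0"
  shows "formal_borel ((fps_exp l oo a) * fsubst H a - H) $ N
    = (\<Sum>m\<le>N. (fps_integral0 ^^ Suc m) (kernel_poly a l m * formal_borel H) $ N)"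
proof -
  define h where "h = (\<lambda>n. (dz_twisted l ^^ n) H)"
  have h0: "h n $ 0 = 0" for n
    unfolding h_def dz_twisted_funpow fps_sum_nth
    by (rule sum.neutral) (auto simp: fps_nth_dz_funpow H0)
  have B: "formal_borel (h n) = (fps_const l - fps_X) ^ n * formal_borel H" for n
    unfolding h_def by (induction n) (simp_all add: formal_borel_dz_twisted mult.assoc)
  have "(fps_integral0 ^^ Suc m) (kernel_poly a l m * formal_borel H) $ N
      = (\<Sum>n\<le>Suc m. (a ^ n) $ Suc m / fact n * (h n $ (N - m) / fact N))" if "m \<le> N" for m
  proof -
    have "kernel_poly a l m * formal_borel H
        = (\<Sum>n\<le>Suc m. fps_const ((a ^ n) $ Suc m / fact n) * formal_borel (h n))"
      unfolding kernel_poly_def sum_distrib_right B by (simp add: mult.assoc)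
    moreover have "(fps_integral0 ^^ Suc m) (formal_borel (h n)) $ N = h n $ (N - m) / fact N" for n
      using that by (cases "m = N") (simp_all add: fps_integral0_funpow_formal_borel h0 del: funpow.simps)
    ultimately show ?thesis
      by (simp only: fps_integral0_funpow_linear fps_sum_nth fps_mult_left_const_nth)
  qed
  then have "(\<Sum>m\<le>N. (fps_integral0 ^^ Suc m) (kernel_poly a l m * formal_borel H) $ N)
      = (\<Sum>m\<le>N. \<Sum>n\<le>Suc m. (a ^ n) $ Suc m / fact n * (h n $ (N - m) / fact N))"
    by simp
  also have "\<dots> = (\<Sum>m\<le>N. \<Sum>n\<in>{1..Suc N}. (a ^ n) $ Suc m / fact n * (h n $ (N - m) / fact N))"
    by (rule sum.cong[OF refl], rule sum.mono_neutral_cong)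
      (use a0 in \<open>auto simp: not_le Suc_le_eq intro: startsby_zero_power_prefix[rule_format]\<close>)
  also have "\<dots> = (\<Sum>n\<in>{1..Suc N}. (\<Sum>m\<le>N. (a ^ n) $ Suc m * h n $ (N - m)) / fact n) / fact N"
    by (rule trans[OF sum.swap])
      (simp add: sum_divide_distrib del: sum.cl_ivl_Suc power_Suc fact_Suc)
  also have "(\<Sum>n\<in>{1..Suc N}. (\<Sum>m\<le>N. (a ^ n) $ Suc m * h n $ (N - m)) / fact n)
      = (\<Sum>n\<in>{1..Suc N}. (a ^ n * h n) $ Suc N / fact n)"
  proof (rule sum.cong)
    fix n assume n: "n \<in> {1..Suc N}"
    have "(a ^ n * h n) $ Suc N = (\<Sum>m\<le>Suc N. (a ^ n) $ m * h n $ (Suc N - m))"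
      by (simp add: fps_mult_nth atLeast0AtMost)
    also have "\<dots> = (\<Sum>m\<le>N. (a ^ n) $ Suc m * h n $ (N - m))"
      using n a0 by (subst sum.atMost_Suc_shift) (simp add: startsby_zero_power)
    finally show "(\<Sum>m\<le>N. (a ^ n) $ Suc m * h n $ (N - m)) / fact n = (a ^ n * h n) $ Suc N / fact n"
      by simp
  qed simp
  also have "\<dots> = ((fps_exp l oo a) * fsubst H a) $ Suc N - H $ Suc N"
  proof -
    have "{..Suc N} = insert 0 {1..Suc N}" by auto
    then have "(\<Sum>n\<le>Suc N. (a ^ n * h n) $ Suc N / fact n)
        = H $ Suc N + (\<Sum>n\<in>{1..Suc N}. (a ^ n * h n) $ Suc N / fact n)"
      by (simp add: h_def del: sum.cl_ivl_Suc)
    then show ?thesis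
      unfolding twisted_fsubst_nth[OF a0] by (simp add: h_def)
  qed
  finally show ?thesis
    by (simp add: formal_borel_nth)
qed

lemma exp_satisfies_difference_equation:
  assumes p0: "p $ 0 = 0" and a0: "a $ 0 = 0" and eq: "fsubst p (- 1) = a + fsubst p a"
  shows "fsubst (fps_exp l oo p) (- 1) = (fps_exp l oo a) * fsubst (fps_exp l oo p) a"
  using assms by (simp add: fsubst_compose fps_exp_compose_add)

section \<open>Lagrange inversion in the Borel plane\<close>

lemma fps_deriv_power_Suc:
  fixes q :: "complex fps"
  shows "fps_deriv (q ^ Suc j) = of_nat (Suc j) * (fps_deriv q * q ^ j)"
  by (subst fps_deriv_power) (simp add: fps_of_nat mult.assoc del: of_nat_Suc)

text \<open>
  The coefficient of index \<open>n + 1\<close> of \<open>\<phi>\<close> is \<open>- 1 / (n + 1)\<close> times the coefficient of \<open>z\<^sup>-\<^sup>1\<close> in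
  \<open>(z + \<psi>(z))\<^sup>n\<^sup>+\<^sup>1\<close>.  On the right
  stands the diagonal \<open>\<lambda> = \<zeta>\<close> of the Borel transform of \<open>exp (\<lambda>\<psi>) - 1\<close>, ordered by powers of \<open>\<zeta>\<close>: the index
  \<open>N - m\<close> counts the powers of \<open>\<lambda>\<close> and \<open>m\<close> those of the Borel variable.
\<close>

lemma lagrange_inversion_borel:
  assumes inv: "fsubst \<phi> \<psi> = - \<psi>"
  shows "fps_X * formal_borel \<phi>
    = - Abs_fps (\<lambda>N. \<Sum>m\<le>N. (\<psi> ^ (N - m)) $ Suc m / (fact (N - m) * fact m))"
proof (rule fps_ext)
  fix N
  show "(fps_X * formal_borel \<phi>) $ N = (- Abs_fps (\<lambda>N. \<Sum>m\<le>N. (\<psi> ^ (N - m)) $ Suc m / (fact (N - m) * fact m))) $ N"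
  proof (cases N)
    case 0
    then show ?thesis by simp
  next
    case (Suc n)
    define q where "q = 1 + fps_X * \<psi>"
    define V where "V = inv_translate \<psi>"
    have q1: "inverse q * q = 1"
      by (rule inverse_mult_eq_1) (simp add: q_def)
    have V: "V = fps_X * inverse q"
      by (simp add: V_def inv_translate_def q_def)
    have qV: "q * V = fps_X"
      by (metis V mult.left_commute mult.right_neutral q1 mult.commute)
    have dV: "fps_deriv V * q\<^sup>2 = q - fps_X * fps_deriv q"
    proof -
      have "fps_deriv q * V + q * fps_deriv V = 1"
        using arg_cong[OF qV, of fps_deriv] by (simp add: algebra_simps)
      then have "q * (fps_deriv q * V + q * fps_deriv V) = q" by simp
      then have "fps_deriv q * (q * V) + fps_deriv V * q\<^sup>2 = q"
        by (simp add: algebra_simps power2_eq_square)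
      then show ?thesis unfolding qV by (simp add: algebra_simps)
    qed
    \<comment> \<open>The residues of \<open>V\<^sup>i\<^sup>-\<^sup>n\<^sup>-\<^sup>1 V'\<close>, with the powers of \<open>fps_X\<close> cleared: \<open>V = fps_X / q\<close>, and only the
      logarithmic derivative \<open>i = n\<close> has a nonzero residue.\<close>
    have res: "(V ^ i * (fps_deriv V * q ^ Suc n)) $ n = (if i = n then 1 else 0)" if "i \<le> n" for i
    proof (cases "i = n")
      case True
      have "V ^ n * (fps_deriv V * q ^ Suc n) = (q * V) ^ n * (fps_deriv V * q)"
        by (simp add: power_mult_distrib mult_ac)
      then have "(V ^ n * (fps_deriv V * q ^ Suc n)) $ n = (fps_deriv V * q) $ 0"
        by (simp only: qV fps_X_power_mult_nth) simp
      then show ?thesis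
        by (simp add: True) (simp add: V q_def)
    next
      case False
      define j where "j = n - Suc i"
      have n: "n = Suc (i + j)" using False that by (simp add: j_def)
      have "V ^ i * (fps_deriv V * q ^ Suc n) = (q * V) ^ i * (q ^ j * (fps_deriv V * q\<^sup>2))"
        by (simp add: n power_mult_distrib power_add power2_eq_square mult_ac)
      also have "\<dots> = fps_X ^ i * (q ^ Suc j - fps_X * (fps_deriv q * q ^ j))"
        unfolding qV dV by (simp add: algebra_simps)
      also have "of_nat (Suc j) * \<dots> = fps_X ^ i * (of_nat (Suc j) * q ^ Suc j - fps_X * fps_deriv (q ^ Suc j))"
        unfolding fps_deriv_power_Suc by (simp add: algebra_simps del: of_nat_Suc)
      also have "\<dots> $ n = 0"
        by (simp add: n fps_X_power_mult_nth fps_of_nat [symmetric] del: of_nat_Suc power_Suc fps_deriv_power)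
      finally have "of_nat (Suc j) * (V ^ i * (fps_deriv V * q ^ Suc n)) $ n = 0"
        by (simp add: fps_of_nat [symmetric] del: of_nat_Suc)
      then show ?thesis using False by (simp del: of_nat_Suc)
    qed
    have "- fps_deriv \<psi> = fps_deriv (\<phi> oo V)"
      using inv by (simp add: fsubst_conv_compose V_def)
    also have "\<dots> = (fps_deriv \<phi> oo V) * fps_deriv V"
      by (rule fps_compose_deriv) (simp add: V_def)
    finally have "- (fps_deriv \<psi> * q ^ Suc n) = (fps_deriv \<phi> oo V) * (fps_deriv V * q ^ Suc n)"
      by (metis mult.assoc mult_minus_left)
    also have "\<dots> $ n = (\<Sum>i\<le>n. fps_deriv \<phi> $ i * (V ^ i * (fps_deriv V * q ^ Suc n)) $ n)"
    proof -
      have "((fps_deriv \<phi> oo V) * G) $ n = (\<Sum>i\<le>n. fps_deriv \<phi> $ i * (V ^ i * G) $ n)" for G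
      proof -
        have "((fps_deriv \<phi> oo V) * G) $ n
            = (\<Sum>p\<le>n. \<Sum>i\<le>n. fps_deriv \<phi> $ i * ((V ^ i) $ p * G $ (n - p)))"
          unfolding fps_mult_nth atLeast0AtMost
        proof (rule sum.cong)
          fix p assume "p \<in> {..n}"
          then have "(fps_deriv \<phi> oo V) $ p = (\<Sum>i\<le>n. fps_deriv \<phi> $ i * (V ^ i) $ p)"
            unfolding fps_compose_nth
            by (intro sum.mono_neutral_left)
              (auto simp: V_def intro: startsby_zero_power_prefix[rule_format])
          then show "(fps_deriv \<phi> oo V) $ p * G $ (n - p)
              = (\<Sum>i\<le>n. fps_deriv \<phi> $ i * ((V ^ i) $ p * G $ (n - p)))"
            by (simp add: sum_distrib_right mult.assoc)
        qed simp
        also have "\<dots> = (\<Sum>i\<le>n. fps_deriv \<phi> $ i * (V ^ i * G) $ n)"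
          by (subst sum.swap) (simp add: fps_mult_nth atLeast0AtMost sum_distrib_left)
        finally show ?thesis .
      qed
      then show ?thesis .
    qed
    also have "\<dots> = fps_deriv \<phi> $ n"
    proof -
      have "(\<Sum>i\<le>n. fps_deriv \<phi> $ i * (V ^ i * (fps_deriv V * q ^ Suc n)) $ n)
          = (\<Sum>i\<le>n. if i = n then fps_deriv \<phi> $ i else 0)"
        by (rule sum.cong) (simp_all add: res del: power_Suc fps_deriv_nth)
      then show ?thesis by simp
    qed
    finally have L: "fps_deriv \<phi> $ n = - (fps_deriv \<psi> * q ^ Suc n) $ n" by simp
    have "(fps_deriv \<psi> * q ^ Suc n) $ n = (\<Sum>k\<le>n. of_nat (Suc n choose Suc k) * (\<psi> ^ Suc k) $ Suc (n - k))"
    proof -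
      have "fps_deriv \<psi> * q ^ Suc n = (\<Sum>k\<le>Suc n. of_nat (Suc n choose k) * (fps_X ^ k * (\<psi> ^ k * fps_deriv \<psi>)))"
        unfolding q_def add.commute[of 1] binomial_ring
        by (simp add: sum_distrib_left power_mult_distrib mult_ac del: sum.atMost_Suc binomial_Suc_Suc)
      then have "(fps_deriv \<psi> * q ^ Suc n) $ n
          = (\<Sum>k\<le>Suc n. of_nat (Suc n choose k) * (fps_X ^ k * (\<psi> ^ k * fps_deriv \<psi>)) $ n)"
        by (simp add: fps_sum_nth fps_of_nat [symmetric] del: sum.atMost_Suc binomial_Suc_Suc)
      also have "\<dots> = (\<Sum>k\<le>n. of_nat (Suc n choose k) * (\<psi> ^ k * fps_deriv \<psi>) $ (n - k))"
        by (simp add: fps_X_power_mult_nth del: binomial_Suc_Suc)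
      also have "\<dots> = (\<Sum>k\<le>n. of_nat (Suc n choose Suc k) * (\<psi> ^ Suc k) $ Suc (n - k))"
      proof (rule sum.cong)
        fix k assume k: "k \<in> {..n}"
        have "fps_deriv (\<psi> ^ Suc k) $ (n - k) = of_nat (Suc k) * (\<psi> ^ k * fps_deriv \<psi>) $ (n - k)"
          unfolding fps_deriv_power_Suc
          by (simp add: fps_of_nat [symmetric] mult.commute[of "\<psi> ^ k"] del: of_nat_Suc)
        then have 1: "of_nat (Suc k) * (\<psi> ^ k * fps_deriv \<psi>) $ (n - k) = of_nat (Suc (n - k)) * (\<psi> ^ Suc k) $ Suc (n - k)"
          by (simp del: power_Suc fps_deriv_mult fps_deriv_power)
        have "Suc k * (Suc n choose Suc k) = Suc (n - k) * (Suc n choose k)"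
          using k binomial_absorb_comp[of "Suc n" k] Suc_times_binomial[of k n]
          by (simp only: Suc_diff_le diff_Suc_1 atMost_iff)
        then have 2: "(of_nat (Suc k) :: complex) * of_nat (Suc n choose Suc k) = of_nat (Suc (n - k)) * of_nat (Suc n choose k)"
          by (metis of_nat_mult)
        have "of_nat (Suc k) * (of_nat (Suc n choose k) * (\<psi> ^ k * fps_deriv \<psi>) $ (n - k))
            = of_nat (Suc k) * (of_nat (Suc n choose Suc k) * (\<psi> ^ Suc k) $ Suc (n - k))"
          using 1 2 by (metis mult.assoc mult.left_commute)
        then show "of_nat (Suc n choose k) * (\<psi> ^ k * fps_deriv \<psi>) $ (n - k)
            = of_nat (Suc n choose Suc k) * (\<psi> ^ Suc k) $ Suc (n - k)"
          by (simp del: of_nat_Suc power_Suc binomial_Suc_Suc)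
      qed simp
      finally show ?thesis .
    qed
    then have "of_nat (Suc n) * \<phi> $ Suc n
        = - (\<Sum>k\<le>n. of_nat (Suc n choose Suc k) * (\<psi> ^ Suc k) $ Suc (n - k))"
      using L by (simp del: binomial_Suc_Suc power_Suc)
    also have "(\<Sum>k\<le>n. of_nat (Suc n choose Suc k) * (\<psi> ^ Suc k) $ Suc (n - k))
        = (\<Sum>m\<le>n. of_nat (Suc n choose (Suc n - m)) * (\<psi> ^ (Suc n - m)) $ Suc m)"
      by (rule sum.reindex_bij_witness[of _ "\<lambda>k. n - k" "\<lambda>k. n - k"]) (auto simp: Suc_diff_le)
    also have "\<dots> = fact (Suc n) * (\<Sum>m\<le>n. (\<psi> ^ (Suc n - m)) $ Suc m / (fact (Suc n - m) * fact m))"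
      unfolding sum_distrib_left
      by (rule sum.cong) (auto simp: binomial_fact simp del: fact_Suc binomial_Suc_Suc)
    finally have "of_nat (Suc n) * \<phi> $ Suc n
        = - (fact (Suc n) * (\<Sum>m\<le>n. (\<psi> ^ (Suc n - m)) $ Suc m / (fact (Suc n - m) * fact m)))" .
    then have "of_nat (Suc n) * \<phi> $ Suc n
        = of_nat (Suc n) * - (fact n * (\<Sum>m\<le>n. (\<psi> ^ (Suc n - m)) $ Suc m / (fact (Suc n - m) * fact m)))"
      by (simp add: mult.assoc del: of_nat_Suc)
    then have "\<phi> $ Suc n = - (fact n * (\<Sum>m\<le>n. (\<psi> ^ (Suc n - m)) $ Suc m / (fact (Suc n - m) * fact m)))"
      using mult_left_cancel[OF of_nat_neq_0[of n, where 'a = complex]] by blast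
    then have "formal_borel \<phi> $ n = - (\<Sum>m\<le>n. (\<psi> ^ (Suc n - m)) $ Suc m / (fact (Suc n - m) * fact m))"
      by (simp add: formal_borel_nth)
    then show ?thesis by (simp add: Suc)
  qed
qed

section \<open>Taylor coefficients of convolutions\<close>

text \<open>
  Taylor coefficients of two functions agree up to order \<open>N\<close> as soon as the functions differ by
  \<open>O(z\<^sup>N\<^sup>+\<^sup>1)\<close>.  This replaces every interchange of a limit with the extraction of coefficients below.
\<close>

lemma fps_nth_eq_0_if_small:
  assumes d: "d has_fps_expansion D"
    and small: "\<forall>\<^sub>F z in nhds 0. norm (d z) \<le> B * norm z ^ Suc N" and n: "n \<le> N"
  shows "D $ n = (0 :: complex)"
proof (rule ccontr)
  assume nz: "D $ n \<noteq> 0"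
  define k where "k = subdegree D"
  have D: "D \<noteq> 0" using nz by auto
  have k: "k \<le> N" unfolding k_def using nz n subdegree_leI[of D n] by simp
  define e where "e = (\<lambda>x. if x = 0 then D $ k else d x / x ^ k)"
  have "e has_fps_expansion fps_shift k D"
    unfolding e_def by (rule has_fps_expansion_shift[OF d]) (simp_all add: k_def)
  then have "e \<midarrow>0\<rightarrow> D $ k"
    using has_fps_expansion_imp_tendsto_0[of e "fps_shift k D"] by (simp add: tendsto_nhds_iff)
  moreover have "e \<midarrow>0\<rightarrow> 0"
  proof (rule Lim_null_comparison)
    have "\<forall>\<^sub>F z in at 0. norm (d z) \<le> B * norm z ^ Suc N"
      using small by (rule eventually_nhds_conv_at[THEN iffD1, THEN conjunct1])
    moreover have "\<forall>\<^sub>F z in at (0::complex). z \<noteq> 0"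
      by (rule eventually_neq_at_within)
    ultimately show "\<forall>\<^sub>F z in at 0. norm (e z) \<le> B * norm z ^ (Suc N - k)"
    proof eventually_elim
      case (elim z)
      have "Suc N = (Suc N - k) + k" using k by simp
      then have "norm z ^ Suc N = norm z ^ (Suc N - k) * norm z ^ k"
        by (metis power_add)
      then show ?case using elim
        by (simp add: e_def norm_divide norm_power field_simps)
    qed
    have "isCont (\<lambda>z::complex. B * norm z ^ (Suc N - k)) 0"
      by (intro continuous_intros)
    then have "((\<lambda>z::complex. B * norm z ^ (Suc N - k)) \<longlongrightarrow> B * norm (0::complex) ^ (Suc N - k)) (at 0)"
      by (rule isContD)
    then show "((\<lambda>z. B * norm z ^ (Suc N - k)) \<longlongrightarrow> 0) (at (0::complex))"
      using k by (simp add: power_0_left)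
  qed
  ultimately have "D $ k = 0" using LIM_unique by blast
  then show False using D by (simp add: k_def)
qed

lemma fps_expansion_primitive:
  assumes h: "h holomorphic_on ball 0 r" and r: "r > 0"
  obtains P where "P holomorphic_on ball 0 r" "P 0 = 0"
    "\<And>z. z \<in> ball 0 r \<Longrightarrow> (P has_field_derivative h z) (at z)"
    "fps_expansion P 0 = fps_integral0 (fps_expansion h 0)"
proof -
  obtain Q where Q: "\<And>z. z \<in> ball 0 r \<Longrightarrow> (Q has_field_derivative h z) (at z)"
    using holomorphic_convex_primitive'[OF convex_ball open_ball h] by (metis at_within_open open_ball)
  define P where "P = (\<lambda>z. Q z - Q 0)"
  have P: "(P has_field_derivative h z) (at z)" if "z \<in> ball 0 r" for z
    unfolding P_def using Q[OF that] by (auto intro!: derivative_eq_intros)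
  have hol: "P holomorphic_on ball 0 r"
    using P unfolding holomorphic_on_open[OF open_ball] by blast
  define F where "F = fps_expansion P 0"
  have F: "P has_fps_expansion F"
    unfolding F_def using hol r by (intro has_fps_expansion_fps_expansion[of "ball 0 r"]) auto
  have "deriv P has_fps_expansion fps_deriv F"
    by (rule has_fps_expansion_deriv[OF F])
  moreover have "\<forall>\<^sub>F z in nhds 0. deriv P z = h z"
    by (rule eventually_mono[OF eventually_nhds_in_open[of "ball 0 r" 0]]) (use r P in \<open>auto intro: DERIV_imp_deriv\<close>)
  ultimately have "h has_fps_expansion fps_deriv F"
    using has_fps_expansion_cong by blast
  then have "fps_expansion h 0 = fps_deriv F"
    by (rule fps_expansion_eqI)
  moreover have "F $ 0 = 0"
    using has_fps_expansion_imp_0_eq_fps_nth_0[OF F] by (simp add: P_def)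
  ultimately have "F = fps_integral0 (fps_expansion h 0)"
    by (simp add: fps_integral0_deriv)
  then show ?thesis
    using that[of P] hol P by (simp add: P_def F_def)
qed

lemma contour_integral_linepath_primitive:
  assumes "\<And>z. z \<in> S \<Longrightarrow> (f has_field_derivative f' z) (at z)" "closed_segment a b \<subseteq> S"
  shows "contour_integral (linepath a b) f' = f b - f a"
  using contour_integral_primitive[of S f f' "linepath a b"] assms
  by (simp add: contour_integral_unique has_field_derivative_at_within)

text \<open>
  Cauchy's formula for repeated integration, proved by integrating by parts; it identifies the analytic
  convolution with \<open>\<eta>\<^sup>m / m!\<close> with the formal one.
\<close>

lemma contour_integral_power_kernel:
  assumes h: "h holomorphic_on ball 0 r" and r: "r > 0"
  obtains S where "S holomorphic_on ball 0 r"
    "fps_expansion S 0 = (fps_integral0 ^^ Suc m) (fps_expansion h 0)"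
    "\<And>\<zeta>. \<zeta> \<in> ball 0 r \<Longrightarrow> contour_integral (linepath 0 \<zeta>) (\<lambda>\<xi>. h \<xi> * ((\<zeta> - \<xi>) ^ m / fact m)) = S \<zeta>"
  using h
proof (induction m arbitrary: h thesis)
  case 0
  obtain P where P: "P holomorphic_on ball 0 r" "P 0 = 0"
    "\<And>z. z \<in> ball 0 r \<Longrightarrow> (P has_field_derivative h z) (at z)"
    "fps_expansion P 0 = fps_integral0 (fps_expansion h 0)"
    using fps_expansion_primitive[OF 0(2) r] by blast
  show ?case
  proof (rule 0(1))
    fix \<zeta> :: complex assume \<zeta>: "\<zeta> \<in> ball 0 r"
    have "closed_segment 0 \<zeta> \<subseteq> ball 0 r"
      using \<zeta> r by (intro closed_segment_subset) auto
    then have "contour_integral (linepath 0 \<zeta>) h = P \<zeta> - P 0"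
      by (intro contour_integral_linepath_primitive[where S = "ball 0 r"] P(3))
    then show "contour_integral (linepath 0 \<zeta>) (\<lambda>\<xi>. h \<xi> * ((\<zeta> - \<xi>) ^ 0 / fact 0)) = P \<zeta>"
      using P(2) by simp
  qed (use P in auto)
next
  case (Suc m)
  obtain P where P: "P holomorphic_on ball 0 r" "P 0 = 0"
    "\<And>z. z \<in> ball 0 r \<Longrightarrow> (P has_field_derivative h z) (at z)"
    "fps_expansion P 0 = fps_integral0 (fps_expansion h 0)"
    using fps_expansion_primitive[OF Suc.prems(2) r] by blast
  obtain S where S: "S holomorphic_on ball 0 r"
    "fps_expansion S 0 = (fps_integral0 ^^ Suc m) (fps_expansion P 0)"
    "\<And>\<zeta>. \<zeta> \<in> ball 0 r \<Longrightarrow> contour_integral (linepath 0 \<zeta>) (\<lambda>\<xi>. P \<xi> * ((\<zeta> - \<xi>) ^ m / fact m)) = S \<zeta>"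
    using Suc.IH P(1) by blast
  show ?case
  proof (rule Suc.prems(1)[OF S(1)])
    show "fps_expansion S 0 = (fps_integral0 ^^ Suc (Suc m)) (fps_expansion h 0)"
      unfolding S(2) P(4) funpow_Suc_right o_apply ..
    fix \<zeta> :: complex assume \<zeta>: "\<zeta> \<in> ball 0 r"
    have seg: "closed_segment 0 \<zeta> \<subseteq> ball 0 r"
      using \<zeta> r by (intro closed_segment_subset) auto
    define f where "f = (\<lambda>\<xi>. h \<xi> * ((\<zeta> - \<xi>) ^ Suc m / fact (Suc m)))"
    define g where "g = (\<lambda>\<xi>. P \<xi> * ((\<zeta> - \<xi>) ^ m / fact m))"
    define Q where "Q = (\<lambda>\<xi>. P \<xi> * ((\<zeta> - \<xi>) ^ Suc m / fact (Suc m)))"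
    have "(Q has_field_derivative f z - g z) (at z)" if "z \<in> ball 0 r" for z
    proof -
      have "((\<lambda>\<xi>. (\<zeta> - \<xi>) ^ Suc m / fact (Suc m)) has_field_derivative - ((\<zeta> - z) ^ m / fact m)) (at z)"
      proof -
        have "((\<lambda>\<xi>. (\<zeta> - \<xi>) ^ Suc m) has_field_derivative of_nat (Suc m) * ((0 - 1) * (\<zeta> - z) ^ (Suc m - Suc 0))) (at z)"
          by (intro DERIV_power DERIV_diff DERIV_const DERIV_ident)
        from DERIV_cdivide[OF this, of "fact (Suc m)"] show ?thesis
          by (simp add: divide_simps mult_ac del: of_nat_Suc power_Suc)
      qed
      from DERIV_mult[OF P(3)[OF that] this] show ?thesis
        unfolding Q_def f_def g_def by (simp add: mult.commute)
    qed
    then have "contour_integral (linepath 0 \<zeta>) (\<lambda>z. f z - g z) = Q \<zeta> - Q 0"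
      by (rule contour_integral_linepath_primitive[OF _ seg])
    then have 0: "contour_integral (linepath 0 \<zeta>) (\<lambda>z. f z - g z) = 0"
      using P(2) by (simp add: Q_def)
    have hol: "f holomorphic_on ball 0 r" "g holomorphic_on ball 0 r"
      unfolding f_def g_def using P(1) Suc.prems(2) by (auto intro!: holomorphic_intros)
    then have "f contour_integrable_on linepath 0 \<zeta>" "g contour_integrable_on linepath 0 \<zeta>"
      using seg by (auto intro!: contour_integrable_continuous_linepath holomorphic_on_imp_continuous_on
          intro: holomorphic_on_subset)
    then have "contour_integral (linepath 0 \<zeta>) f = contour_integral (linepath 0 \<zeta>) g"
      using 0 by (simp add: contour_integral_diff)
    then show "contour_integral (linepath 0 \<zeta>) (\<lambda>\<xi>. h \<xi> * ((\<zeta> - \<xi>) ^ Suc m / fact (Suc m))) = S \<zeta>"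
      using S(3)[OF \<zeta>] by (simp add: f_def g_def)
  qed
qed

section \<open>Contour integrals depending on a parameter\<close>

lemma continuous_on_contour_integral_linepath:
  fixes f :: "'a::metric_space \<Rightarrow> complex \<Rightarrow> complex"
  assumes "continuous_on (V \<times> closed_segment a b) (\<lambda>(x, t). f x t)"
  shows "continuous_on V (\<lambda>x. contour_integral (linepath a b) (f x))"
proof -
  have "continuous_on (V \<times> cbox 0 1) (\<lambda>(x, t). f x (linepath a b t) * (b - a))"
  proof -
    have "continuous_on (V \<times> cbox 0 1) (\<lambda>p. (\<lambda>(x, t). f x t) (fst p, linepath a b (snd p)))"
      by (rule continuous_on_compose2[OF assms])
        (auto intro!: continuous_intros simp: linepath_def linepath_in_path[unfolded linepath_def])
    then show ?thesis
      by (auto intro!: continuous_intros simp: case_prod_unfold)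
  qed
  from integral_continuous_on_param[OF this] show ?thesis
    by (simp add: contour_integral_integral)
qed

text \<open>
  Morera's theorem and Fubini: no derivative of the integrand with respect to the parameter is needed.
\<close>

lemma holomorphic_on_contour_integral_param:
  assumes U: "open U"
    and cont: "continuous_on (U \<times> closed_segment 0 1) (\<lambda>(z, t). h z t)"
    and hol: "\<And>t. t \<in> closed_segment 0 1 \<Longrightarrow> (\<lambda>z. h z t) holomorphic_on U"
  shows "(\<lambda>z. contour_integral (linepath 0 1) (h z)) holomorphic_on U"
proof -
  let ?I = "\<lambda>z. contour_integral (linepath 0 1) (h z)"
  have cI: "continuous_on U ?I"
    using cont by (rule continuous_on_contour_integral_linepath)
  have "?I analytic_on U"
  proof (rule Morera_triangle[OF cI U], intro allI impI)
    fix a b c assume abc: "convex hull {a, b, c} \<subseteq> U"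
    have seg: "closed_segment a b \<subseteq> U" "closed_segment b c \<subseteq> U" "closed_segment c a \<subseteq> U"
      using abc by (meson hull_subset segments_subset_convex_hull subset_trans)+
    define J where "J = (\<lambda>p q t. contour_integral (linepath p q) (\<lambda>z. h z t))"
    have swap: "contour_integral (linepath p q) ?I = contour_integral (linepath 0 1) (J p q)"
      if "closed_segment p q \<subseteq> U" for p q
      unfolding J_def
      by (rule contour_integral_swap) (use that in \<open>auto intro!: continuous_intros continuous_on_subset[OF cont]\<close>)
    have int: "J p q contour_integrable_on (linepath 0 1)" if "closed_segment p q \<subseteq> U" for p q
      unfolding J_def
    proof (intro contour_integrable_continuous_linepath continuous_on_contour_integral_linepath)
      have "continuous_on (closed_segment 0 1 \<times> closed_segment p q) (\<lambda>p. (\<lambda>(z, t). h z t) (snd p, fst p))"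
        by (rule continuous_on_compose2[OF cont]) (use that in \<open>auto intro!: continuous_intros\<close>)
      then show "continuous_on (closed_segment 0 1 \<times> closed_segment p q) (\<lambda>(x, t). h t x)"
        by (simp add: case_prod_unfold)
    qed
    have 0: "J a b t + J b c t + J c a t = 0" if "t \<in> closed_segment 0 1" for t
    proof -
      have "((\<lambda>z. h z t) has_contour_integral 0) (linepath a b +++ linepath b c +++ linepath c a)"
        using Cauchy_theorem_triangle holomorphic_on_subset[OF hol[OF that] abc] by blast
      moreover have "(\<lambda>z. h z t) contour_integrable_on linepath p q" if "closed_segment p q \<subseteq> U" for p q
        using hol[OF \<open>t \<in> _\<close>] that
        by (intro contour_integrable_continuous_linepath)
          (meson continuous_on_subset holomorphic_on_imp_continuous_on)
      ultimately show ?thesis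
        unfolding J_def using seg
        by (auto dest!: contour_integral_unique simp: contour_integral_join add.assoc)
    qed
    have "contour_integral (linepath 0 1) (J a b) + contour_integral (linepath 0 1) (J b c)
        + contour_integral (linepath 0 1) (J c a) = contour_integral (linepath 0 1) (\<lambda>t. J a b t + J b c t + J c a t)"
      using int[OF seg(1)] int[OF seg(2)] int[OF seg(3)]
      by (simp add: contour_integral_add contour_integrable_add)
    also have "\<dots> = contour_integral (linepath 0 1) (\<lambda>t. 0)"
      by (rule contour_integral_eq) (simp add: 0)
    finally show "contour_integral (linepath a b) ?I + contour_integral (linepath b c) ?I + contour_integral (linepath c a) ?I = 0"
      by (simp add: swap seg)
  qed
  then show ?thesis by (rule analytic_imp_holomorphic)
qed

section \<open>Holomorphy along curves\<close>

text \<open>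
  The solutions of the Volterra equation depend on \<open>\<lambda>\<close> and \<open>\<zeta>\<close>, and they are evaluated on \<open>\<lambda> = 0\<close> and on the
  diagonal \<open>\<lambda> = \<zeta>\<close>.  Holomorphy in two variables is therefore expressed as joint continuity
  together with holomorphy along all holomorphic curves.  This class is stable under products, parameter integrals and
  locally uniform limits by one-variable arguments.
\<close>

definition hol2 :: "(complex \<times> complex) set \<Rightarrow> (complex \<Rightarrow> complex \<Rightarrow> complex) \<Rightarrow> bool" where
  "hol2 S f \<longleftrightarrow> continuous_on S (\<lambda>(x, y). f x y) \<and>
     (\<forall>U l m. open U \<and> l holomorphic_on U \<and> m holomorphic_on U \<and> (\<forall>z\<in>U. (l z, m z) \<in> S)
        \<longrightarrow> (\<lambda>z. f (l z) (m z)) holomorphic_on U)"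

lemma hol2D:
  "hol2 S f \<Longrightarrow> open U \<Longrightarrow> l holomorphic_on U \<Longrightarrow> m holomorphic_on U \<Longrightarrow> (\<And>z. z \<in> U \<Longrightarrow> (l z, m z) \<in> S)
     \<Longrightarrow> (\<lambda>z. f (l z) (m z)) holomorphic_on U"
  by (auto simp: hol2_def)

lemma hol2_continuous_compose:
  assumes "hol2 S f" "continuous_on T p" "continuous_on T q" "\<And>x. x \<in> T \<Longrightarrow> (p x, q x) \<in> S"
  shows "continuous_on T (\<lambda>x. f (p x) (q x))"
proof -
  have S: "continuous_on S (\<lambda>(x, y). f x y)"
    using assms(1) by (simp add: hol2_def)
  have "continuous_on T (\<lambda>x. (\<lambda>(x, y). f x y) (p x, q x))"
    by (rule continuous_on_compose2[OF S continuous_on_Pair[OF assms(2,3)]]) (use assms(4) in auto)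
  then show ?thesis by simp
qed

lemma hol2I:
  assumes "continuous_on S (\<lambda>p. f (fst p) (snd p))"
    and "\<And>U l m. open U \<Longrightarrow> l holomorphic_on U \<Longrightarrow> m holomorphic_on U
        \<Longrightarrow> (\<And>z. z \<in> U \<Longrightarrow> (l z, m z) \<in> S) \<Longrightarrow> (\<lambda>z. f (l z) (m z)) holomorphic_on U"
  shows "hol2 S f"
  using assms(1) unfolding hol2_def case_prod_unfold by (blast intro: assms(2))

lemma hol2_continuous: "hol2 S f \<Longrightarrow> continuous_on S (\<lambda>p. f (fst p) (snd p))"
  by (simp add: hol2_def case_prod_unfold)

lemma hol2_mult:
  assumes "hol2 S f" "hol2 S g"
  shows "hol2 S (\<lambda>x y. f x y * g x y)"
proof (rule hol2I)
  show "continuous_on S (\<lambda>p. f (fst p) (snd p) * g (fst p) (snd p))"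
    by (intro continuous_on_mult hol2_continuous assms)
qed (intro holomorphic_on_mult hol2D[OF assms(1)] hol2D[OF assms(2)])

lemma hol2_add:
  assumes "hol2 S f" "hol2 S g"
  shows "hol2 S (\<lambda>x y. f x y + g x y)"
proof (rule hol2I)
  show "continuous_on S (\<lambda>p. f (fst p) (snd p) + g (fst p) (snd p))"
    by (intro continuous_on_add hol2_continuous assms)
qed (intro holomorphic_on_add hol2D[OF assms(1)] hol2D[OF assms(2)])

lemma hol2_sum:
  assumes "\<And>i. i \<in> A \<Longrightarrow> hol2 S (f i)"
  shows "hol2 S (\<lambda>x y. \<Sum>i\<in>A. f i x y)"
proof (rule hol2I)
  show "continuous_on S (\<lambda>p. \<Sum>i\<in>A. f i (fst p) (snd p))"
    by (intro continuous_on_sum hol2_continuous assms)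
qed (intro holomorphic_on_sum hol2D[OF assms])

lemma hol2_snd:
  assumes "f holomorphic_on D" "open D" "\<And>p. p \<in> S \<Longrightarrow> snd p \<in> D"
  shows "hol2 S (\<lambda>x y. f y)"
  unfolding hol2_def case_prod_unfold
proof (intro conjI allI impI)
  show "continuous_on S (\<lambda>p. f (snd p))"
    by (rule continuous_on_compose2[OF holomorphic_on_imp_continuous_on[OF assms(1)]])
      (use assms(3) in \<open>auto intro!: continuous_intros\<close>)
  fix U l m assume "open U \<and> l holomorphic_on U \<and> m holomorphic_on U \<and> (\<forall>z\<in>U. (l z, m z) \<in> S)"
  then have "(f \<circ> m) holomorphic_on U"
    by (intro holomorphic_on_compose_gen[OF _ assms(1)]) (use assms(3) in force)+
  then show "(\<lambda>z. f (m z)) holomorphic_on U" by (simp add: o_def)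
qed

lemma hol2_subset: "hol2 S f \<Longrightarrow> T \<subseteq> S \<Longrightarrow> hol2 T f"
  unfolding hol2_def by (meson continuous_on_subset subsetD)

lemma hol2_integral:
  assumes cont: "continuous_on (S \<times> closed_segment 0 1) (\<lambda>(p, t). f t (fst p) (snd p))"
    and hol: "\<And>t. t \<in> closed_segment 0 1 \<Longrightarrow> hol2 S (f t)"
  shows "hol2 S (\<lambda>x y. contour_integral (linepath 0 1) (\<lambda>t. f t x y))"
  unfolding hol2_def
proof (intro conjI allI impI)
  show "continuous_on S (\<lambda>(x, y). contour_integral (linepath 0 1) (\<lambda>t. f t x y))"
    unfolding case_prod_unfold using cont by (intro continuous_on_contour_integral_linepath) (simp add: case_prod_unfold)
  fix U l m assume U: "open U \<and> l holomorphic_on U \<and> m holomorphic_on U \<and> (\<forall>z\<in>U. (l z, m z) \<in> S)"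
  show "(\<lambda>z. contour_integral (linepath 0 1) (\<lambda>t. f t (l z) (m z))) holomorphic_on U"
  proof (rule holomorphic_on_contour_integral_param)
    have "continuous_on (U \<times> closed_segment 0 1) (\<lambda>p. (\<lambda>(p, t). f t (fst p) (snd p)) ((l (fst p), m (fst p)), snd p))"
    proof (rule continuous_on_compose2[OF cont])
      have "continuous_on (U \<times> closed_segment 0 1) (\<lambda>p. g (fst p))" if "g holomorphic_on U" for g
        by (rule continuous_on_compose2[OF holomorphic_on_imp_continuous_on[OF that]])
          (auto intro!: continuous_intros)
      then show "continuous_on (U \<times> closed_segment 0 1) (\<lambda>p. ((l (fst p), m (fst p)), snd p))"
        using U by (intro continuous_intros) auto
    qed (use U in auto)
    then show "continuous_on (U \<times> closed_segment 0 1) (\<lambda>(z, t). f t (l z) (m z))"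
      by (simp add: case_prod_unfold)
  qed (use U hol2D[OF hol] in auto)
qed

lemma hol2_uniform_limit:
  assumes hol: "\<And>N. hol2 S (s N)"
    and V: "\<And>p. p \<in> S \<Longrightarrow> open (V p)" "\<And>p. p \<in> S \<Longrightarrow> p \<in> V p"
    and lim: "\<And>p. p \<in> S \<Longrightarrow> uniform_limit (V p \<inter> S) (\<lambda>N q. s N (fst q) (snd q)) (\<lambda>q. g (fst q) (snd q)) sequentially"
  shows "hol2 S g"
proof (rule hol2I)
  have "continuous (at p within S) (\<lambda>q. g (fst q) (snd q))" if p: "p \<in> S" for p
  proof -
    have "continuous_on (V p \<inter> S) (\<lambda>q. g (fst q) (snd q))"
    proof (rule uniform_limit_theorem[OF _ _ trivial_limit_sequentially])
      show "\<forall>\<^sub>F N in sequentially. continuous_on (V p \<inter> S) (\<lambda>q. s N (fst q) (snd q))"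
        by (intro always_eventually allI continuous_on_subset[OF hol2_continuous[OF hol]] Int_lower2)
      show "uniform_limit (V p \<inter> S) (\<lambda>N q. s N (fst q) (snd q)) (\<lambda>q. g (fst q) (snd q)) sequentially"
        by (rule lim[OF p])
    qed
    moreover have pV: "p \<in> V p" "open (V p)" by (rule V[OF p])+
    ultimately have "continuous (at p within V p \<inter> S) (\<lambda>q. g (fst q) (snd q))"
      unfolding continuous_on_eq_continuous_within using p by (metis IntI)
    moreover have "at p within V p \<inter> S = at p within S"
      by (rule at_within_nhd[of p "V p"]) (use pV in auto)
    ultimately show ?thesis by simp
  qed
  then show "continuous_on S (\<lambda>q. g (fst q) (snd q))"
    by (simp add: continuous_on_eq_continuous_within)
next
  fix U l m
  assume U: "open U" "l holomorphic_on U" "m holomorphic_on U" "\<And>z. z \<in> U \<Longrightarrow> (l z, m z) \<in> S"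
  show "(\<lambda>z. g (l z) (m z)) holomorphic_on U"
  proof (rule holomorphic_uniform_sequence[OF U(1)])
    show "(\<lambda>z. s N (l z) (m z)) holomorphic_on U" for N
      by (rule hol2D[OF hol U])
    fix z assume z: "z \<in> U"
    let ?c = "\<lambda>z. (l z, m z)"
    have V': "open (V (?c z))" "?c z \<in> V (?c z)"
      by (rule V[OF U(4)[OF z]])+
    have ul: "uniform_limit (V (?c z) \<inter> S) (\<lambda>N q. s N (fst q) (snd q)) (\<lambda>q. g (fst q) (snd q)) sequentially"
      by (rule lim[OF U(4)[OF z]])
    have "continuous_on U ?c"
      using U by (intro continuous_on_Pair holomorphic_on_imp_continuous_on)
    then have "open (?c -` V (?c z) \<inter> U)"
      using V'(1) continuous_on_open_vimage[OF U(1)] by blast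
    moreover have "z \<in> ?c -` V (?c z) \<inter> U" using z V'(2) by simp
    ultimately obtain d where d: "d > 0" "cball z d \<subseteq> ?c -` V (?c z) \<inter> U"
      by (metis open_contains_cball)
    from d(2) have sub: "?c w \<in> V (?c z) \<inter> S" if "w \<in> cball z d" for w
      using that U(4) by auto
    have "uniform_limit (cball z d) (\<lambda>N w. s N (fst (?c w)) (snd (?c w))) (\<lambda>w. g (fst (?c w)) (snd (?c w))) sequentially"
      by (rule uniform_limit_compose'[OF ul funcsetI[OF sub]])
    then show "\<exists>d>0. cball z d \<subseteq> U \<and> uniform_limit (cball z d) (\<lambda>N z. s N (l z) (m z)) (\<lambda>z. g (l z) (m z)) sequentially"
      using d by (intro exI[of _ d] conjI) (auto simp only: fst_conv snd_conv)
  qed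
qed

lemma hol2_suminf:
  fixes f :: "nat \<Rightarrow> complex \<Rightarrow> complex \<Rightarrow> complex"
  assumes hol: "\<And>n. hol2 S (f n)"
    and V: "\<And>p. p \<in> S \<Longrightarrow> open (V p)" "\<And>p. p \<in> S \<Longrightarrow> p \<in> V p"
    and M: "\<And>p. p \<in> S \<Longrightarrow> summable (M p)"
      "\<And>p n q. p \<in> S \<Longrightarrow> q \<in> V p \<Longrightarrow> q \<in> S \<Longrightarrow> norm (f n (fst q) (snd q)) \<le> M p n"
  shows "hol2 S (\<lambda>x y. \<Sum>n. f n x y)"
proof (rule hol2_uniform_limit[OF _ V])
  show "hol2 S (\<lambda>x y. \<Sum>n<N. f n x y)" for N
    by (intro hol2_sum hol)
  fix p assume p: "p \<in> S"
  show "uniform_limit (V p \<inter> S) (\<lambda>N q. \<Sum>n<N. f n (fst q) (snd q)) (\<lambda>q. \<Sum>n. f n (fst q) (snd q)) sequentially"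
    by (rule Weierstrass_m_test[where M = "M p"]) (use p M in auto)
qed

section \<open>The entire kernel\<close>

text \<open>
  A bound \<open>|a| \<le> C |z|\<^sup>-\<^sup>2\<close> for the majorant series of \<open>a\<close> on all large circles \<open>|z| = R\<close>.  The double zero
  of \<open>a\<close> at infinity gives the exponent \<open>2\<close>, on which the growth estimates rest.
\<close>

lemma fps_weight_bound_exists:
  fixes a :: "complex fps"
  assumes conv: "fps_conv_radius a > 0" and a0: "a $ 0 = 0" and a1: "a $ 1 = 0"
  obtains R0 C :: real where "R0 > 0" "C \<ge> 0"
    "\<And>R k. R \<ge> R0 \<Longrightarrow> (\<Sum>i\<le>k. norm (a $ i) / R ^ i) \<le> C / R\<^sup>2"
proof -
  obtain r :: real where r: "r > 0" "ereal r < fps_conv_radius a"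
    using conv by (metis ereal_dense2 ereal_less(2) zero_ereal_def)
  define R0 where "R0 = 1 / r"
  have R0: "R0 > 0" using r by (simp add: R0_def)
  have sm: "summable (\<lambda>i. norm (a $ i) / R0 ^ i)"
    using norm_summable_fps[of "of_real r" a] r
    by (simp add: R0_def norm_mult norm_power power_divide)
  define C where "C = (\<Sum>i. norm (a $ i) / R0 ^ i) * R0\<^sup>2"
  have C: "C \<ge> 0" unfolding C_def using R0 by (intro mult_nonneg_nonneg suminf_nonneg sm) auto
  have "(\<Sum>i\<le>k. norm (a $ i) / R ^ i) \<le> C / R\<^sup>2" if R: "R \<ge> R0" for R k
  proof -
    have "norm (a $ i) / R ^ i \<le> (R0\<^sup>2 / R\<^sup>2) * (norm (a $ i) / R0 ^ i)" for i
    proof (cases "i < 2")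
      case True
      then have "i = 0 \<or> i = 1" by auto
      then show ?thesis using a0 a1 by auto
    next
      case False
      then obtain j where i: "i = j + 2" by (metis le_add_diff_inverse2 not_less)
      have "norm (a $ i) / R ^ j \<le> norm (a $ i) / R0 ^ j"
        using R R0 by (intro divide_left_mono power_mono mult_pos_pos zero_less_power) auto
      then have "norm (a $ i) / R ^ j / R\<^sup>2 \<le> norm (a $ i) / R0 ^ j / R\<^sup>2"
        by (intro divide_right_mono) auto
      moreover have "norm (a $ i) / R ^ i = norm (a $ i) / R ^ j / R\<^sup>2"
        by (simp add: i power_add power2_eq_square)
      moreover have "(R0\<^sup>2 / R\<^sup>2) * (norm (a $ i) / R0 ^ i) = norm (a $ i) / R0 ^ j / R\<^sup>2"
        using R0 by (simp add: i power_add field_simps power2_eq_square)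
      ultimately show ?thesis by linarith
    qed
    then have "(\<Sum>i\<le>k. norm (a $ i) / R ^ i) \<le> (R0\<^sup>2 / R\<^sup>2) * (\<Sum>i\<le>k. norm (a $ i) / R0 ^ i)"
      unfolding sum_distrib_left by (intro sum_mono)
    also have "\<dots> \<le> (R0\<^sup>2 / R\<^sup>2) * (\<Sum>i. norm (a $ i) / R0 ^ i)"
      using R0 by (intro mult_left_mono sum_le_suminf sm) auto
    finally show ?thesis by (simp add: C_def field_simps)
  qed
  then show ?thesis using that R0 C by blast
qed

text \<open>
  The series \<open>(e\<^sup>t - 1) / t\<close>; the two bounds serve the kernel with and without its factor \<open>\<eta>\<close>.
\<close>

lemma shifted_exp_series_le:
  fixes t :: real
  assumes "t \<ge> 0"
  shows "summable (\<lambda>m. t ^ m / fact (Suc m))" "(\<Sum>m. t ^ m / fact (Suc m)) \<le> exp t" "t * (\<Sum>m. t ^ m / fact (Suc m)) \<le> exp t"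
proof -
  have e: "(\<lambda>m. t ^ m / fact m) sums exp t"
    using exp_converges[of t] by (simp add: divide_inverse mult.commute scaleR_conv_of_real)
  have le: "t ^ m / fact (Suc m) \<le> t ^ m / fact m" for m
    using assms by (intro divide_left_mono fact_mono) auto
  show sm: "summable (\<lambda>m. t ^ m / fact (Suc m))"
    using le assms by (intro summable_comparison_test'[OF sums_summable[OF e]]) auto
  show "(\<Sum>m. t ^ m / fact (Suc m)) \<le> exp t"
    using suminf_le[OF le sm sums_summable[OF e]] e by (simp add: sums_iff)
  have "(\<lambda>m. t ^ Suc m / fact (Suc m)) sums (exp t - 1)"
    using e by (subst sums_Suc_iff) simp
  moreover have "(\<lambda>m. t ^ Suc m / fact (Suc m)) sums (t * (\<Sum>m. t ^ m / fact (Suc m)))"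
    using sums_mult[OF summable_sums[OF sm], of t] by simp
  ultimately have "t * (\<Sum>m. t ^ m / fact (Suc m)) = exp t - 1"
    by (rule sums_unique2[symmetric])
  then show "t * (\<Sum>m. t ^ m / fact (Suc m)) \<le> exp t" by simp
qed

locale parabolic =
  fixes a :: "complex fps" and R0 C :: real
  assumes a0: "a $ 0 = 0" and a1: "a $ 1 = 0" and R0: "R0 > 0" and C: "C \<ge> 0"
    and weight: "\<And>R k. R \<ge> R0 \<Longrightarrow> (\<Sum>i\<le>k. norm (a $ i) / R ^ i) \<le> C / R\<^sup>2"
begin

lemma norm_power_nth_le:
  assumes R: "R \<ge> R0"
  shows "norm ((a ^ n) $ k) \<le> R ^ k * (C / R\<^sup>2) ^ n"
proof (induction n arbitrary: k)
  case 0
  show ?case using R R0 by (cases k) auto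
next
  case (Suc n)
  have Rp: "R > 0" using R R0 by simp
  have "norm ((a ^ Suc n) $ k) \<le> (\<Sum>i\<le>k. norm (a $ i) * norm ((a ^ n) $ (k - i)))"
    unfolding power_Suc fps_mult_nth atLeast0AtMost
    by (rule order_trans[OF norm_sum]) (simp add: norm_mult)
  also have "\<dots> \<le> (\<Sum>i\<le>k. norm (a $ i) / R ^ i * (R ^ k * (C / R\<^sup>2) ^ n))"
  proof (rule sum_mono)
    fix i assume i: "i \<in> {..k}"
    have "norm (a $ i) * norm ((a ^ n) $ (k - i)) \<le> norm (a $ i) * (R ^ (k - i) * (C / R\<^sup>2) ^ n)"
      by (intro mult_left_mono Suc) auto
    also have "R ^ (k - i) = R ^ k / R ^ i"
      using i Rp by (simp add: power_diff)
    finally show "norm (a $ i) * norm ((a ^ n) $ (k - i)) \<le> norm (a $ i) / R ^ i * (R ^ k * (C / R\<^sup>2) ^ n)"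
      by (simp add: field_simps)
  qed
  also have "\<dots> = (\<Sum>i\<le>k. norm (a $ i) / R ^ i) * (R ^ k * (C / R\<^sup>2) ^ n)"
    by (simp add: sum_distrib_right)
  also have "\<dots> \<le> (C / R\<^sup>2) * (R ^ k * (C / R\<^sup>2) ^ n)"
    using Rp C by (intro mult_right_mono weight R) auto
  finally show ?case by (simp add: mult_ac)
qed

text \<open>
  The kernel is \<open>kern x \<eta> = \<Sum>\<^sub>m kappa x m \<eta>\<^sup>m / m!\<close>, the Borel transform of \<open>exp (x a) - 1\<close>.
\<close>

definition kappa :: "complex \<Rightarrow> nat \<Rightarrow> complex" where
  "kappa x m = (fps_exp x oo a) $ Suc m"

lemma kappa_altdef: "kappa x m = (\<Sum>n\<le>Suc m. x ^ n / fact n * (a ^ n) $ Suc m)"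
  by (simp add: kappa_def fps_compose_nth atLeast0AtMost)

lemma kappa_0 [simp]: "kappa x 0 = 0"
  using a1 by (simp add: kappa_altdef)

text \<open>
  The coefficients of \<open>exp (x a) - 1\<close> are dominated by those of the exponential of the majorant of \<open>|x| a\<close>.
\<close>

lemma norm_kappa_le:
  assumes R: "R \<ge> R0"
  shows "norm (kappa x m) \<le> R ^ Suc m * (exp (C * norm x / R\<^sup>2) - 1)"
proof -
  define y where "y = C * norm x / R\<^sup>2"
  have Rp: "R > 0" using R R0 by simp
  have y: "y \<ge> 0" using C by (simp add: y_def)
  have "norm (kappa x m) \<le> (\<Sum>n\<le>Suc m. norm (x ^ n / fact n * (a ^ n) $ Suc m))"
    unfolding kappa_altdef by (rule norm_sum)
  also have "\<dots> = (\<Sum>n\<in>{1..Suc m}. norm (x ^ n / fact n * (a ^ n) $ Suc m))"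
    by (rule sum.mono_neutral_right) (auto simp: not_less_eq_eq)
  also have "\<dots> \<le> (\<Sum>n\<in>{1..Suc m}. R ^ Suc m * (y ^ n / fact n))"
  proof (rule sum_mono)
    fix n
    have "norm (x ^ n / fact n * (a ^ n) $ Suc m) = norm x ^ n / fact n * norm ((a ^ n) $ Suc m)"
      by (simp add: norm_mult norm_divide norm_power)
    also have "\<dots> \<le> norm x ^ n / fact n * (R ^ Suc m * (C / R\<^sup>2) ^ n)"
      by (intro mult_left_mono norm_power_nth_le R) auto
    finally show "norm (x ^ n / fact n * (a ^ n) $ Suc m) \<le> R ^ Suc m * (y ^ n / fact n)"
      by (simp add: y_def power_divide power_mult_distrib field_simps)
  qed
  also have "\<dots> = R ^ Suc m * (\<Sum>n\<in>{1..Suc m}. y ^ n / fact n)"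
    by (simp only: sum_distrib_left)
  also have "(\<Sum>n\<in>{1..Suc m}. y ^ n / fact n) = (\<Sum>n\<le>Suc m. y ^ n / fact n) - 1"
  proof -
    have "{..Suc m} = insert 0 {1..Suc m}" by auto
    then show ?thesis by (simp del: sum.cl_ivl_Suc)
  qed
  also have "R ^ Suc m * \<dots> \<le> R ^ Suc m * (exp y - 1)"
  proof -
    have "(\<Sum>n\<le>Suc m. y ^ n / fact n) \<le> (\<Sum>n. y ^ n / fact n)"
      using y summable_exp[of y] by (intro sum_le_suminf) (auto simp: field_simps)
    then show ?thesis
      using Rp by (intro mult_left_mono) (auto simp: exp_def divide_inverse mult.commute scaleR_conv_of_real)
  qed
  finally show ?thesis by (simp add: y_def)
qed

text \<open>
  As \<open>a\<close> has no term in \<open>z\<^sup>-\<^sup>1\<close>, the kernel vanishes for \<open>\<eta> = 0\<close>.  It is written as \<open>\<eta> * kern1 x \<eta>\<close> in order to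
  cancel the zero of \<open>e\<^sup>\<zeta> - 1\<close> at the origin.
\<close>

definition kern1 :: "complex \<Rightarrow> complex \<Rightarrow> complex" where
  "kern1 x \<eta> = (\<Sum>m. kappa x (Suc m) / fact (Suc m) * \<eta> ^ m)"

definition kern :: "complex \<Rightarrow> complex \<Rightarrow> complex" where
  "kern x \<eta> = \<eta> * kern1 x \<eta>"

lemma norm_kern1_term_le:
  assumes R: "R \<ge> R0" and x: "norm x \<le> X" and \<eta>: "norm \<eta> \<le> Y"
  shows "norm (kappa x (Suc m) / fact (Suc m) * \<eta> ^ m)
    \<le> R\<^sup>2 * (exp (C * X / R\<^sup>2) - 1) * ((R * Y) ^ m / fact (Suc m))"
proof -
  have Rp: "R > 0" using R R0 by simp
  have "norm (kappa x (Suc m)) \<le> R ^ Suc (Suc m) * (exp (C * norm x / R\<^sup>2) - 1)"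
    by (rule norm_kappa_le[OF R])
  also have "\<dots> \<le> R ^ Suc (Suc m) * (exp (C * X / R\<^sup>2) - 1)"
    using Rp C x by (intro mult_left_mono diff_right_mono) (auto intro!: divide_right_mono mult_left_mono)
  finally have 1: "norm (kappa x (Suc m)) \<le> R ^ Suc (Suc m) * (exp (C * X / R\<^sup>2) - 1)" .
  have "norm (kappa x (Suc m) / fact (Suc m) * \<eta> ^ m) = norm (kappa x (Suc m)) / fact (Suc m) * norm \<eta> ^ m"
    by (simp add: norm_mult norm_divide norm_power del: fact_Suc)
  also have "\<dots> \<le> R ^ Suc (Suc m) * (exp (C * X / R\<^sup>2) - 1) / fact (Suc m) * Y ^ m"
    using order_trans[OF norm_ge_zero 1]
    by (intro mult_mono divide_right_mono 1 power_mono \<eta> divide_nonneg_nonneg) (auto simp del: fact_Suc power_Suc)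
  also have "\<dots> = R\<^sup>2 * (exp (C * X / R\<^sup>2) - 1) * ((R * Y) ^ m / fact (Suc m))"
    by (simp add: power_mult_distrib power2_eq_square field_simps del: fact_Suc)
  finally show ?thesis .
qed

lemma
  assumes R: "R \<ge> R0" and x: "norm x \<le> X"
  shows norm_kern1_le: "norm (kern1 x \<eta>) \<le> R\<^sup>2 * (exp (C * X / R\<^sup>2) - 1) * exp (R * norm \<eta>)"
    and norm_kern_le: "norm (kern x \<eta>) \<le> R * (exp (C * X / R\<^sup>2) - 1) * exp (R * norm \<eta>)"
proof -
  have Rp: "R > 0" using R R0 by simp
  have X: "X \<ge> 0" using x order_trans norm_ge_zero by blast
  define B where "B = exp (C * X / R\<^sup>2) - 1"
  have B: "B \<ge> 0" using C X by (simp add: B_def)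
  define S where "S = (\<Sum>m. (R * norm \<eta>) ^ m / fact (Suc m))"
  have t: "R * norm \<eta> \<ge> 0" using Rp by simp
  have 0: "norm (kern1 x \<eta>) \<le> R\<^sup>2 * B * S"
    unfolding kern1_def S_def suminf_mult[OF shifted_exp_series_le(1)[OF t], symmetric] B_def
    by (intro norm_suminf_le summable_mult shifted_exp_series_le(1)[OF t] norm_kern1_term_le R x order_refl)
  also have "\<dots> \<le> R\<^sup>2 * B * exp (R * norm \<eta>)"
    unfolding S_def by (intro mult_left_mono shifted_exp_series_le(2)[OF t]) (use B in auto)
  finally show "norm (kern1 x \<eta>) \<le> R\<^sup>2 * (exp (C * X / R\<^sup>2) - 1) * exp (R * norm \<eta>)"
    by (simp add: B_def)
  have "norm (kern x \<eta>) \<le> norm \<eta> * (R\<^sup>2 * B * S)"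
    unfolding kern_def norm_mult by (intro mult_left_mono 0) auto
  also have "\<dots> = R * B * (R * norm \<eta> * S)"
    by (simp add: power2_eq_square)
  also have "\<dots> \<le> R * B * exp (R * norm \<eta>)"
    unfolding S_def by (intro mult_left_mono shifted_exp_series_le(3)[OF t]) (use B Rp in auto)
  finally show "norm (kern x \<eta>) \<le> R * (exp (C * X / R\<^sup>2) - 1) * exp (R * norm \<eta>)"
    by (simp add: B_def)
qed

lemma kern1_summable: "summable (\<lambda>m. kappa x (Suc m) / fact (Suc m) * \<eta> ^ m)"
proof (rule summable_comparison_test')
  show "summable (\<lambda>m. R0\<^sup>2 * (exp (C * norm x / R0\<^sup>2) - 1) * ((R0 * norm \<eta>) ^ m / fact (Suc m)))"
    using R0 by (intro summable_mult shifted_exp_series_le(1)) auto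
  show "norm (kappa x (Suc m) / fact (Suc m) * \<eta> ^ m)
      \<le> R0\<^sup>2 * (exp (C * norm x / R0\<^sup>2) - 1) * ((R0 * norm \<eta>) ^ m / fact (Suc m))" for m
    by (intro norm_kern1_term_le order_refl)
qed

lemma hol2_kern1: "hol2 UNIV kern1"
proof -
  have "hol2 UNIV (\<lambda>x \<eta>. \<Sum>m. kappa x (Suc m) / fact (Suc m) * \<eta> ^ m)"
  proof (rule hol2_suminf)
    show "hol2 UNIV (\<lambda>x \<eta>. kappa x (Suc m) / fact (Suc m) * \<eta> ^ m)" for m
      unfolding kappa_altdef
      by (rule hol2I) (auto intro!: continuous_intros holomorphic_intros simp del: fact_Suc)
    show "open (ball p 1)" "p \<in> ball p 1" for p :: "complex \<times> complex" by auto
    fix p q :: "complex \<times> complex" and m assume "q \<in> ball p 1"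
    then have q: "norm q \<le> norm p + 1"
      using norm_triangle_ineq2[of q p] by (simp add: dist_norm norm_minus_commute)
    have "norm (fst q) \<le> norm p + 1" "norm (snd q) \<le> norm p + 1"
      using norm_fst_le[of "fst q" "snd q"] norm_snd_le[of "snd q" "fst q"] q by auto
    then show "norm (kappa (fst q) (Suc m) / fact (Suc m) * snd q ^ m)
      \<le> R0\<^sup>2 * (exp (C * (norm p + 1) / R0\<^sup>2) - 1) * ((R0 * (norm p + 1)) ^ m / fact (Suc m))"
      by (intro norm_kern1_term_le order_refl)
  next
    show "summable (\<lambda>m. R0\<^sup>2 * (exp (C * (norm p + 1) / R0\<^sup>2) - 1) * ((R0 * (norm p + 1)) ^ m / fact (Suc m)))"
      for p :: "complex \<times> complex"
      using R0 by (intro summable_mult shifted_exp_series_le(1)) auto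
  qed
  then show ?thesis by (simp add: kern1_def [abs_def])
qed

lemma hol2_kern: "hol2 UNIV kern"
  unfolding kern_def [abs_def]
  by (intro hol2_mult hol2_kern1 hol2_snd[where D = UNIV]) (auto intro!: holomorphic_intros)

lemma kern_sums: "(\<lambda>m. kappa x m / fact m * \<eta> ^ m) sums kern x \<eta>"
proof -
  have "(\<lambda>m. \<eta> * (kappa x (Suc m) / fact (Suc m) * \<eta> ^ m)) sums kern x \<eta>"
    unfolding kern_def kern1_def by (intro sums_mult summable_sums kern1_summable)
  then have "(\<lambda>m. kappa x (Suc m) / fact (Suc m) * \<eta> ^ Suc m) sums kern x \<eta>"
    by (simp add: mult_ac)
  then show ?thesis by (subst (asm) sums_Suc_iff) simp
qed

text \<open>
  The error of truncating the kernel, uniform for \<open>x\<close> in a bounded set; with it, the Taylor coefficients of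
  the Volterra integral are computed from finitely many terms.
\<close>

lemma kern_tail_le:
  assumes x: "norm x \<le> X" and \<eta>: "norm \<eta> \<le> 1"
  shows "norm (kern x \<eta> - (\<Sum>m\<le>N. kappa x m / fact m * \<eta> ^ m))
    \<le> R0 * (exp (C * X / R0\<^sup>2) - 1) * exp R0 * norm \<eta> ^ Suc N"
proof -
  define B where "B = R0 * (exp (C * X / R0\<^sup>2) - 1)"
  have X: "X \<ge> 0" using x order_trans norm_ge_zero by blast
  have B: "B \<ge> 0" using R0 C X by (simp add: B_def)
  have t: "norm (kappa x (m + Suc N) / fact (m + Suc N) * \<eta> ^ (m + Suc N)) \<le> B * (R0 ^ (m + Suc N) / fact (m + Suc N)) * norm \<eta> ^ Suc N" for m
  proof -
    have "norm (kappa x (m + Suc N)) \<le> R0 ^ Suc (m + Suc N) * (exp (C * norm x / R0\<^sup>2) - 1)"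
      by (rule norm_kappa_le) simp
    also have "\<dots> \<le> R0 ^ Suc (m + Suc N) * (exp (C * X / R0\<^sup>2) - 1)"
      using R0 C x by (intro mult_left_mono diff_right_mono) (auto intro!: divide_right_mono mult_left_mono)
    finally have 1: "norm (kappa x (m + Suc N)) \<le> B * R0 ^ (m + Suc N)" by (simp add: B_def mult_ac)
    have 2: "norm \<eta> ^ (m + Suc N) \<le> norm \<eta> ^ Suc N"
      using \<eta> by (intro power_decreasing) auto
    have "norm (kappa x (m + Suc N) / fact (m + Suc N) * \<eta> ^ (m + Suc N)) = norm (kappa x (m + Suc N)) / fact (m + Suc N) * norm \<eta> ^ (m + Suc N)"
      by (simp add: norm_mult norm_divide norm_power del: fact_Suc add_Suc_right)
    also have "\<dots> \<le> B * R0 ^ (m + Suc N) / fact (m + Suc N) * norm \<eta> ^ Suc N"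
      using R0 B by (intro mult_mono divide_right_mono 1 2) (auto intro!: divide_nonneg_nonneg mult_nonneg_nonneg)
    finally show ?thesis by simp
  qed
  have e: "(\<lambda>m. R0 ^ m / fact m) sums exp R0"
    using exp_converges[of R0] by (simp add: divide_inverse mult.commute scaleR_conv_of_real)
  have se: "summable (\<lambda>m. R0 ^ (m + Suc N) / fact (m + Suc N))"
    by (rule summable_ignore_initial_segment[OF sums_summable[OF e]])
  have "kern x \<eta> - (\<Sum>m\<le>N. kappa x m / fact m * \<eta> ^ m) = (\<Sum>m. kappa x (m + Suc N) / fact (m + Suc N) * \<eta> ^ (m + Suc N))"
    using suminf_minus_initial_segment[OF sums_summable[OF kern_sums[where x = x and \<eta> = \<eta>]], of "Suc N"]
      sums_unique[OF kern_sums[where x = x and \<eta> = \<eta>]]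
    by (simp only: lessThan_Suc_atMost)
  also have "norm \<dots> \<le> (\<Sum>m. B * (R0 ^ (m + Suc N) / fact (m + Suc N)) * norm \<eta> ^ Suc N)"
    by (intro norm_suminf_le t summable_mult summable_mult2 se)
  also have "\<dots> = B * (\<Sum>m. R0 ^ (m + Suc N) / fact (m + Suc N)) * norm \<eta> ^ Suc N"
    by (subst suminf_mult2[symmetric, OF summable_mult[OF se]], subst suminf_mult[OF se]) simp
  also have "\<dots> \<le> B * exp R0 * norm \<eta> ^ Suc N"
  proof (intro mult_right_mono mult_left_mono)
    have "(\<Sum>m. R0 ^ (m + Suc N) / fact (m + Suc N)) = exp R0 - (\<Sum>m<Suc N. R0 ^ m / fact m)"
      using suminf_minus_initial_segment[OF sums_summable[OF e], of "Suc N"] sums_unique[OF e] by simp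
    also have "\<dots> \<le> exp R0" using R0 by (simp add: sum_nonneg del: sum.lessThan_Suc)
    finally show "(\<Sum>m. R0 ^ (m + Suc N) / fact (m + Suc N)) \<le> exp R0" .
  qed (use B in auto)
  finally show ?thesis by (simp add: B_def)
qed

end

section \<open>Linear Volterra equations on starlike regions\<close>

text \<open>
  Segments from the centre are rescaled to \<open>[0, 1]\<close>.  The integration variable then ranges over a set that is
  independent of \<open>\<zeta>\<close>.
\<close>

lemma contour_integral_linepath_unit:
  "contour_integral (linepath c \<zeta>) g = (\<zeta> - c) * contour_integral (linepath 0 1) (\<lambda>t. g (c + t * (\<zeta> - c)))"
proof -
  have "linepath c \<zeta> x = c + linepath 0 1 x * (\<zeta> - c)" for x
    by (simp add: linepath_def scaleR_conv_of_real algebra_simps)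
  then show ?thesis
    by (simp add: contour_integral_integral mult.commute del: linepath_0')
qed

lemma norm_contour_integral_unit_le:
  assumes f: "continuous_on (closed_segment 0 1) f"
    and le: "\<And>t. t \<in> {0..1} \<Longrightarrow> norm (f (of_real t)) \<le> g t"
    and g: "(g has_integral I) {0..1}"
  shows "norm (contour_integral (linepath 0 1) f) \<le> I"
proof -
  have l: "linepath 0 1 x = complex_of_real x" for x
    by (simp add: linepath_def scaleR_conv_of_real)
  have "f contour_integrable_on linepath 0 1"
    by (rule contour_integrable_continuous_linepath[OF f])
  then have "(\<lambda>t. f (of_real t)) integrable_on {0..1}"
    by (simp add: contour_integrable_on l scaleR_conv_of_real)
  then have "norm (integral {0..1} (\<lambda>t. f (of_real t))) \<le> integral {0..1} g"
    by (rule integral_norm_bound_integral) (use g le in auto)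
  moreover have "integral {0..1} g = I" using g by blast
  ultimately show ?thesis
    by (simp only: contour_integral_integral l vector_derivative_linepath_at) simp
qed

lemma has_integral_power_unit: "((\<lambda>t::real. t ^ n) has_integral (1 / Suc n)) {0..1}"
proof -
  have "((\<lambda>t. t ^ Suc n / Suc n) has_vector_derivative x ^ n) (at x within {0..1})" for x :: real
    using DERIV_cdivide[OF DERIV_pow[of "Suc n" x "{0..1}"], of "real (Suc n)"]
    unfolding has_real_derivative_iff_has_vector_derivative by (simp del: of_nat_Suc power_Suc)
  then have "((\<lambda>t::real. t ^ n) has_integral (1 ^ Suc n / Suc n - 0 ^ Suc n / Suc n)) {0..1}"
    by (intro fundamental_theorem_of_calculus) auto
  then show ?thesis by simp
qed

lemma unit_segment_iff: "t \<in> closed_segment 0 1 \<longleftrightarrow> (\<exists>s\<in>{0..1}. t = complex_of_real s)"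
  by (auto simp: closed_segment_def scaleR_conv_of_real)

definition starlike_at :: "complex \<Rightarrow> complex set \<Rightarrow> bool" where
  "starlike_at c D \<longleftrightarrow> (\<forall>\<zeta>\<in>D. closed_segment c \<zeta> \<subseteq> D)"

lemma starlike_atD:
  assumes "starlike_at c D" "\<zeta> \<in> D" "t \<in> closed_segment 0 1"
  shows "c + t * (\<zeta> - c) \<in> D"
proof -
  obtain s where s: "s \<in> {0..1}" "t = of_real s" using assms(3) unit_segment_iff by blast
  have "c + t * (\<zeta> - c) = (1 - s) *\<^sub>R c + s *\<^sub>R \<zeta>"
    by (simp add: s scaleR_conv_of_real algebra_simps)
  then have "c + t * (\<zeta> - c) \<in> closed_segment c \<zeta>"
    using s(1) by (auto simp: closed_segment_def)
  then show ?thesis using assms by (auto simp: starlike_at_def)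
qed

lemma convex_starlike_at: "convex D \<Longrightarrow> c \<in> D \<Longrightarrow> starlike_at c D"
  by (simp add: starlike_at_def closed_segment_subset)

context parabolic begin

text \<open>
  The kernel \<open>K(l - \<xi>, \<zeta> - \<xi>)\<close> at the point \<open>\<xi> = c + t (\<zeta> - c)\<close> of the segment from \<open>c\<close> to \<open>\<zeta>\<close>.
\<close>

definition vkern :: "complex \<Rightarrow> complex \<Rightarrow> complex \<Rightarrow> complex \<Rightarrow> complex" where
  "vkern c l \<zeta> t = kern (l - (c + t * (\<zeta> - c))) ((1 - t) * (\<zeta> - c))"

text \<open>
  The Volterra operator divided by \<open>E(\<zeta>) = e\<^sup>\<zeta> - 1\<close>.  The function \<open>e\<close> stands for \<open>(\<zeta> - c) / E(\<zeta>)\<close>: it remains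
  holomorphic at \<open>\<zeta> = c\<close> when \<open>c = 0\<close>, so that the singular equation at the origin and the regular ones
  elsewhere are instances of the same problem.
\<close>

definition vop :: "(complex \<Rightarrow> complex) \<Rightarrow> complex \<Rightarrow> complex \<Rightarrow> (complex \<Rightarrow> complex) \<Rightarrow> complex \<Rightarrow> complex" where
  "vop e c l f \<zeta> = e \<zeta> * contour_integral (linepath 0 1) (\<lambda>t. vkern c l \<zeta> t * f (c + t * (\<zeta> - c)))"

lemma vop_conv_contour_integral:
  assumes "e \<zeta> * E = \<zeta> - c"
  shows "E * vop e c l f \<zeta> = contour_integral (linepath c \<zeta>) (\<lambda>\<xi>. kern (l - \<xi>) (\<zeta> - \<xi>) * f \<xi>)"
proof -
  have *: "\<zeta> - (c + t * (\<zeta> - c)) = (1 - t) * (\<zeta> - c)" for t by (simp add: algebra_simps)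
  have "E * vop e c l f \<zeta> = (\<zeta> - c) * contour_integral (linepath 0 1) (\<lambda>t. vkern c l \<zeta> t * f (c + t * (\<zeta> - c)))"
    unfolding vop_def assms[symmetric] by simp
  then show ?thesis
    unfolding contour_integral_linepath_unit[of c \<zeta>] vkern_def * .
qed

end

locale volterra = parabolic +
  fixes D :: "complex set" and c :: complex and e :: "complex \<Rightarrow> complex"
  assumes D: "open D" "c \<in> D" "starlike_at c D" and e: "e holomorphic_on D"
begin

lemma continuous_on_kern_compose:
  "continuous_on T p \<Longrightarrow> continuous_on T q \<Longrightarrow> continuous_on T (\<lambda>x. kern (p x) (q x))"
  by (rule hol2_continuous_compose[OF hol2_kern]) auto

lemma continuous_on_vop_integrand:
  assumes f: "continuous_on D f" and \<zeta>: "\<zeta> \<in> D"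
  shows "continuous_on (closed_segment 0 1) (\<lambda>t. vkern c l \<zeta> t * f (c + t * (\<zeta> - c)))"
  unfolding vkern_def
  by (intro continuous_on_mult continuous_on_kern_compose continuous_on_compose2[OF f])
    (auto intro!: continuous_intros starlike_atD D \<zeta>)

lemma hol2_vop:
  assumes F: "hol2 (UNIV \<times> D) F"
  shows "hol2 (UNIV \<times> D) (\<lambda>l \<zeta>. vop e c l (F l) \<zeta>)"
  unfolding vop_def
proof (rule hol2_mult)
  show "hol2 (UNIV \<times> D) (\<lambda>l \<zeta>. e \<zeta>)"
    by (rule hol2_snd[OF e D(1)]) auto
  show "hol2 (UNIV \<times> D) (\<lambda>l \<zeta>. contour_integral (linepath 0 1) (\<lambda>t. vkern c l \<zeta> t * F l (c + t * (\<zeta> - c))))"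
  proof (rule hol2_integral)
    show "continuous_on ((UNIV \<times> D) \<times> closed_segment 0 1)
        (\<lambda>(p, t). vkern c (fst p) (snd p) t * F (fst p) (c + t * (snd p - c)))"
      unfolding case_prod_unfold vkern_def
      by (intro continuous_on_mult continuous_on_kern_compose hol2_continuous_compose[OF F])
        (auto intro!: continuous_intros starlike_atD D)
    fix t :: complex assume t: "t \<in> closed_segment 0 1"
    show "hol2 (UNIV \<times> D) (\<lambda>l \<zeta>. vkern c l \<zeta> t * F l (c + t * (\<zeta> - c)))"
      unfolding vkern_def
    proof (rule hol2I)
      show "continuous_on (UNIV \<times> D) (\<lambda>p. kern (fst p - (c + t * (snd p - c))) ((1 - t) * (snd p - c)) *
            F (fst p) (c + t * (snd p - c)))"
        by (intro continuous_on_mult continuous_on_kern_compose hol2_continuous_compose[OF F])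
          (auto intro!: continuous_intros starlike_atD D t)
      fix U l m
      assume U: "open U" "l holomorphic_on U" "m holomorphic_on U" "\<And>z. z \<in> U \<Longrightarrow> (l z, m z) \<in> UNIV \<times> D"
      show "(\<lambda>z. kern (l z - (c + t * (m z - c))) ((1 - t) * (m z - c)) * F (l z) (c + t * (m z - c))) holomorphic_on U"
        by (intro holomorphic_on_mult hol2D[OF hol2_kern U(1)] hol2D[OF F U(1)])
          (use U in \<open>auto intro!: holomorphic_intros starlike_atD D t\<close>)
    qed
  qed
qed

text \<open>
  Locally, one application of the Volterra operator gains the factor \<open>A |\<zeta> - c| / (n + 1)\<close>.  The sets \<open>S\<close> are
  starlike hulls of small discs, as the operator at \<open>\<zeta>\<close> uses the whole segment from \<open>c\<close> to \<open>\<zeta>\<close>.  The gain persists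
  at \<open>c = 0\<close>, where \<open>e\<close> does not vanish, because the kernel contributes the factor \<open>\<zeta> - \<xi>\<close>.
\<close>

lemma local_estimate:
  assumes \<zeta>0: "\<zeta>0 \<in> D"
  obtains r S A Y where "r > 0" "cball \<zeta>0 r \<subseteq> S" "S \<subseteq> D" "compact S" "starlike_at c S" "A \<ge> 0"
    "\<And>\<zeta>. \<zeta> \<in> S \<Longrightarrow> norm (\<zeta> - c) \<le> Y"
    "\<And>l \<zeta> f P n. norm (l - l0) \<le> 1 \<Longrightarrow> \<zeta> \<in> S \<Longrightarrow> continuous_on D f \<Longrightarrow>
      (\<And>\<xi>. \<xi> \<in> S \<Longrightarrow> norm (f \<xi>) \<le> P * (A * norm (\<xi> - c)) ^ n / fact n)
      \<Longrightarrow> norm (vop e c l f \<zeta>) \<le> P * (A * norm (\<zeta> - c)) ^ Suc n / fact (Suc n)"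
proof -
  obtain r where r: "r > 0" "cball \<zeta>0 r \<subseteq> D"
    using D(1) \<zeta>0 open_contains_cball by blast
  define S where "S = (\<lambda>(t, \<zeta>). c + t * (\<zeta> - c)) ` (closed_segment 0 1 \<times> cball \<zeta>0 r)"
  have S1: "cball \<zeta>0 r \<subseteq> S"
  proof
    fix \<zeta> assume "\<zeta> \<in> cball \<zeta>0 r"
    then show "\<zeta> \<in> S" unfolding S_def by (intro image_eqI[where x = "(1, \<zeta>)"]) auto
  qed
  have S2: "S \<subseteq> D"
    unfolding S_def using r starlike_atD[OF D(3)] by auto
  have S3: "compact S"
    unfolding S_def case_prod_unfold
    by (intro compact_continuous_image compact_Times continuous_intros) auto
  have S4: "c + t * (\<zeta> - c) \<in> S" if "\<zeta> \<in> S" "t \<in> closed_segment 0 1" for t \<zeta>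
  proof -
    obtain s \<xi> where s: "s \<in> closed_segment 0 1" "\<xi> \<in> cball \<zeta>0 r" "\<zeta> = c + s * (\<xi> - c)"
      using \<open>\<zeta> \<in> S\<close> by (auto simp: S_def)
    have "t * s \<in> closed_segment 0 1"
      using s(1) that(2) by (auto simp: unit_segment_iff mult_le_one intro!: bexI[of _ "_ * _"])
    moreover have "c + t * (\<zeta> - c) = c + (t * s) * (\<xi> - c)"
      by (simp add: s)
    ultimately show ?thesis
      unfolding S_def using s(2) by (intro image_eqI[where x = "(t * s, \<xi>)"]) auto
  qed
  have S4': "starlike_at c S"
    unfolding starlike_at_def
  proof safe
    fix \<zeta> x assume "\<zeta> \<in> S" "x \<in> closed_segment c \<zeta>"
    then obtain u where u: "x = (1 - u) *\<^sub>R c + u *\<^sub>R \<zeta>" "0 \<le> u" "u \<le> 1"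
      by (auto simp: closed_segment_def)
    have "of_real u \<in> closed_segment 0 (1::complex)"
      using u(2,3) unfolding unit_segment_iff by (intro bexI[of _ u]) simp_all
    from S4[OF \<open>\<zeta> \<in> S\<close> this] show "x \<in> S"
      unfolding u(1) by (simp add: scaleR_conv_of_real algebra_simps)
  qed
  have "bounded ((\<lambda>\<zeta>. \<zeta> - c) ` S)" "bounded (e ` S)"
    using S2 S3 by (auto intro!: compact_imp_bounded compact_continuous_image continuous_intros
        intro: continuous_on_subset[OF holomorphic_on_imp_continuous_on[OF e]])
  then obtain Y E where Y: "\<And>\<zeta>. \<zeta> \<in> S \<Longrightarrow> norm (\<zeta> - c) \<le> Y" and E: "\<And>\<zeta>. \<zeta> \<in> S \<Longrightarrow> norm (e \<zeta>) \<le> E"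
    by (auto simp: bounded_iff)
  have Y0: "Y \<ge> 0" and E0: "E \<ge> 0"
    using Y E \<zeta>0 S1 r(1) order_trans[OF norm_ge_zero] by (meson centre_in_cball less_imp_le subsetD)+
  define X where "X = norm l0 + 1 + norm c + Y"
  define K where "K = R0\<^sup>2 * (exp (C * X / R0\<^sup>2) - 1) * exp (R0 * Y)"
  have K0: "K \<ge> 0" unfolding K_def X_def using C Y0 by (intro mult_nonneg_nonneg) auto
  define A where "A = E * K"
  have A0: "A \<ge> 0" using E0 K0 by (simp add: A_def)
  have vk: "norm (vkern c l \<zeta> (of_real s)) \<le> norm (\<zeta> - c) * K"
    if "norm (l - l0) \<le> 1" "\<zeta> \<in> S" "s \<in> {0..1}" for l \<zeta> s
  proof -
    have "norm (1 - complex_of_real s) = norm (complex_of_real (1 - s))" by simp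
    also have "\<dots> = 1 - s" using that(3) by (simp only: norm_of_real) simp
    finally have n: "norm (1 - complex_of_real s) = 1 - s" .
    have s: "norm (of_real s * (\<zeta> - c)) \<le> Y" "norm ((1 - of_real s) * (\<zeta> - c)) \<le> norm (\<zeta> - c)"
      using that(3) order_trans[OF mult_left_le_one_le Y[OF that(2)], of s] mult_left_le_one_le[of "norm (\<zeta> - c)" "1 - s"]
      unfolding norm_mult n by simp_all
    have "norm l \<le> norm l0 + 1"
      using that(1) norm_triangle_ineq2[of l l0] by simp
    then have x: "norm (l - (c + of_real s * (\<zeta> - c))) \<le> X"
      using s(1) norm_triangle_ineq4[of l "c + of_real s * (\<zeta> - c)"] norm_triangle_ineq[of c "of_real s * (\<zeta> - c)"]
      unfolding X_def by linarith
    have "norm (kern1 (l - (c + of_real s * (\<zeta> - c))) ((1 - of_real s) * (\<zeta> - c)))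
       \<le> R0\<^sup>2 * (exp (C * X / R0\<^sup>2) - 1) * exp (R0 * norm ((1 - of_real s) * (\<zeta> - c)))"
      by (rule norm_kern1_le[OF order_refl x])
    also have "\<dots> \<le> K"
      unfolding K_def X_def using C Y0 R0 s(2) Y[OF that(2)]
      by (intro mult_left_mono) auto
    finally show ?thesis
      unfolding vkern_def kern_def norm_mult using s(2) by (intro mult_mono) (auto simp: norm_mult)
  qed
  show ?thesis
  proof (rule that[OF r(1) S1 S2 S3 S4' A0 Y])
    fix l \<zeta> :: complex and f :: "complex \<Rightarrow> complex" and P :: real and n :: nat
    assume l: "norm (l - l0) \<le> 1" and \<zeta>: "\<zeta> \<in> S" and f: "continuous_on D f"
      and bnd: "\<And>\<xi>. \<xi> \<in> S \<Longrightarrow> norm (f \<xi>) \<le> P * (A * norm (\<xi> - c)) ^ n / fact n"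
    define b where "b = norm (\<zeta> - c) * K * (P * (A * norm (\<zeta> - c)) ^ n / fact n)"
    have "norm (contour_integral (linepath 0 1) (\<lambda>t. vkern c l \<zeta> t * f (c + t * (\<zeta> - c)))) \<le> b * (1 / Suc n)"
    proof (rule norm_contour_integral_unit_le[OF continuous_on_vop_integrand[OF f]])
      show "\<zeta> \<in> D" using \<zeta> S2 by blast
      show "((\<lambda>t. b * t ^ n) has_integral b * (1 / Suc n)) {0..1}"
        by (intro has_integral_mult_right has_integral_power_unit)
      fix s :: real assume s: "s \<in> {0..1}"
      then have "norm (f (c + of_real s * (\<zeta> - c))) \<le> P * (A * norm (c + of_real s * (\<zeta> - c) - c)) ^ n / fact n"
        by (intro bnd S4 \<zeta>) (auto simp: unit_segment_iff)
      also have "\<dots> = P * (A * norm (\<zeta> - c)) ^ n / fact n * s ^ n"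
        using s by (simp add: norm_mult power_mult_distrib)
      finally have 1: "norm (f (c + of_real s * (\<zeta> - c))) \<le> P * (A * norm (\<zeta> - c)) ^ n / fact n * s ^ n" .
      have "norm (vkern c l \<zeta> (of_real s) * f (c + of_real s * (\<zeta> - c)))
          \<le> (norm (\<zeta> - c) * K) * (P * (A * norm (\<zeta> - c)) ^ n / fact n * s ^ n)"
        unfolding norm_mult using K0 by (intro mult_mono vk l \<zeta> s 1) auto
      then show "norm (vkern c l \<zeta> (of_real s) * f (c + of_real s * (\<zeta> - c))) \<le> b * s ^ n"
        by (simp add: b_def mult.assoc)
    qed
    then have "norm (vop e c l f \<zeta>) \<le> E * (b * (1 / Suc n))"
      unfolding vop_def norm_mult using E[OF \<zeta>] E0 by (intro mult_mono) auto
    also have "\<dots> = P * (A * norm (\<zeta> - c)) ^ Suc n / fact (Suc n)"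
      by (simp add: b_def A_def field_simps del: of_nat_Suc)
    finally show "norm (vop e c l f \<zeta>) \<le> P * (A * norm (\<zeta> - c)) ^ Suc n / fact (Suc n)" .
  qed
qed

text \<open>
  Iterating the homogeneous equation gives \<open>|f| \<le> P (A |\<zeta> - c|)\<^sup>n / n!\<close> for every \<open>n\<close>.
\<close>

lemma volterra_unique:
  assumes f: "continuous_on D f" and eq: "\<And>\<zeta>. \<zeta> \<in> D \<Longrightarrow> f \<zeta> = vop e c l f \<zeta>" and \<zeta>: "\<zeta> \<in> D"
  shows "f \<zeta> = 0"
proof -
  obtain r S A Y where S: "r > 0" "cball \<zeta> r \<subseteq> S" "S \<subseteq> D" "compact S" "starlike_at c S" "A \<ge> 0"
    "\<And>\<zeta>. \<zeta> \<in> S \<Longrightarrow> norm (\<zeta> - c) \<le> Y"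
    and step: "\<And>l' \<zeta> f P n. norm (l' - l) \<le> 1 \<Longrightarrow> \<zeta> \<in> S \<Longrightarrow> continuous_on D f \<Longrightarrow>
      (\<And>\<xi>. \<xi> \<in> S \<Longrightarrow> norm (f \<xi>) \<le> P * (A * norm (\<xi> - c)) ^ n / fact n)
      \<Longrightarrow> norm (vop e c l' f \<zeta>) \<le> P * (A * norm (\<zeta> - c)) ^ Suc n / fact (Suc n)"
    using local_estimate[OF \<zeta>, of l] by blast
  have "bounded (f ` S)"
    using S by (intro compact_imp_bounded compact_continuous_image continuous_on_subset[OF f])
  then obtain P where P: "\<And>\<xi>. \<xi> \<in> S \<Longrightarrow> norm (f \<xi>) \<le> P"
    by (auto simp: bounded_iff)
  have bnd: "norm (f \<xi>) \<le> P * (A * norm (\<xi> - c)) ^ n / fact n" if "\<xi> \<in> S" for n \<xi>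
    using that
  proof (induction n arbitrary: \<xi>)
    case (Suc n)
    have "norm (vop e c l f \<xi>) \<le> P * (A * norm (\<xi> - c)) ^ Suc n / fact (Suc n)"
      by (rule step[OF _ Suc.prems f Suc.IH]) auto
    then show ?case using eq[of \<xi>] Suc.prems S(3) by auto
  qed (use P in auto)
  have "(\<lambda>n. (A * norm (\<zeta> - c)) ^ n / fact n) \<longlonglongrightarrow> 0"
    using summable_LIMSEQ_zero[OF summable_exp[of "A * norm (\<zeta> - c)"]]
    by (simp add: divide_inverse mult.commute)
  then have "(\<lambda>n. P * ((A * norm (\<zeta> - c)) ^ n / fact n)) \<longlonglongrightarrow> P * 0"
    by (intro tendsto_mult tendsto_const)
  moreover have "norm (f \<zeta>) \<le> P * ((A * norm (\<zeta> - c)) ^ n / fact n)" for n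
    using bnd[of \<zeta> n] subsetD[OF S(2), of \<zeta>] S(1) by simp
  ultimately have "norm (f \<zeta>) \<le> 0"
    by (intro LIMSEQ_le_const[where X = "\<lambda>n. P * ((A * norm (\<zeta> - c)) ^ n / fact n)"]) auto
  then show ?thesis by simp
qed

text \<open>
  Successive terms of the Neumann series of the equation \<open>G = m + vop G\<close>.
\<close>

primrec picard :: "(complex \<Rightarrow> complex \<Rightarrow> complex) \<Rightarrow> nat \<Rightarrow> complex \<Rightarrow> complex \<Rightarrow> complex" where
  "picard m 0 = m"
| "picard m (Suc n) = (\<lambda>l \<zeta>. vop e c l (picard m n l) \<zeta>)"

lemma hol2_picard: "hol2 (UNIV \<times> D) m \<Longrightarrow> hol2 (UNIV \<times> D) (picard m n)"
  by (induction n) (auto intro: hol2_vop)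

lemma hol2_continuous_on_slice: "hol2 (UNIV \<times> D) F \<Longrightarrow> continuous_on D (F l)"
  by (rule hol2_continuous_compose[where p = "\<lambda>_. l" and q = "\<lambda>x. x"]) (auto intro!: continuous_intros)

lemma picard_bound:
  assumes m: "hol2 (UNIV \<times> D) m" and \<zeta>0: "\<zeta>0 \<in> D"
  obtains r S M where "r > 0" "cball \<zeta>0 r \<subseteq> S" "S \<subseteq> D" "starlike_at c S" "summable M"
    "\<And>n l \<zeta>. norm (l - l0) \<le> 1 \<Longrightarrow> \<zeta> \<in> S \<Longrightarrow> norm (picard m n l \<zeta>) \<le> M n"
proof -
  obtain r S A Y where S: "r > 0" "cball \<zeta>0 r \<subseteq> S" "S \<subseteq> D" "compact S" "starlike_at c S" "A \<ge> 0"
    "\<And>\<zeta>. \<zeta> \<in> S \<Longrightarrow> norm (\<zeta> - c) \<le> Y"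
    and step: "\<And>l' \<zeta> f P n. norm (l' - l0) \<le> 1 \<Longrightarrow> \<zeta> \<in> S \<Longrightarrow> continuous_on D f \<Longrightarrow>
      (\<And>\<xi>. \<xi> \<in> S \<Longrightarrow> norm (f \<xi>) \<le> P * (A * norm (\<xi> - c)) ^ n / fact n)
      \<Longrightarrow> norm (vop e c l' f \<zeta>) \<le> P * (A * norm (\<zeta> - c)) ^ Suc n / fact (Suc n)"
    using local_estimate[OF \<zeta>0, of l0] by blast
  have "bounded ((\<lambda>p. m (fst p) (snd p)) ` (cball l0 1 \<times> S))"
    using S by (intro compact_imp_bounded compact_continuous_image compact_Times continuous_on_subset[OF hol2_continuous[OF m]]) auto
  then obtain P where "\<forall>x \<in> (\<lambda>p. m (fst p) (snd p)) ` (cball l0 1 \<times> S). norm x \<le> P"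
    unfolding bounded_iff by blast
  then have P: "norm (m l \<zeta>) \<le> P" if "norm (l - l0) \<le> 1" "\<zeta> \<in> S" for l \<zeta>
    using that by (auto simp: dist_norm norm_minus_commute)
  have P0: "P \<ge> 0" using P[of l0 \<zeta>0] S(1,2) order_trans[OF norm_ge_zero] by force
  have bnd: "norm (picard m n l \<zeta>) \<le> P * (A * norm (\<zeta> - c)) ^ n / fact n"
    if "norm (l - l0) \<le> 1" "\<zeta> \<in> S" for n l \<zeta>
    using that
  proof (induction n arbitrary: \<zeta>)
    case (Suc n)
    show ?case unfolding picard.simps
      by (rule step[OF Suc.prems hol2_continuous_on_slice[OF hol2_picard[OF m]]]) (use Suc in auto)
  qed (use P in auto)
  have "norm (picard m n l \<zeta>) \<le> P * ((A * Y) ^ n / fact n)" if "norm (l - l0) \<le> 1" "\<zeta> \<in> S" for n l \<zeta>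
  proof -
    have "P * ((A * norm (\<zeta> - c)) ^ n / fact n) \<le> P * ((A * Y) ^ n / fact n)"
      using P0 S(6) S(7)[OF that(2)] by (intro mult_left_mono divide_right_mono power_mono) auto
    then show ?thesis using bnd[OF that, of n] by simp
  qed
  moreover have "summable (\<lambda>n. P * ((A * Y) ^ n / fact n))"
    using summable_exp[of "A * Y"] by (intro summable_mult) (simp add: divide_inverse mult.commute)
  ultimately show ?thesis using that S by blast
qed

text \<open>
  The Neumann series converges locally uniformly by the factorial gain, so its sum is again holomorphic
  along curves, and the operator may be applied term by term.
\<close>

theorem volterra_solution:
  assumes m: "hol2 (UNIV \<times> D) m"
  obtains G where "hol2 (UNIV \<times> D) G" "\<And>l \<zeta>. \<zeta> \<in> D \<Longrightarrow> G l \<zeta> = m l \<zeta> + vop e c l (G l) \<zeta>"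
proof -
  define G where "G = (\<lambda>l \<zeta>. \<Sum>n. picard m n l \<zeta>)"
  define good where "good = (\<lambda>p V M. open V \<and> p \<in> V \<and> summable M \<and>
    (\<forall>n q. q \<in> V \<longrightarrow> q \<in> UNIV \<times> D \<longrightarrow> norm (picard m n (fst q) (snd q)) \<le> M n))"
  have "\<exists>VM. good p (fst VM) (snd VM)" if p: "p \<in> UNIV \<times> D" for p
  proof -
    have sp: "snd p \<in> D" using p by auto
    obtain r S M where b: "r > 0" "cball (snd p) r \<subseteq> S" "S \<subseteq> D" "starlike_at c S" "summable M"
      "\<And>n l \<zeta>. norm (l - fst p) \<le> 1 \<Longrightarrow> \<zeta> \<in> S \<Longrightarrow> norm (picard m n l \<zeta>) \<le> M n"
      by (rule picard_bound[OF m sp, where ?l0.0 = "fst p"]) (rule that)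
    have "norm (picard m n (fst q) (snd q)) \<le> M n" if "q \<in> ball (fst p) 1 \<times> ball (snd p) r" for n q
    proof (rule b(6))
      show "norm (fst q - fst p) \<le> 1"
        using that by (simp add: mem_Times_iff dist_norm norm_minus_commute)
      show "snd q \<in> S"
        using that by (intro subsetD[OF b(2)]) (simp add: mem_Times_iff)
    qed
    moreover have "open (ball (fst p) 1 \<times> ball (snd p) r)" "p \<in> ball (fst p) 1 \<times> ball (snd p) r"
      using b(1) by (simp_all add: open_Times mem_Times_iff)
    ultimately have "good p (ball (fst p) 1 \<times> ball (snd p) r) M"
      unfolding good_def using b(5) by blast
    then show ?thesis by (intro exI[of _ "(ball (fst p) 1 \<times> ball (snd p) r, M)"]) simp
  qed
  then obtain VM where VM: "\<And>p. p \<in> UNIV \<times> D \<Longrightarrow> good p (fst (VM p)) (snd (VM p))"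
    using bchoice[of "UNIV \<times> D" "\<lambda>p VM. good p (fst VM) (snd VM)"] by blast
  have G: "hol2 (UNIV \<times> D) G"
    unfolding G_def
  proof (rule hol2_suminf[where V = "\<lambda>p. fst (VM p)" and M = "\<lambda>p. snd (VM p)", OF hol2_picard[OF m]])
    fix p :: "complex \<times> complex" assume p: "p \<in> UNIV \<times> D"
    note g = VM[OF p, unfolded good_def]
    show "open (fst (VM p))" "p \<in> fst (VM p)" "summable (snd (VM p))"
      using g by (simp_all only: simp_thms)
    fix n q assume "q \<in> fst (VM p)" "q \<in> UNIV \<times> D"
    with g show "norm (picard m n (fst q) (snd q)) \<le> snd (VM p) n" by blast
  qed
  moreover have "G l \<zeta> = m l \<zeta> + vop e c l (G l) \<zeta>" if \<zeta>: "\<zeta> \<in> D" for l \<zeta>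
  proof -
    obtain r S M where b: "r > 0" "cball \<zeta> r \<subseteq> S" "S \<subseteq> D" "starlike_at c S" "summable M"
      "\<And>n l' \<zeta>. norm (l' - l) \<le> 1 \<Longrightarrow> \<zeta> \<in> S \<Longrightarrow> norm (picard m n l' \<zeta>) \<le> M n"
      by (rule picard_bound[OF m \<zeta>, where ?l0.0 = l]) (rule that)
    have \<zeta>S: "\<zeta> \<in> S" using b by auto
    have pM: "norm (picard m n l \<xi>) \<le> M n" if "\<xi> \<in> S" for n \<xi>
      using b(6)[of l \<xi> n] that by simp
    have sm: "summable (\<lambda>n. picard m n l \<xi>)" if "\<xi> \<in> S" for \<xi>
      by (rule summable_comparison_test'[OF b(5) pM[OF that]])
    define k where "k = vkern c l \<zeta>"
    have k: "continuous_on (closed_segment 0 1) k"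
      unfolding k_def vkern_def by (intro continuous_on_kern_compose continuous_intros)
    have "bounded (k ` closed_segment 0 1)"
      by (intro compact_imp_bounded compact_continuous_image k) auto
    then obtain B where B: "\<And>t. t \<in> closed_segment 0 1 \<Longrightarrow> norm (k t) \<le> B"
      by (auto simp: bounded_iff)
    have in_S: "c + t * (\<zeta> - c) \<in> S" if "t \<in> closed_segment 0 1" for t
      using b(4) \<zeta>S that by (rule starlike_atD)
    define f where "f = (\<lambda>n t. k t * picard m n l (c + t * (\<zeta> - c)))"
    have fc: "f n contour_integrable_on linepath 0 1" for n
      unfolding f_def k_def
      by (intro contour_integrable_continuous_linepath continuous_on_vop_integrand[OF hol2_continuous_on_slice[OF hol2_picard[OF m]] \<zeta>])
    have ul: "uniform_limit (path_image (linepath 0 1)) (\<lambda>N t. \<Sum>n<N. f n t) (\<lambda>t. k t * G l (c + t * (\<zeta> - c))) sequentially"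
    proof -
      have "uniform_limit (path_image (linepath 0 1)) (\<lambda>N t. \<Sum>n<N. f n t) (\<lambda>t. \<Sum>n. f n t) sequentially"
      proof (rule Weierstrass_m_test)
        show "summable (\<lambda>n. B * M n)" by (intro summable_mult b)
        show "norm (f n t) \<le> B * M n" if "t \<in> path_image (linepath 0 1)" for n t
        proof -
          have t: "t \<in> closed_segment 0 1" using that by (simp only: path_image_linepath)
          show ?thesis
            unfolding f_def norm_mult using order_trans[OF norm_ge_zero B[OF t]]
            by (intro mult_mono B[OF t] pM in_S[OF t]) auto
        qed
      qed
      note ul0 = this
      have eqn: "(\<Sum>n. f n t) = k t * G l (c + t * (\<zeta> - c))" if "t \<in> path_image (linepath 0 1)" for t
      proof -
        have t: "t \<in> closed_segment 0 1" using that by (simp only: path_image_linepath)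
        show ?thesis unfolding f_def G_def by (intro suminf_mult sm in_S[OF t])
      qed
      show ?thesis
        by (rule iffD1[OF uniform_limit_cong'[OF refl eqn] ul0])
    qed
    have "(\<lambda>N. contour_integral (linepath 0 1) (\<lambda>t. \<Sum>n<N. f n t)) \<longlonglongrightarrow>
        contour_integral (linepath 0 1) (\<lambda>t. k t * G l (c + t * (\<zeta> - c)))"
    proof (rule contour_integral_uniform_limit(2)[OF _ ul, where B = 1])
      show "\<forall>\<^sub>F N in sequentially. (\<lambda>t. \<Sum>n<N. f n t) contour_integrable_on linepath 0 1"
        by (intro always_eventually allI contour_integrable_sum fc finite_lessThan)
    qed simp_all
    then have "(\<lambda>N. \<Sum>n<N. contour_integral (linepath 0 1) (f n)) \<longlonglongrightarrow>
        contour_integral (linepath 0 1) (\<lambda>t. k t * G l (c + t * (\<zeta> - c)))"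
      by (simp only: contour_integral_sum[OF finite_lessThan fc])
    then have "(\<lambda>n. contour_integral (linepath 0 1) (f n)) sums contour_integral (linepath 0 1) (\<lambda>t. k t * G l (c + t * (\<zeta> - c)))"
      by (simp add: sums_def)
    then have "(\<lambda>n. e \<zeta> * contour_integral (linepath 0 1) (f n)) sums vop e c l (G l) \<zeta>"
      unfolding vop_def k_def by (rule sums_mult)
    then have "(\<lambda>n. picard m (Suc n) l \<zeta>) sums vop e c l (G l) \<zeta>"
      by (simp add: vop_def f_def k_def)
    then have "(\<lambda>n. picard m n l \<zeta>) sums (vop e c l (G l) \<zeta> + m l \<zeta>)"
      by (subst (asm) sums_Suc_iff) simp
    then show ?thesis by (simp add: G_def sums_iff)
  qed
  ultimately show ?thesis using that by blast
qed

end

section \<open>Continuation of germs along paths\<close>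

text \<open>
  A coherent family of germs over a parameter interval other than \<open>[0, 1]\<close>, needed to build a continuation
  piece by piece.
\<close>

definition continues_on :: "(real \<Rightarrow> complex) \<Rightarrow> (real \<Rightarrow> complex fps) \<Rightarrow> real \<Rightarrow> real \<Rightarrow> bool" where
  "continues_on \<gamma> P u v \<longleftrightarrow>
     (\<forall>t\<in>{u..v}. \<exists>\<epsilon>>0. \<forall>s\<in>{u..v}. \<bar>s - t\<bar> < \<epsilon> \<longrightarrow>
        ereal (norm (\<gamma> s - \<gamma> t)) < fps_conv_radius (P t) \<and>
        P s = fps_expansion (eval_fps (P t)) (\<gamma> s - \<gamma> t))"

lemma continuation_family_conv: "continuation_family \<gamma> P \<longleftrightarrow> continues_on \<gamma> P 0 1"
  by (simp add: continuation_family_def continues_on_def)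

lemma fps_expansion_shift: "fps_expansion f z = fps_expansion (\<lambda>x. f (z + x)) 0"
  unfolding fps_expansion_def higher_deriv_shift_0[of _ f z] by (simp only: o_def)

lemma fps_expansion_reexpand:
  assumes g: "g holomorphic_on ball z r" and w: "norm w < r"
  shows "fps_expansion g (z + w) = fps_expansion (eval_fps (fps_expansion g z)) w"
proof -
  have ev: "\<forall>\<^sub>F x in nhds 0. norm (w + x :: complex) < r"
  proof (rule eventually_mono[OF eventually_nhds_in_open[of "ball 0 (r - norm w)" 0]])
    fix x :: complex assume "x \<in> ball 0 (r - norm w)"
    then show "norm (w + x) < r" using norm_triangle_ineq[of w x] by simp
  qed (use w in auto)
  have "fps_expansion (eval_fps (fps_expansion g z)) w = fps_expansion (\<lambda>x. eval_fps (fps_expansion g z) (w + x)) 0"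
    by (rule fps_expansion_shift)
  also have "\<dots> = fps_expansion (\<lambda>x. g (z + w + x)) 0"
  proof (rule fps_expansion_cong, rule eventually_mono[OF ev])
    fix x assume "norm (w + x) < r"
    then show "eval_fps (fps_expansion g z) (w + x) = g (z + w + x)"
      using eval_fps_expansion'[of g z "ereal r" "w + x"] g by (simp add: add.assoc)
  qed
  also have "\<dots> = fps_expansion g (z + w)"
    by (rule fps_expansion_shift[symmetric])
  finally show ?thesis ..
qed

lemma continues_on_holomorphic:
  assumes D: "open D" and g: "g holomorphic_on D" and \<gamma>: "continuous_on {u..v} \<gamma>"
    and im: "\<And>t. t \<in> {u..v} \<Longrightarrow> \<gamma> t \<in> D"
  shows "continues_on \<gamma> (\<lambda>t. fps_expansion g (\<gamma> t)) u v"
  unfolding continues_on_def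
proof
  fix t assume t: "t \<in> {u..v}"
  obtain r where r: "r > 0" "ball (\<gamma> t) r \<subseteq> D"
    using D im[OF t] open_contains_ball by blast
  obtain \<epsilon> where \<epsilon>: "\<epsilon> > 0" "\<And>s. s \<in> {u..v} \<Longrightarrow> dist s t < \<epsilon> \<Longrightarrow> dist (\<gamma> s) (\<gamma> t) < r"
    using \<gamma> t r(1) unfolding continuous_on_iff by blast
  have gb: "g holomorphic_on ball (\<gamma> t) r"
    using g r(2) by (rule holomorphic_on_subset)
  have cr: "fps_conv_radius (fps_expansion g (\<gamma> t)) \<ge> ereal r"
    using gb by (intro conv_radius_fps_expansion) simp
  show "\<exists>\<epsilon>>0. \<forall>s\<in>{u..v}. \<bar>s - t\<bar> < \<epsilon> \<longrightarrow>
      ereal (norm (\<gamma> s - \<gamma> t)) < fps_conv_radius (fps_expansion g (\<gamma> t)) \<and>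
      fps_expansion g (\<gamma> s) = fps_expansion (eval_fps (fps_expansion g (\<gamma> t))) (\<gamma> s - \<gamma> t)"
  proof (intro exI[of _ \<epsilon>] conjI ballI impI \<epsilon>(1))
    fix s assume "s \<in> {u..v}" "\<bar>s - t\<bar> < \<epsilon>"
    then have lt: "norm (\<gamma> s - \<gamma> t) < r"
      using \<epsilon>(2)[of s] by (simp add: dist_norm)
    then show "ereal (norm (\<gamma> s - \<gamma> t)) < fps_conv_radius (fps_expansion g (\<gamma> t))"
      using cr by (meson ereal_less(2) less_ereal.simps(1) order_less_le_trans)
    show "fps_expansion g (\<gamma> s) = fps_expansion (eval_fps (fps_expansion g (\<gamma> t))) (\<gamma> s - \<gamma> t)"
      using fps_expansion_reexpand[OF gb lt] by simp
  qed
qed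

text \<open>
  At the common endpoint, the germs of the two pieces agree, so that the smaller of the two radii of coherence works.
\<close>

lemma continues_on_join:
  assumes P: "continues_on \<gamma> P u v" and Q: "continues_on \<gamma> Q v w" and eq: "P v = Q v"
  shows "continues_on \<gamma> (\<lambda>t. if t \<le> v then P t else Q t) u w"
  unfolding continues_on_def
proof
  fix t assume t: "t \<in> {u..w}"
  let ?R = "\<lambda>t. if t \<le> v then P t else Q t"
  let ?ok = "\<lambda>F G s t. ereal (norm (\<gamma> s - \<gamma> t)) < fps_conv_radius F \<and> G = fps_expansion (eval_fps F) (\<gamma> s - \<gamma> t)"
  have eP: "\<exists>\<epsilon>>0. \<forall>s\<in>{u..v}. \<bar>s - t\<bar> < \<epsilon> \<longrightarrow> ?ok (P t) (P s) s t" if "t \<le> v"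
    by (rule P[unfolded continues_on_def, THEN bspec]) (use t that in simp)
  have eQ: "\<exists>\<epsilon>>0. \<forall>s\<in>{v..w}. \<bar>s - t\<bar> < \<epsilon> \<longrightarrow> ?ok (Q t) (Q s) s t" if "v \<le> t"
    by (rule Q[unfolded continues_on_def, THEN bspec]) (use t that in simp)
  have RP: "?R s = P s" if "s \<le> v" for s using that by simp
  have RQ: "?R s = Q s" if "v \<le> s" for s using that eq by (cases "s = v") auto
  consider "t < v" | "t = v" | "v < t" by linarith
  then show "\<exists>\<epsilon>>0. \<forall>s\<in>{u..w}. \<bar>s - t\<bar> < \<epsilon> \<longrightarrow> ?ok (?R t) (?R s) s t"
  proof cases
    case 1
    from eP[OF less_imp_le[OF 1]] obtain \<epsilon> where
      e: "\<epsilon> > 0 \<and> (\<forall>s\<in>{u..v}. \<bar>s - t\<bar> < \<epsilon> \<longrightarrow> ?ok (P t) (P s) s t)" ..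
    have "?ok (?R t) (?R s) s t" if "s \<in> {u..w}" "\<bar>s - t\<bar> < min \<epsilon> (v - t)" for s
    proof -
      have s: "s \<in> {u..v}" "\<bar>s - t\<bar> < \<epsilon>" "s \<le> v" using that by auto
      show ?thesis
        unfolding RP[OF less_imp_le[OF 1]] RP[OF s(3)]
        by (rule conjunct2[OF e, rule_format, OF s(1,2)])
    qed
    then show ?thesis
      using conjunct1[OF e] 1 by (rule_tac exI[of _ "min \<epsilon> (v - t)"], rule_tac conjI) (simp, blast)
  next
    case 2
    from eP[OF eq_refl[OF 2]] obtain \<epsilon> where
      e: "\<epsilon> > 0 \<and> (\<forall>s\<in>{u..v}. \<bar>s - t\<bar> < \<epsilon> \<longrightarrow> ?ok (P t) (P s) s t)" ..
    from eQ[OF eq_refl[OF 2[symmetric]]] obtain \<delta> where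
      d: "\<delta> > 0 \<and> (\<forall>s\<in>{v..w}. \<bar>s - t\<bar> < \<delta> \<longrightarrow> ?ok (Q t) (Q s) s t)" ..
    have "?ok (?R t) (?R s) s t" if s: "s \<in> {u..w}" "\<bar>s - t\<bar> < min \<epsilon> \<delta>" for s
    proof (cases "s \<le> v")
      case True
      then have s': "s \<in> {u..v}" "\<bar>s - t\<bar> < \<epsilon>" using s by auto
      show ?thesis
        unfolding RP[OF eq_refl[OF 2]] RP[OF True]
        by (rule conjunct2[OF e, rule_format, OF s'])
    next
      case False
      then have s': "s \<in> {v..w}" "\<bar>s - t\<bar> < \<delta>" "v \<le> s" using s by auto
      show ?thesis
        unfolding RQ[OF eq_refl[OF 2[symmetric]]] RQ[OF s'(3)]
        by (rule conjunct2[OF d, rule_format, OF s'(1,2)])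
    qed
    then show ?thesis
      using conjunct1[OF e] conjunct1[OF d] by (rule_tac exI[of _ "min \<epsilon> \<delta>"], rule_tac conjI) (simp, blast)
  next
    case 3
    from eQ[OF less_imp_le[OF 3]] obtain \<epsilon> where
      e: "\<epsilon> > 0 \<and> (\<forall>s\<in>{v..w}. \<bar>s - t\<bar> < \<epsilon> \<longrightarrow> ?ok (Q t) (Q s) s t)" ..
    have "?ok (?R t) (?R s) s t" if "s \<in> {u..w}" "\<bar>s - t\<bar> < min \<epsilon> (t - v)" for s
    proof -
      have s: "s \<in> {v..w}" "\<bar>s - t\<bar> < \<epsilon>" "v \<le> s" using that by auto
      show ?thesis
        unfolding RQ[OF less_imp_le[OF 3]] RQ[OF s(3)]
        by (rule conjunct2[OF e, rule_format, OF s(1,2)])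
    qed
    then show ?thesis
      using conjunct1[OF e] 3 by (rule_tac exI[of _ "min \<epsilon> (t - v)"], rule_tac conjI) (simp, blast)
  qed
qed

lemma two_pi_i_Z_iff: "z \<in> two_pi_i_Z \<longleftrightarrow> exp z = 1"
proof -
  have "z \<in> two_pi_i_Z \<longleftrightarrow> (\<exists>n::int. z = 2 * of_real pi * \<i> * of_int n)"
    by (auto simp: two_pi_i_Z_def)
  also have "\<dots> \<longleftrightarrow> exp z = 1"
    unfolding exp_eq_1 by (auto simp: complex_eq_iff[of z])
  finally show ?thesis .
qed

lemma closed_two_pi_i_Z: "closed two_pi_i_Z"
proof -
  have "two_pi_i_Z = exp -` {1}" by (auto simp: two_pi_i_Z_iff)
  moreover have "closed (exp -` {1 :: complex})"
    by (intro closed_vimage continuous_intros)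
  ultimately show ?thesis by simp
qed

lemma principal_branch_fps_expansion:
  assumes D: "open cut_plane" "starlike_at 0 cut_plane" and g: "g holomorphic_on cut_plane"
  shows "principal_branch (fps_expansion g 0) g"
  unfolding principal_branch_def
proof (intro conjI ballI g)
  fix \<zeta> assume \<zeta>: "\<zeta> \<in> cut_plane"
  have "continues_on (linepath 0 \<zeta>) (\<lambda>t. fps_expansion g (linepath 0 \<zeta> t)) 0 1"
  proof (rule continues_on_holomorphic[OF D(1) g])
    fix t :: real assume "t \<in> {0..1}"
    then have "linepath 0 \<zeta> t \<in> closed_segment 0 \<zeta>" by (rule linepath_in_path)
    then show "linepath 0 \<zeta> t \<in> cut_plane" using D(2) \<zeta> by (auto simp: starlike_at_def)
  qed (rule continuous_on_linepath)
  then show "continues_along (fps_expansion g 0) (linepath 0 \<zeta>) (fps_expansion g \<zeta>)"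
    unfolding continues_along_def continuation_family_conv
    by (intro exI[of _ "\<lambda>t. fps_expansion g (linepath 0 \<zeta> t)"] conjI) simp_all
qed

text \<open>
  An induction along the path.  \<open>Good D g\<close> is any property of functions on regions that passes from a
  function on \<open>D\<close> to one on each disc that is centred in \<open>D\<close> and free of singular points, with the same germ at the
  centre.  After a first step inside \<open>D0\<close> the path stays at a distance \<open>r\<close> from the singular points, so that finitely many
  discs of the fixed radius \<open>r\<close> suffice.
\<close>

lemma extends_to_R_if_locally_continuable:
  assumes hol: "\<And>D g. Good D g \<Longrightarrow> open D \<and> g holomorphic_on D"
    and step: "\<And>D g c r. Good D g \<Longrightarrow> c \<in> D \<Longrightarrow> 0 < r \<Longrightarrow> ball c r \<inter> two_pi_i_Z = {} \<Longrightarrow>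
      \<exists>g' \<rho>. Good (ball c r) g' \<and> \<rho> > 0 \<and> (\<forall>\<zeta>\<in>ball c \<rho>. g' \<zeta> = g \<zeta>)"
    and base: "Good D0 g0" "0 \<in> D0"
  shows "extends_to_R (fps_expansion g0 0)"
  unfolding extends_to_R_def
proof (intro allI impI)
  fix \<gamma> assume "path \<gamma> \<and> pathstart \<gamma> = 0 \<and> (\<forall>t\<in>{0<..1}. \<gamma> t \<notin> two_pi_i_Z)"
  then have cont: "continuous_on {0..1} \<gamma>" and start: "\<gamma> 0 = 0"
    and avoid: "\<And>t. 0 < t \<Longrightarrow> t \<le> 1 \<Longrightarrow> \<gamma> t \<notin> two_pi_i_Z"
    by (auto simp: path_def pathstart_def)
  obtain r0 where r0: "r0 > 0" "ball 0 r0 \<subseteq> D0"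
    using hol[OF base(1)] base(2) open_contains_ball by blast
  obtain d0 where d0: "d0 > 0" "\<And>t. t \<in> {0..1} \<Longrightarrow> dist t 0 < d0 \<Longrightarrow> dist (\<gamma> t) (\<gamma> 0) < r0"
    using cont r0(1) unfolding continuous_on_iff by (metis atLeastAtMost_iff order_refl zero_le_one)
  \<comment> \<open>The germ at \<open>0\<close> lies over a singular point; until the time \<open>\<delta>0\<close> the function \<open>g0\<close> itself is used.\<close>
  define \<delta>0 where "\<delta>0 = min (d0 / 2) 1"
  have \<delta>0: "0 < \<delta>0" "\<delta>0 \<le> 1" using d0(1) by (auto simp: \<delta>0_def)
  have in_D0: "\<gamma> t \<in> D0" if "t \<in> {0..\<delta>0}" for t
  proof -
    have "t \<in> {0..1}" "dist t 0 < d0" using that d0(1) by (auto simp: \<delta>0_def dist_real_def)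
    then show ?thesis using d0(2)[of t] r0(2) start by (auto simp: dist_commute)
  qed
  have comp: "compact (\<gamma> ` {\<delta>0..1})"
    using cont \<delta>0 by (intro compact_continuous_image continuous_on_subset[OF cont]) auto
  have disj: "\<gamma> ` {\<delta>0..1} \<inter> two_pi_i_Z = {}"
    using avoid \<delta>0 by force
  obtain r where r: "r > 0" "\<And>x y. x \<in> \<gamma> ` {\<delta>0..1} \<Longrightarrow> y \<in> two_pi_i_Z \<Longrightarrow> r \<le> dist x y"
    using separate_compact_closed[OF comp closed_two_pi_i_Z disj] by blast
  have ball_disj: "ball (\<gamma> t) r \<inter> two_pi_i_Z = {}" if "t \<in> {\<delta>0..1}" for t
    using r(2)[of "\<gamma> t"] that by force
  have "uniformly_continuous_on {0..1} \<gamma>"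
    using cont by (rule compact_uniformly_continuous) simp
  then obtain h where h: "h > 0" "\<And>s t. s \<in> {0..1} \<Longrightarrow> t \<in> {0..1} \<Longrightarrow> dist s t < h \<Longrightarrow> dist (\<gamma> s) (\<gamma> t) < r"
    unfolding uniformly_continuous_on_def using r(1) by metis
  define \<tau> where "\<tau> = (\<lambda>k::nat. min 1 (\<delta>0 + of_nat k * (h / 2)))"
  have \<tau>: "\<delta>0 \<le> \<tau> k" "\<tau> k \<le> 1" "\<tau> k \<le> \<tau> (Suc k)" "\<tau> (Suc k) < \<tau> k + h" for k
  proof -
    have "\<delta>0 + real (Suc k) * (h / 2) = (\<delta>0 + real k * (h / 2)) + h / 2"
      by (simp add: field_simps)
    then have S: "\<tau> (Suc k) = min 1 ((\<delta>0 + real k * (h / 2)) + h / 2)"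
      by (simp only: \<tau>_def)
    have "0 \<le> real k * (h / 2)" using h(1) by simp
    then show "\<delta>0 \<le> \<tau> k" "\<tau> k \<le> 1" "\<tau> k \<le> \<tau> (Suc k)" "\<tau> (Suc k) < \<tau> k + h"
      using h(1) \<delta>0 unfolding S by (simp_all add: \<tau>_def min_def)
  qed
  have ind: "\<exists>P D g. continues_on \<gamma> P 0 (\<tau> k) \<and> P 0 = fps_expansion g0 0 \<and> Good D g \<and> \<gamma> (\<tau> k) \<in> D \<and>
      P (\<tau> k) = fps_expansion g (\<gamma> (\<tau> k))" for k
  proof (induction k)
    case 0
    have t0: "\<tau> 0 = \<delta>0" using \<delta>0 by (simp add: \<tau>_def)
    have "continues_on \<gamma> (\<lambda>t. fps_expansion g0 (\<gamma> t)) 0 \<delta>0"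
      by (rule continues_on_holomorphic[of D0])
        (use hol[OF base(1)] in_D0 \<delta>0 in \<open>auto intro: continuous_on_subset[OF cont]\<close>)
    then show ?case
      using base in_D0[of \<delta>0] \<delta>0 start unfolding t0
      by (intro exI[of _ "\<lambda>t. fps_expansion g0 (\<gamma> t)"] exI[of _ D0] exI[of _ g0]) simp
  next
    case (Suc k)
    then obtain P D g where IH: "continues_on \<gamma> P 0 (\<tau> k)" "P 0 = fps_expansion g0 0" "Good D g"
      "\<gamma> (\<tau> k) \<in> D" "P (\<tau> k) = fps_expansion g (\<gamma> (\<tau> k))"
      by blast
    have tk: "\<tau> k \<in> {\<delta>0..1}" using \<tau> by simp
    obtain g' \<rho> where g': "Good (ball (\<gamma> (\<tau> k)) r) g'" "\<rho> > 0" "\<And>\<zeta>. \<zeta> \<in> ball (\<gamma> (\<tau> k)) \<rho> \<Longrightarrow> g' \<zeta> = g \<zeta>"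
      using step[OF IH(3,4) r(1) ball_disj[OF tk]] by blast
    have "fps_expansion g' (\<gamma> (\<tau> k)) = fps_expansion g (\<gamma> (\<tau> k))"
      by (rule fps_expansion_cong, rule eventually_mono[OF eventually_nhds_in_open[of "ball (\<gamma> (\<tau> k)) \<rho>"]])
        (use g' in auto)
    then have eq: "P (\<tau> k) = fps_expansion g' (\<gamma> (\<tau> k))" using IH(5) by simp
    have near: "\<gamma> t \<in> ball (\<gamma> (\<tau> k)) r" if "t \<in> {\<tau> k..\<tau> (Suc k)}" for t
    proof -
      have "t \<in> {0..1}" "\<tau> k \<in> {0..1}" "dist (\<tau> k) t < h"
        using that \<tau>[of k] \<tau>(2)[of "Suc k"] \<delta>0 by (auto simp: dist_real_def)
      then show ?thesis using h(2)[of "\<tau> k" t] by simp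
    qed
    have Q: "continues_on \<gamma> (\<lambda>t. fps_expansion g' (\<gamma> t)) (\<tau> k) (\<tau> (Suc k))"
    proof (rule continues_on_holomorphic[of "ball (\<gamma> (\<tau> k)) r"])
      show "continuous_on {\<tau> k..\<tau> (Suc k)} \<gamma>"
        by (rule continuous_on_subset[OF cont]) (use \<tau>[of k] \<tau>(2)[of "Suc k"] \<delta>0 in auto)
    qed (use hol[OF g'(1)] near in auto)
    define R where "R = (\<lambda>t. if t \<le> \<tau> k then P t else fps_expansion g' (\<gamma> t))"
    have "continues_on \<gamma> R 0 (\<tau> (Suc k))"
      unfolding R_def by (rule continues_on_join[OF IH(1) Q eq])
    moreover have "R 0 = fps_expansion g0 0"
      using IH(2) \<tau>(1)[of k] \<delta>0 by (simp add: R_def)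
    moreover have "R (\<tau> (Suc k)) = fps_expansion g' (\<gamma> (\<tau> (Suc k)))"
    proof (cases "\<tau> (Suc k) = \<tau> k")
      case True
      then show ?thesis using eq by (simp add: R_def)
    qed (use \<tau>(3)[of k] in \<open>simp add: R_def\<close>)
    ultimately show ?case
      using g'(1) near[of "\<tau> (Suc k)"] \<tau>(3)[of k]
      by (intro exI[of _ R] exI[of _ "ball (\<gamma> (\<tau> k)) r"] exI[of _ g']) simp
  qed
  obtain n where "real n * (h / 2) \<ge> 1"
    using h(1) reals_Archimedean3[of "h / 2"] by (meson half_gt_zero less_imp_le)
  then have "\<tau> n = 1" using \<delta>0 by (simp add: \<tau>_def)
  then show "\<exists>H. continues_along (fps_expansion g0 0) \<gamma> H"
    using ind[of n] unfolding continues_along_def continuation_family_conv by metis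
qed

section \<open>The cut plane\<close>

lemma cut_plane_iff: "z \<in> cut_plane \<longleftrightarrow> Re z \<noteq> 0 \<or> \<bar>Im z\<bar> < 2 * pi"
proof -
  have "z \<in> - cut_plane \<longleftrightarrow> Re z = 0 \<and> \<bar>Im z\<bar> \<ge> 2 * pi"
    by (auto simp: cut_plane_def complex_eq_iff)
  then show ?thesis by auto
qed

lemma open_cut_plane: "open cut_plane"
proof -
  have "cut_plane = {z. Re z \<noteq> 0} \<union> {z. \<bar>Im z\<bar> < 2 * pi}"
    by (auto simp: cut_plane_iff)
  moreover have "open {z. Re z \<noteq> 0}" "open {z. \<bar>Im z\<bar> < 2 * pi}"
    by (auto intro!: open_Collect_neq open_Collect_less continuous_intros)
  ultimately show ?thesis by (metis open_Un)
qed

lemma zero_in_cut_plane: "0 \<in> cut_plane"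
  by (simp add: cut_plane_iff)

lemma starlike_at_cut_plane: "starlike_at 0 cut_plane"
  unfolding starlike_at_def
proof safe
  fix \<zeta> x assume \<zeta>: "\<zeta> \<in> cut_plane" and "x \<in> closed_segment 0 \<zeta>"
  then obtain u where u: "x = u *\<^sub>R \<zeta>" "0 \<le> u" "u \<le> 1"
    by (auto simp: closed_segment_def)
  show "x \<in> cut_plane"
  proof (cases "u = 0")
    case True
    then show ?thesis using u(1) by (simp add: zero_in_cut_plane)
  next
    case False
    have "\<bar>u * Im \<zeta>\<bar> \<le> \<bar>Im \<zeta>\<bar>"
      using u by (simp add: abs_mult mult_left_le_one_le)
    then show ?thesis using \<zeta> False u(1) by (auto simp: cut_plane_iff)
  qed
qed

lemma exp_eq_1_cut_plane: "\<zeta> \<in> cut_plane \<Longrightarrow> exp \<zeta> = 1 \<Longrightarrow> \<zeta> = 0"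
proof -
  assume \<zeta>: "\<zeta> \<in> cut_plane" "exp \<zeta> = 1"
  then obtain n :: int where n: "Re \<zeta> = 0" "Im \<zeta> = of_int (2 * n) * pi"
    by (auto simp: exp_eq_1)
  then have "\<bar>of_int (2 * n) * pi\<bar> < 2 * pi" using \<zeta>(1) by (simp add: cut_plane_iff)
  then have "\<bar>real_of_int n\<bar> < 1" by (simp add: abs_mult)
  then have "n = 0" by linarith
  then show "\<zeta> = 0" using n by (simp add: complex_eq_iff)
qed

text \<open>
  The Todd function \<open>\<zeta> / (e\<^sup>\<zeta> - 1)\<close>, which plays the role of \<open>e\<close> for the centre \<open>0\<close>.
\<close>

definition todd :: "complex \<Rightarrow> complex" where
  "todd \<zeta> = (if \<zeta> = 0 then 1 else \<zeta> / (exp \<zeta> - 1))"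

lemma todd_holomorphic: "todd holomorphic_on cut_plane"
proof -
  define h :: "complex \<Rightarrow> complex" where "h = (\<lambda>z. if z = 0 then deriv exp 0 else (exp z - exp 0) / (z - 0))"
  have "h holomorphic_on cut_plane"
    unfolding h_def by (rule pole_lemma_open) (auto intro!: holomorphic_intros open_cut_plane)
  moreover have "deriv exp (0::complex) = 1"
    using DERIV_imp_deriv[OF DERIV_exp[of "0::complex"]] by simp
  moreover have "h z \<noteq> 0" if "z \<in> cut_plane" for z
    using exp_eq_1_cut_plane[OF that] \<open>deriv exp 0 = 1\<close> by (auto simp: h_def)
  ultimately have "(\<lambda>z. 1 / h z) holomorphic_on cut_plane"
    by (intro holomorphic_on_divide) auto
  then show ?thesis
    by (rule holomorphic_transform) (simp add: h_def todd_def \<open>deriv exp 0 = 1\<close>)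
qed

lemma todd_mult: "\<zeta> \<in> cut_plane \<Longrightarrow> todd \<zeta> * (exp \<zeta> - 1) = \<zeta>"
  using exp_eq_1_cut_plane by (auto simp: todd_def)

section \<open>Continuation of solutions of the Volterra equation\<close>

lemma contour_integral_starlike_split:
  assumes D: "starlike_at c D" and f: "f holomorphic_on D" and seg: "closed_segment c' \<zeta> \<subseteq> D"
  shows "contour_integral (linepath c \<zeta>) f = contour_integral (linepath c c') f + contour_integral (linepath c' \<zeta>) f"
proof -
  have "convex hull {c, c', \<zeta>} \<subseteq> D"
  proof
    fix x assume "x \<in> convex hull {c, c', \<zeta>}"
    then obtain u v b where b: "0 \<le> u" "0 \<le> v" "u + v = 1" "b \<in> convex hull {c', \<zeta>}" "x = u *\<^sub>R c + v *\<^sub>R b"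
      by (auto simp: convex_hull_insert[of "{c', \<zeta>}" c])
    then have "b \<in> D" using seg by (auto simp: segment_convex_hull)
    then have "closed_segment c b \<subseteq> D" using D by (simp add: starlike_at_def)
    moreover have "x \<in> closed_segment c b"
      using b(1,2,3,5) by (auto simp: closed_segment_def intro!: exI[of _ v])
    ultimately show "x \<in> D" by blast
  qed
  then have h: "f holomorphic_on convex hull {c, c', \<zeta>}" using f by (rule holomorphic_on_subset[rotated])
  then have "(f has_contour_integral 0) (linepath c c' +++ linepath c' \<zeta> +++ linepath \<zeta> c)"
    by (rule Cauchy_theorem_triangle)
  moreover have "f contour_integrable_on linepath p q" if "p \<in> {c, c', \<zeta>}" "q \<in> {c, c', \<zeta>}" for p q
  proof (rule contour_integrable_continuous_linepath)
    have "closed_segment p q \<subseteq> convex hull {c, c', \<zeta>}"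
      using that by (intro closed_segment_subset convex_convex_hull hull_inc)
    then show "continuous_on (closed_segment p q) f"
      using holomorphic_on_imp_continuous_on[OF h] continuous_on_subset by blast
  qed
  ultimately have "contour_integral (linepath c c') f + (contour_integral (linepath c' \<zeta>) f + contour_integral (linepath \<zeta> c) f) = 0"
    by (auto dest!: contour_integral_unique simp: contour_integral_join)
  moreover have "contour_integral (linepath \<zeta> c) f = - contour_integral (linepath c \<zeta>) f"
    using contour_integral_reversepath[of "linepath c \<zeta>" f] by simp
  ultimately show ?thesis by (simp add: algebra_simps)
qed

context parabolic begin

text \<open>
  All that has to be known in order to continue a solution beyond \<open>D\<close>: the function \<open>G\<close> on \<open>D\<close>, and an entire \<open>M\<close> that
  contains the inhomogeneous term and the integral over the path that leads from \<open>0\<close> to the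
  centre \<open>c\<close>.
\<close>

definition state :: "complex set \<Rightarrow> complex \<Rightarrow> (complex \<Rightarrow> complex \<Rightarrow> complex) \<Rightarrow> (complex \<Rightarrow> complex \<Rightarrow> complex) \<Rightarrow> bool" where
  "state D c M G \<longleftrightarrow> open D \<and> c \<in> D \<and> starlike_at c D \<and> hol2 UNIV M \<and> hol2 (UNIV \<times> D) G \<and>
     (\<forall>l. \<forall>\<zeta>\<in>D. (exp \<zeta> - 1) * G l \<zeta>
        = M l \<zeta> + contour_integral (linepath c \<zeta>) (\<lambda>\<xi>. kern (l - \<xi>) (\<zeta> - \<xi>) * G l \<xi>))"

lemma state_cut_plane:
  assumes M1: "hol2 UNIV M1"
  obtains G where "state cut_plane 0 (\<lambda>l \<zeta>. \<zeta> * M1 l \<zeta>) G"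
    "\<And>l \<zeta>. \<zeta> \<in> cut_plane \<Longrightarrow> G l \<zeta> = todd \<zeta> * M1 l \<zeta> + vop todd 0 l (G l) \<zeta>"
proof -
  interpret volterra a R0 C cut_plane 0 todd
    by unfold_locales (auto intro: open_cut_plane zero_in_cut_plane starlike_at_cut_plane todd_holomorphic)
  have "hol2 (UNIV \<times> cut_plane) (\<lambda>l \<zeta>. todd \<zeta> * M1 l \<zeta>)"
    by (intro hol2_mult hol2_snd[OF todd_holomorphic open_cut_plane] hol2_subset[OF M1]) auto
  then obtain G where G: "hol2 (UNIV \<times> cut_plane) G"
    "\<And>l \<zeta>. \<zeta> \<in> cut_plane \<Longrightarrow> G l \<zeta> = todd \<zeta> * M1 l \<zeta> + vop todd 0 l (G l) \<zeta>"
    by (rule volterra_solution) (rule that)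
  have "state cut_plane 0 (\<lambda>l \<zeta>. \<zeta> * M1 l \<zeta>) G"
    unfolding state_def
  proof (intro conjI allI ballI G(1) D)
    show "hol2 UNIV (\<lambda>l \<zeta>. \<zeta> * M1 l \<zeta>)"
      by (intro hol2_mult M1 hol2_snd[where D = UNIV]) (auto intro: holomorphic_intros)
    fix l \<zeta> assume \<zeta>: "\<zeta> \<in> cut_plane"
    have "(exp \<zeta> - 1) * G l \<zeta> = todd \<zeta> * (exp \<zeta> - 1) * M1 l \<zeta> + (exp \<zeta> - 1) * vop todd 0 l (G l) \<zeta>"
      by (subst G(2)[OF \<zeta>]) (simp add: algebra_simps)
    also have "(exp \<zeta> - 1) * vop todd 0 l (G l) \<zeta>
        = contour_integral (linepath 0 \<zeta>) (\<lambda>\<xi>. kern (l - \<xi>) (\<zeta> - \<xi>) * G l \<xi>)"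
      using todd_mult[OF \<zeta>] by (intro vop_conv_contour_integral) simp
    finally show "(exp \<zeta> - 1) * G l \<zeta> = \<zeta> * M1 l \<zeta> + contour_integral (linepath 0 \<zeta>) (\<lambda>\<xi>. kern (l - \<xi>) (\<zeta> - \<xi>) * G l \<xi>)"
      by (simp only: todd_mult[OF \<zeta>])
  qed
  then show ?thesis using that G(2) by blast
qed

lemma state_integrand_holomorphic:
  assumes G: "hol2 (UNIV \<times> D) G" and D: "open D"
  shows "(\<lambda>\<xi>. kern (l - \<xi>) (\<zeta> - \<xi>) * G l \<xi>) holomorphic_on D"
  by (intro holomorphic_on_mult hol2D[OF hol2_kern D] hol2D[OF G D]) (auto intro!: holomorphic_intros)

text \<open>
  The new \<open>M'\<close> is \<open>M\<close> plus the integral from \<open>c\<close> to the new centre \<open>c'\<close>.  Near \<open>c'\<close>, Cauchy's theorem for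
  the triangle \<open>c, c', \<zeta>\<close> shows that \<open>G\<close> solves the equation centred at \<open>c'\<close>, and uniqueness
  identifies it with the new solution.
\<close>

lemma state_step:
  assumes st: "state D c M G" and c': "c' \<in> D" and r: "r > 0" and disj: "ball c' r \<inter> two_pi_i_Z = {}"
  obtains M' G' \<rho> where "state (ball c' r) c' M' G'" "\<rho> > 0" "\<And>l \<zeta>. \<zeta> \<in> ball c' \<rho> \<Longrightarrow> G' l \<zeta> = G l \<zeta>"
proof -
  have D: "open D" "c \<in> D" "starlike_at c D" and M: "hol2 UNIV M" and G: "hol2 (UNIV \<times> D) G"
    and eq: "\<And>l \<zeta>. \<zeta> \<in> D \<Longrightarrow> (exp \<zeta> - 1) * G l \<zeta>
        = M l \<zeta> + contour_integral (linepath c \<zeta>) (\<lambda>\<xi>. kern (l - \<xi>) (\<zeta> - \<xi>) * G l \<xi>)"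
    using st unfolding state_def by blast+
  define B where "B = ball c' r"
  have nz: "exp \<zeta> - 1 \<noteq> 0" if "\<zeta> \<in> B" for \<zeta>
    using disj that by (auto simp: B_def two_pi_i_Z_iff)
  define e where "e = (\<lambda>\<zeta>. (\<zeta> - c') / (exp \<zeta> - 1))"
  have e: "e holomorphic_on B"
    unfolding e_def using nz by (auto intro!: holomorphic_intros)
  have emult: "e \<zeta> * (exp \<zeta> - 1) = \<zeta> - c'" if "\<zeta> \<in> B" for \<zeta>
    using nz[OF that] by (simp add: e_def)
  define M' where "M' = (\<lambda>l \<zeta>. M l \<zeta> + contour_integral (linepath c c') (\<lambda>\<xi>. kern (l - \<xi>) (\<zeta> - \<xi>) * G l \<xi>))"
  have M': "hol2 UNIV M'"
    unfolding M'_def contour_integral_linepath_unit[of c c']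
  proof (intro hol2_add M hol2_mult hol2_integral)
    show "hol2 UNIV (\<lambda>l \<zeta>. c' - c)" by (rule hol2I) auto
    have pt: "c + t * (c' - c) \<in> D" if "t \<in> closed_segment 0 1" for t
      using D(3) c' that by (rule starlike_atD)
    show "continuous_on (UNIV \<times> closed_segment 0 1)
      (\<lambda>(p, t). kern (fst p - (c + t * (c' - c))) (snd p - (c + t * (c' - c))) * G (fst p) (c + t * (c' - c)))"
      unfolding case_prod_unfold
      by (intro continuous_on_mult hol2_continuous_compose[OF hol2_kern] hol2_continuous_compose[OF G])
        (auto intro!: continuous_intros pt)
    fix t :: complex assume t: "t \<in> closed_segment 0 1"
    show "hol2 UNIV (\<lambda>l \<zeta>. kern (l - (c + t * (c' - c))) (\<zeta> - (c + t * (c' - c))))"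
    proof (rule hol2I)
      show "continuous_on UNIV (\<lambda>p. kern (fst p - (c + t * (c' - c))) (snd p - (c + t * (c' - c))))"
        by (intro hol2_continuous_compose[OF hol2_kern]) (auto intro!: continuous_intros)
    qed (intro hol2D[OF hol2_kern]; auto intro!: holomorphic_intros)
    show "hol2 UNIV (\<lambda>l \<zeta>. G l (c + t * (c' - c)))"
    proof (rule hol2I)
      show "continuous_on UNIV (\<lambda>p::complex \<times> complex. G (fst p) (c + t * (c' - c)))"
        by (intro hol2_continuous_compose[OF G]) (auto intro!: continuous_intros pt[OF t])
    qed (intro hol2D[OF G]; auto intro!: holomorphic_intros pt[OF t])
  qed
  interpret B: volterra a R0 C B c' e
    by unfold_locales (use r e in \<open>auto simp: B_def intro!: convex_starlike_at\<close>)
  define m where "m = (\<lambda>l \<zeta>. M' l \<zeta> * (1 / (exp \<zeta> - 1)))"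
  have "hol2 (UNIV \<times> B) m"
    unfolding m_def using nz
    by (intro hol2_mult hol2_subset[OF M'] hol2_snd[where D = B]) (auto intro!: holomorphic_intros simp: B_def)
  then obtain G' where G': "hol2 (UNIV \<times> B) G'" "\<And>l \<zeta>. \<zeta> \<in> B \<Longrightarrow> G' l \<zeta> = m l \<zeta> + vop e c' l (G' l) \<zeta>"
    by (rule B.volterra_solution) (rule that)
  have "state B c' M' G'"
    unfolding state_def
  proof (intro conjI allI ballI M' G'(1) B.D)
    fix l \<zeta> assume \<zeta>: "\<zeta> \<in> B"
    have "(exp \<zeta> - 1) * G' l \<zeta> = M' l \<zeta> + (exp \<zeta> - 1) * vop e c' l (G' l) \<zeta>"
    proof -
      have "(exp \<zeta> - 1) * m l \<zeta> = M' l \<zeta>" using nz[OF \<zeta>] by (simp add: m_def)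
      then show ?thesis by (subst G'(2)[OF \<zeta>]) (simp only: distrib_left)
    qed
    also have "(exp \<zeta> - 1) * vop e c' l (G' l) \<zeta>
        = contour_integral (linepath c' \<zeta>) (\<lambda>\<xi>. kern (l - \<xi>) (\<zeta> - \<xi>) * G' l \<xi>)"
      using emult[OF \<zeta>] by (rule vop_conv_contour_integral)
    finally show "(exp \<zeta> - 1) * G' l \<zeta> = M' l \<zeta> + contour_integral (linepath c' \<zeta>) (\<lambda>\<xi>. kern (l - \<xi>) (\<zeta> - \<xi>) * G' l \<xi>)" .
  qed
  moreover obtain \<rho> where \<rho>: "\<rho> > 0" "ball c' \<rho> \<subseteq> D" "ball c' \<rho> \<subseteq> B"
  proof -
    obtain s where "s > 0" "ball c' s \<subseteq> D" using D(1) c' open_contains_ball by blast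
    moreover have "ball c' (min s r) \<subseteq> ball c' s" "ball c' (min s r) \<subseteq> ball c' r" by auto
    ultimately show ?thesis using that[of "min s r"] r by (auto simp: B_def)
  qed
  moreover have "G' l \<zeta> = G l \<zeta>" if \<zeta>: "\<zeta> \<in> ball c' \<rho>" for l \<zeta>
  proof -
    interpret U: volterra a R0 C "ball c' \<rho>" c' e
      by unfold_locales (use \<rho> e in \<open>auto intro!: convex_starlike_at intro: holomorphic_on_subset\<close>)
    have cG': "continuous_on (ball c' \<rho>) (G' l)"
      by (rule continuous_on_subset[OF B.hol2_continuous_on_slice[OF G'(1)] \<rho>(3)])
    have cG: "continuous_on (ball c' \<rho>) (G l)"
      by (rule U.hol2_continuous_on_slice[OF hol2_subset[OF G]]) (use \<rho> in auto)
    have Geq: "G l z = m l z + vop e c' l (G l) z" if z: "z \<in> ball c' \<rho>" for z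
    proof -
      have zB: "z \<in> B" and zD: "z \<in> D" using \<rho> z by blast+
      have "closed_segment c' z \<subseteq> ball c' \<rho>"
        using z \<rho>(1) by (intro closed_segment_subset) auto
      then have seg: "closed_segment c' z \<subseteq> D" using \<rho>(2) by blast
      have "(exp z - 1) * G l z = M' l z + contour_integral (linepath c' z) (\<lambda>\<xi>. kern (l - \<xi>) (z - \<xi>) * G l \<xi>)"
        unfolding eq[OF zD] M'_def
        using contour_integral_starlike_split[OF D(3) state_integrand_holomorphic[OF G D(1)] seg, of l z] by simp
      also have "contour_integral (linepath c' z) (\<lambda>\<xi>. kern (l - \<xi>) (z - \<xi>) * G l \<xi>) = (exp z - 1) * vop e c' l (G l) z"
        using vop_conv_contour_integral[of e z "exp z - 1" c' l "G l"] emult[OF zB] by simp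
      finally show ?thesis
        using nz[OF zB] by (simp add: m_def field_simps)
    qed
    have "G' l \<zeta> - G l \<zeta> = 0"
    proof (rule U.volterra_unique[OF _ _ \<zeta>, where f = "\<lambda>z. G' l z - G l z" and l = l])
      show "continuous_on (ball c' \<rho>) (\<lambda>z. G' l z - G l z)"
        by (intro continuous_on_diff cG cG')
      fix z assume z: "z \<in> ball c' \<rho>"
      have "vop e c' l (\<lambda>z. G' l z - G l z) z = vop e c' l (G' l) z - vop e c' l (G l) z"
      proof -
        have "(\<lambda>t. vkern c' l z t * f (c' + t * (z - c'))) contour_integrable_on linepath 0 1"
          if "continuous_on (ball c' \<rho>) f" for f
          by (intro contour_integrable_continuous_linepath U.continuous_on_vop_integrand that z)
        from contour_integral_diff[OF this[OF cG'] this[OF cG]] show ?thesis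
          by (simp only: vop_def right_diff_distrib[of "vkern _ _ _ _"] right_diff_distrib[of "e z"])
      qed
      moreover have "z \<in> B" using z \<rho> by blast
      ultimately show "G' l z - G l z = vop e c' l (\<lambda>z. G' l z - G l z) z"
        using Geq[OF z] G'(2)[of z l] by simp
    qed
    then show ?thesis by simp
  qed
  ultimately show ?thesis using that unfolding B_def by blast
qed

text \<open>
  The continued object is read off from \<open>G\<close> along a curve \<open>\<lambda> = l(\<zeta>)\<close>: with \<open>l = 0\<close> for \<open>\<psi>\<close>, and on the
  diagonal, with a factor \<open>1 / \<zeta>\<close>, for \<open>\<phi>\<close>.
\<close>

lemma extends_to_R_of_state:
  assumes st: "state cut_plane 0 M G" and l: "l holomorphic_on UNIV" and w: "w holomorphic_on - {0}"
    and g: "g holomorphic_on cut_plane" and eq: "\<And>\<zeta>. \<zeta> \<in> cut_plane \<Longrightarrow> \<zeta> \<noteq> 0 \<Longrightarrow> g \<zeta> = w \<zeta> * G (l \<zeta>) \<zeta>"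
  shows "extends_to_R (fps_expansion g 0)"
proof -
  define Good where "Good = (\<lambda>D g. \<exists>c M G. state D c M G \<and> g holomorphic_on D \<and>
    (\<forall>\<zeta>\<in>D - {0}. g \<zeta> = w \<zeta> * G (l \<zeta>) \<zeta>))"
  show ?thesis
  proof (rule extends_to_R_if_locally_continuable[of Good])
    show "Good cut_plane g"
      unfolding Good_def using st g eq by blast
    show "0 \<in> cut_plane" by (rule zero_in_cut_plane)
    show "open D \<and> g holomorphic_on D" if "Good D g" for D g
      using that unfolding Good_def state_def by blast
    fix D g c' r assume "Good D g" and c': "c' \<in> D" "0 < r" "ball c' r \<inter> two_pi_i_Z = {}"
    then obtain c M G where st: "state D c M G" and g: "\<And>\<zeta>. \<zeta> \<in> D \<Longrightarrow> \<zeta> \<noteq> 0 \<Longrightarrow> g \<zeta> = w \<zeta> * G (l \<zeta>) \<zeta>"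
      unfolding Good_def by blast
    obtain M' G' \<rho> where G': "state (ball c' r) c' M' G'" "\<rho> > 0" "\<And>l \<zeta>. \<zeta> \<in> ball c' \<rho> \<Longrightarrow> G' l \<zeta> = G l \<zeta>"
      by (rule state_step[OF st c']) (rule that)
    have no0: "0 \<notin> ball c' r"
    proof -
      have "0 \<in> two_pi_i_Z" by (simp add: two_pi_i_Z_iff)
      then show ?thesis using c'(3) by blast
    qed
    have "open D" using st unfolding state_def by blast
    then obtain s where s: "s > 0" "ball c' s \<subseteq> D" using c'(1) open_contains_ball by blast
    define g' where "g' = (\<lambda>\<zeta>. w \<zeta> * G' (l \<zeta>) \<zeta>)"
    have hG': "hol2 (UNIV \<times> ball c' r) G'" using G'(1) unfolding state_def by blast
    have "g' holomorphic_on ball c' r"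
      unfolding g'_def
      by (intro holomorphic_on_mult holomorphic_on_subset[OF w] hol2D[OF hG'] holomorphic_on_subset[OF l])
        (use no0 in auto)
    then have "Good (ball c' r) g'"
      unfolding Good_def using G'(1) g'_def by blast
    moreover have "g' \<zeta> = g \<zeta>" if "\<zeta> \<in> ball c' (min (min s r) \<rho>)" for \<zeta>
    proof -
      have "\<zeta> \<in> D" "\<zeta> \<in> ball c' r" "\<zeta> \<in> ball c' \<rho>" using that s by auto
      moreover from this no0 have "\<zeta> \<noteq> 0" by blast
      ultimately show ?thesis using g[of \<zeta>] G'(3)[of \<zeta>] by (simp add: g'_def)
    qed
    ultimately show "\<exists>g' \<rho>. Good (ball c' r) g' \<and> \<rho> > 0 \<and> (\<forall>\<zeta>\<in>ball c' \<rho>. g' \<zeta> = g \<zeta>)"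
      using s(1) c'(2) G'(2) by (intro exI[of _ g'] exI[of _ "min (min s r) \<rho>"]) auto
  qed
qed

end

context parabolic begin

section \<open>Formal and analytic solutions at the origin\<close>

lemma kappa_has_fps_expansion:
  "(\<lambda>\<xi>. kappa (l - \<xi>) m) has_fps_expansion kernel_poly a l m"
proof -
  have "(\<lambda>\<xi>. \<Sum>n\<le>Suc m. ((a ^ n) $ Suc m / fact n) * (l - \<xi>) ^ n) has_fps_expansion kernel_poly a l m"
    unfolding kernel_poly_def
    by (intro has_fps_expansion_sum has_fps_expansion_mult has_fps_expansion_power has_fps_expansion_diff
        has_fps_expansion_const has_fps_expansion_fps_X)
  then show ?thesis
    unfolding kappa_altdef by (simp add: field_simps del: sum.atMost_Suc fact_Suc)
qed

lemma kern_has_fps_expansion: "kern l has_fps_expansion formal_borel ((fps_exp l oo a) - 1)"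
proof (rule has_fps_expansionI)
  have "(\<lambda>m. formal_borel ((fps_exp l oo a) - 1) $ m * u ^ m) sums kern l u" for u
    using kern_sums[where x = l and \<eta> = u] by (simp add: formal_borel_nth kappa_def)
  then show "\<forall>\<^sub>F u in nhds 0. (\<lambda>m. formal_borel ((fps_exp l oo a) - 1) $ m * u ^ m) sums kern l u"
    by simp
qed

text \<open>
  The Taylor coefficients of the Volterra integral are given by the formal operator: truncating the kernel
  after \<open>\<eta>\<^sup>N\<close> changes the integral by \<open>O(\<zeta>\<^sup>N\<^sup>+\<^sup>1)\<close> only.
\<close>

lemma volterra_integral_fps_nth:
  assumes g: "g holomorphic_on ball 0 r" and r: "0 < r"
    and J: "(\<lambda>\<zeta>. contour_integral (linepath 0 \<zeta>) (\<lambda>\<xi>. kern (l - \<xi>) (\<zeta> - \<xi>) * g \<xi>)) has_fps_expansion Jf"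
  shows "Jf $ N = (\<Sum>m\<le>N. (fps_integral0 ^^ Suc m) (kernel_poly a l m * fps_expansion g 0) $ N)"
proof -
  have gexp: "g has_fps_expansion fps_expansion g 0"
    using g r by (intro has_fps_expansion_fps_expansion[of "ball 0 r"]) auto
  define h where "h = (\<lambda>m \<xi>. kappa (l - \<xi>) m * g \<xi>)"
  have h: "h m holomorphic_on ball 0 r" for m
    unfolding h_def kappa_altdef using g by (intro holomorphic_intros) auto
  have hexp: "fps_expansion (h m) 0 = kernel_poly a l m * fps_expansion g 0" for m
    unfolding h_def by (intro fps_expansion_eqI has_fps_expansion_mult kappa_has_fps_expansion gexp)
  have "\<exists>S. S holomorphic_on ball 0 r \<and>
      fps_expansion S 0 = (fps_integral0 ^^ Suc m) (kernel_poly a l m * fps_expansion g 0) \<and>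
      (\<forall>\<zeta>\<in>ball 0 r. contour_integral (linepath 0 \<zeta>) (\<lambda>\<xi>. h m \<xi> * ((\<zeta> - \<xi>) ^ m / fact m)) = S \<zeta>)" for m
  proof -
    obtain S where "S holomorphic_on ball 0 r"
      "fps_expansion S 0 = (fps_integral0 ^^ Suc m) (fps_expansion (h m) 0)"
      "\<And>\<zeta>. \<zeta> \<in> ball 0 r \<Longrightarrow> contour_integral (linepath 0 \<zeta>) (\<lambda>\<xi>. h m \<xi> * ((\<zeta> - \<xi>) ^ m / fact m)) = S \<zeta>"
      by (rule contour_integral_power_kernel[OF h r]) (rule that)
    then show ?thesis by (intro exI[of _ S] conjI ballI) (simp_all only: hexp)
  qed
  then obtain S where S: "\<And>m. S m holomorphic_on ball 0 r"
    "\<And>m. fps_expansion (S m) 0 = (fps_integral0 ^^ Suc m) (kernel_poly a l m * fps_expansion g 0)"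
    "\<And>m \<zeta>. \<zeta> \<in> ball 0 r \<Longrightarrow> contour_integral (linepath 0 \<zeta>) (\<lambda>\<xi>. h m \<xi> * ((\<zeta> - \<xi>) ^ m / fact m)) = S m \<zeta>"
    by metis
  have Sexp: "S m has_fps_expansion fps_expansion (S m) 0" for m
    using S(1) r by (intro has_fps_expansion_fps_expansion[of "ball 0 r"]) auto
  define s where "s = min (r / 2) 1"
  have s: "0 < s" "s < r" "s \<le> 1" using r by (auto simp: s_def)
  have "bounded (g ` cball 0 s)"
    using s by (intro compact_imp_bounded compact_continuous_image holomorphic_on_imp_continuous_on
        holomorphic_on_subset[OF g]) auto
  then obtain B where "\<forall>x\<in>g ` cball 0 s. norm x \<le> B" unfolding bounded_iff by blast
  then have B: "\<And>x. norm x \<le> s \<Longrightarrow> norm (g x) \<le> B" by auto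
  have B0: "B \<ge> 0" using B[of 0] s(1) order_trans[OF norm_ge_zero] by auto
  define A where "A = R0 * (exp (C * (norm l + 1) / R0\<^sup>2) - 1) * exp R0"
  have A0: "A \<ge> 0" using R0 C by (simp add: A_def)
  let ?J = "\<lambda>\<zeta>. contour_integral (linepath 0 \<zeta>) (\<lambda>\<xi>. kern (l - \<xi>) (\<zeta> - \<xi>) * g \<xi>)"
  have small: "norm (?J \<zeta> - (\<Sum>m\<le>N. S m \<zeta>)) \<le> A * B * norm \<zeta> ^ Suc N" if \<zeta>: "norm \<zeta> \<le> s" for \<zeta>
  proof -
    have \<zeta>r: "\<zeta> \<in> ball 0 r" using \<zeta> s by simp
    have seg: "closed_segment 0 \<zeta> \<subseteq> ball 0 r"
      using \<zeta>r r by (intro closed_segment_subset) auto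
    have segs: "norm \<xi> \<le> norm \<zeta>" "norm (\<zeta> - \<xi>) \<le> norm \<zeta>" if "\<xi> \<in> closed_segment 0 \<zeta>" for \<xi>
      using segment_bound[OF that] by (simp_all add: norm_minus_commute)
    define k where "k = (\<lambda>\<xi>. (\<Sum>m\<le>N. h m \<xi> * ((\<zeta> - \<xi>) ^ m / fact m)))"
    have int1: "(\<lambda>\<xi>. kern (l - \<xi>) (\<zeta> - \<xi>) * g \<xi>) contour_integrable_on linepath 0 \<zeta>"
    proof (intro contour_integrable_continuous_linepath continuous_on_mult)
      show "continuous_on (closed_segment 0 \<zeta>) (\<lambda>\<xi>. kern (l - \<xi>) (\<zeta> - \<xi>))"
        by (intro hol2_continuous_compose[OF hol2_kern]) (auto intro!: continuous_intros)
      show "continuous_on (closed_segment 0 \<zeta>) g"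
        using seg by (intro holomorphic_on_imp_continuous_on holomorphic_on_subset[OF g])
    qed
    have int2: "(\<lambda>\<xi>. h m \<xi> * ((\<zeta> - \<xi>) ^ m / fact m)) contour_integrable_on linepath 0 \<zeta>" for m
    proof (intro contour_integrable_continuous_linepath continuous_on_mult)
      show "continuous_on (closed_segment 0 \<zeta>) (h m)"
        using seg by (intro holomorphic_on_imp_continuous_on holomorphic_on_subset[OF h])
    qed (auto intro!: continuous_intros)
    have int3: "k contour_integrable_on linepath 0 \<zeta>"
      unfolding k_def by (intro contour_integrable_sum int2 finite_atMost)
    have "(\<Sum>m\<le>N. S m \<zeta>) = contour_integral (linepath 0 \<zeta>) k"
      unfolding k_def contour_integral_sum[OF finite_atMost int2] using S(3)[OF \<zeta>r] by simp
    then have "?J \<zeta> - (\<Sum>m\<le>N. S m \<zeta>) = contour_integral (linepath 0 \<zeta>) (\<lambda>\<xi>. kern (l - \<xi>) (\<zeta> - \<xi>) * g \<xi> - k \<xi>)"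
      using contour_integral_diff[OF int1 int3] by simp
    also have "norm \<dots> \<le> (A * norm \<zeta> ^ Suc N * B) * norm (\<zeta> - 0)"
    proof (rule contour_integral_bound_linepath[OF contour_integrable_diff[OF int1 int3]])
      show "0 \<le> A * norm \<zeta> ^ Suc N * B" using A0 B0 by simp
      fix \<xi> assume \<xi>: "\<xi> \<in> closed_segment 0 \<zeta>"
      have le1: "norm (\<zeta> - \<xi>) \<le> 1" and "norm \<xi> \<le> 1" using segs[OF \<xi>] \<zeta> s by auto
      then have x: "norm (l - \<xi>) \<le> norm l + 1" using norm_triangle_ineq4[of l \<xi>] by linarith
      have "kern (l - \<xi>) (\<zeta> - \<xi>) * g \<xi> - k \<xi> =
          (kern (l - \<xi>) (\<zeta> - \<xi>) - (\<Sum>m\<le>N. kappa (l - \<xi>) m / fact m * (\<zeta> - \<xi>) ^ m)) * g \<xi>"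
        unfolding k_def h_def left_diff_distrib sum_distrib_right by (simp add: mult_ac)
      also have "norm \<dots> \<le> (A * norm \<zeta> ^ Suc N) * B"
        unfolding norm_mult
      proof (intro mult_mono)
        have "norm (kern (l - \<xi>) (\<zeta> - \<xi>) - (\<Sum>m\<le>N. kappa (l - \<xi>) m / fact m * (\<zeta> - \<xi>) ^ m)) \<le> A * norm (\<zeta> - \<xi>) ^ Suc N"
          unfolding A_def by (rule kern_tail_le[OF x le1])
        also have "\<dots> \<le> A * norm \<zeta> ^ Suc N"
          using A0 segs[OF \<xi>] by (intro mult_left_mono power_mono) auto
        finally show "norm (kern (l - \<xi>) (\<zeta> - \<xi>) - (\<Sum>m\<le>N. kappa (l - \<xi>) m / fact m * (\<zeta> - \<xi>) ^ m)) \<le> A * norm \<zeta> ^ Suc N" .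
        show "norm (g \<xi>) \<le> B" using B segs[OF \<xi>] \<zeta> by simp
      qed (use A0 in auto)
      finally show "norm (kern (l - \<xi>) (\<zeta> - \<xi>) * g \<xi> - k \<xi>) \<le> A * norm \<zeta> ^ Suc N * B" .
    qed
    also have "\<dots> \<le> (A * norm \<zeta> ^ Suc N * B) * 1"
      using \<zeta> s A0 B0 by (intro mult_left_mono) auto
    finally show ?thesis by (simp add: mult_ac)
  qed
  have "(\<lambda>\<zeta>. ?J \<zeta> - (\<Sum>m\<le>N. S m \<zeta>)) has_fps_expansion (Jf - (\<Sum>m\<le>N. fps_expansion (S m) 0))"
    by (intro has_fps_expansion_diff J has_fps_expansion_sum Sexp)
  then have "(Jf - (\<Sum>m\<le>N. fps_expansion (S m) 0)) $ N = 0"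
  proof (rule fps_nth_eq_0_if_small)
    show "\<forall>\<^sub>F \<zeta> in nhds 0. norm (?J \<zeta> - (\<Sum>m\<le>N. S m \<zeta>)) \<le> A * B * norm \<zeta> ^ Suc N"
    proof (rule eventually_mono[OF eventually_nhds_in_open[of "ball 0 s"]])
      fix \<zeta> :: complex assume "\<zeta> \<in> ball 0 s"
      then show "norm (?J \<zeta> - (\<Sum>m\<le>N. S m \<zeta>)) \<le> A * B * norm \<zeta> ^ Suc N"
        by (intro small) simp
    qed (use s in auto)
  qed simp
  then show ?thesis by (simp add: fps_sum_nth S(2) del: funpow.simps)
qed

text \<open>
  The inverse Borel transform \<open>H0\<close> of the Taylor series of \<open>G l\<close> satisfies the same formal difference equation as \<open>H\<close>,
  which has a unique solution.
\<close>

lemma state_fps_expansion: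
  assumes st: "state cut_plane 0 M G" and M: "M l has_fps_expansion formal_borel R"
    and R: "R $ 0 = 0" and H: "H $ 0 = 0"
    and eq: "fsubst H (- 1) = R + (fps_exp l oo a) * fsubst H a"
  shows "fps_expansion (G l) 0 = formal_borel H"
proof -
  have G: "hol2 (UNIV \<times> cut_plane) G"
    and Geq: "\<And>\<zeta>. \<zeta> \<in> cut_plane \<Longrightarrow> (exp \<zeta> - 1) * G l \<zeta>
        = M l \<zeta> + contour_integral (linepath 0 \<zeta>) (\<lambda>\<xi>. kern (l - \<xi>) (\<zeta> - \<xi>) * G l \<xi>)"
    using st unfolding state_def by blast+
  let ?J = "\<lambda>\<zeta>. contour_integral (linepath 0 \<zeta>) (\<lambda>\<xi>. kern (l - \<xi>) (\<zeta> - \<xi>) * G l \<xi>)"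
  obtain r where r: "r > 0" "ball 0 r \<subseteq> cut_plane"
    using open_cut_plane zero_in_cut_plane open_contains_ball by blast
  have gh: "G l holomorphic_on cut_plane"
    by (rule hol2D[OF G open_cut_plane, of "\<lambda>_. l" "\<lambda>z. z"]) (auto intro!: holomorphic_intros)
  define g where "g = fps_expansion (G l) 0"
  have gexp: "G l has_fps_expansion g"
    unfolding g_def by (rule has_fps_expansion_fps_expansion[OF open_cut_plane zero_in_cut_plane gh])
  define Jf where "Jf = (fps_exp 1 - 1) * g - formal_borel R"
  have A: "(\<lambda>\<zeta>. (exp \<zeta> - 1) * G l \<zeta> - M l \<zeta>) has_fps_expansion Jf"
    unfolding Jf_def
    by (intro has_fps_expansion_diff has_fps_expansion_mult has_fps_expansion_exp1 has_fps_expansion_1 gexp M)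
  have B: "\<forall>\<^sub>F \<zeta> in nhds 0. (exp \<zeta> - 1) * G l \<zeta> - M l \<zeta> = ?J \<zeta>"
    by (rule eventually_mono[OF eventually_nhds_in_open[OF open_cut_plane zero_in_cut_plane]]) (simp add: Geq)
  have J: "?J has_fps_expansion Jf"
    by (rule iffD1[OF has_fps_expansion_cong[OF B refl] A])
  obtain H0 where H0: "H0 $ 0 = 0" "formal_borel H0 = g" using formal_borel_surj by blast
  have "Jf = formal_borel ((fps_exp l oo a) * fsubst H0 a - H0)"
  proof (rule fps_ext)
    fix N
    show "Jf $ N = formal_borel ((fps_exp l oo a) * fsubst H0 a - H0) $ N"
      unfolding formal_borel_twisted_fsubst[OF a0 H0(1)] H0(2)
      unfolding g_def by (rule volterra_integral_fps_nth[OF holomorphic_on_subset[OF gh r(2)] r(1) J])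
  qed
  moreover have "formal_borel (fsubst H0 (- 1)) = fps_exp 1 * g"
  proof -
    have c: "fps_const (- 1) = (- 1 :: complex fps)" by (simp flip: fps_const_neg)
    show ?thesis
      using formal_borel_fsubst_const[of H0 "- 1"] unfolding c H0(2) minus_minus .
  qed
  ultimately have "formal_borel (fsubst H0 (- 1)) = formal_borel (R + (fps_exp l oo a) * fsubst H0 a)"
    unfolding Jf_def H0(2)[symmetric] formal_borel_add[symmetric]
    by (simp add: fps_eq_iff formal_borel_nth algebra_simps diff_divide_distrib add_divide_distrib)
  then have eq0: "fsubst H0 (- 1) = R + (fps_exp l oo a) * fsubst H0 a"
    by (rule formal_borel_inj) (simp add: H0 R)
  have "fsubst (H - H0) (- 1) = (fps_exp l oo a) * fsubst (H - H0) a"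
    unfolding fsubst_diff eq eq0 by (simp add: algebra_simps)
  then have "H - H0 = 0"
  proof (rule difference_equation_unique)
    show "(fps_exp l oo a) $ 1 = 0" using a0 a1 by (simp add: fps_compose_nth)
  qed (use H H0 a0 in auto)
  then show ?thesis using H0(2) by (simp add: g_def)
qed

end

section \<open>Growth of solutions in the right half-plane\<close>

lemma has_integral_exp_unit:
  assumes q: "q > (0::real)"
  shows "((\<lambda>t. exp (- q * (1 - t))) has_integral (1 - exp (- q)) / q) {0..1}"
proof -
  have "((\<lambda>t. exp (- q * (1 - t)) / q) has_vector_derivative exp (- q * (1 - t))) (at t within {0..1})" for t :: real
    unfolding has_real_derivative_iff_has_vector_derivative[symmetric]
    using q by (auto intro!: derivative_eq_intros simp: field_simps)
  then have "((\<lambda>t. exp (- q * (1 - t))) has_integral (exp (- q * (1 - 1)) / q - exp (- q * (1 - 0)) / q)) {0..1}"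
    by (intro fundamental_theorem_of_calculus) auto
  then show ?thesis by (simp add: diff_divide_distrib)
qed

lemma exp_minus_one_le:
  fixes y :: real
  shows "exp y - 1 \<le> y * exp y"
proof -
  have "1 - y \<le> exp (- y)" using exp_ge_add_one_self[of "- y"] by simp
  then have "(1 - y) * exp y \<le> exp (- y) * exp y" by (intro mult_right_mono) auto
  then show ?thesis by (simp add: algebra_simps flip: exp_add)
qed

lemma one_plus_exp_le:
  fixes x :: real
  assumes "x \<ge> 0"
  shows "(1 + x) * exp (- (x / 2)) \<le> 2"
proof -
  have "1 + x / 2 \<le> exp (x / 2)" by (rule exp_ge_add_one_self)
  then have "1 + x \<le> 2 * exp (x / 2)" using assms by linarith
  then have "(1 + x) * exp (- (x / 2)) \<le> 2 * exp (x / 2) * exp (- (x / 2))" by (intro mult_right_mono) auto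
  also have "\<dots> = 2" by (simp add: mult.assoc flip: exp_add)
  finally show ?thesis .
qed

lemma sqrt_divide_mult_self:
  fixes s :: real
  assumes "s > 0"
  shows "sqrt (d / s) * s = sqrt d * sqrt s"
proof -
  have "sqrt (d / s) * s = sqrt d * (s / sqrt s)" by (simp add: real_sqrt_divide)
  also have "s / sqrt s = sqrt s" using assms by (intro real_div_sqrt) simp
  finally show ?thesis .
qed

text \<open>
  The exponential decay in the right half-plane.  It is lost in the left half-plane, where \<open>e\<^sup>\<zeta> - 1\<close> tends
  to \<open>- 1\<close>.
\<close>

lemma norm_todd_le:
  assumes k: "0 < k" "k \<le> 1" and u: "norm u = 1" "k \<le> Re u" and s: "s \<ge> 0"
  shows "norm (todd (of_real s * u)) \<le> (1 + k * s) / k * exp (- (k * s))"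
proof (cases "s = 0")
  case True
  then show ?thesis using k by (simp add: todd_def)
next
  case False
  then have s: "s > 0" using s by simp
  define x where "x = k * s"
  have x: "x > 0" using k s by (simp add: x_def)
  have "exp x - 1 \<le> norm (exp (of_real s * u)) - norm (1::complex)"
    using u(2) s by (simp add: x_def mult.commute)
  also have "\<dots> \<le> norm (exp (of_real s * u) - 1)" by (rule norm_triangle_ineq2)
  finally have 1: "exp x - 1 \<le> norm (exp (of_real s * u) - 1)" .
  have "1 + x \<le> exp x" by (rule exp_ge_add_one_self)
  then have 2: "x * exp x \<le> (1 + x) * (exp x - 1)" by (simp add: algebra_simps)
  have pos: "exp x - 1 > 0" using x by simp
  then have ne: "of_real s * u \<noteq> 0" using s u by auto
  have "norm (todd (of_real s * u)) = s / norm (exp (of_real s * u) - 1)"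
    using ne s u by (simp add: todd_def norm_divide norm_mult)
  also have "\<dots> \<le> s / (exp x - 1)"
    using 1 pos s by (intro divide_left_mono mult_pos_pos) auto
  also have "\<dots> \<le> (1 + x) / k * exp (- x)"
  proof -
    have "k * s * exp x \<le> (1 + x) * (exp x - 1)" using 2 by (simp add: x_def)
    then show ?thesis using pos k by (simp add: exp_minus field_simps)
  qed
  finally show ?thesis by (simp add: x_def)
qed

context parabolic begin

text \<open>
  The weight for the sup norm along a ray, for \<open>|\<lambda>|, |\<zeta>| \<le> L\<close>.  Its logarithmic derivative in \<open>s\<close> is twice
  \<open>rate k L s\<close>: one half pays for the factor \<open>exp (R |\<eta>|)\<close> in the bound of the kernel, the other half
  makes the integral over the segment converge.  For \<open>s \<le> L\<close> the weight is at most exponential in \<open>L\<close>.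
\<close>

definition weight_fun :: "real \<Rightarrow> real \<Rightarrow> real \<Rightarrow> real" where
  "weight_fun k L s = exp (2 * R0 * s + 4 * sqrt (8 * C / k * L * s))"

text \<open>
  The value of \<open>R\<close> used in the bound of the kernel at distance \<open>s\<close> from the origin.  It is the smallest order of magnitude for
  which \<open>C |\<lambda>| / R\<^sup>2\<close> is a small multiple of \<open>k s\<close>, the exponent of the decay of the Todd function.
\<close>

definition rate :: "real \<Rightarrow> real \<Rightarrow> real \<Rightarrow> real" where
  "rate k L s = R0 + sqrt (8 * C / k * L / s)"

context
  fixes k L :: real
  assumes k: "0 < k" "k \<le> 1" and L: "L \<ge> 0"
begin

lemma D_nonneg: "8 * C / k * L \<ge> 0"
  using k L C by simp

lemma rate_ge:
  assumes "s > 0"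
  shows "rate k L s \<ge> R0"
proof -
  have "8 * C / k * L / s \<ge> 0" using D_nonneg assms by (intro divide_nonneg_nonneg) auto
  then show ?thesis by (simp add: rate_def)
qed

lemma rate_exponent_le:
  assumes s: "s > 0"
  shows "C * (2 * L) / (rate k L s)\<^sup>2 \<le> k * s / 4"
proof -
  have pos: "rate k L s > 0" using rate_ge[OF s] R0 by simp
  have q: "8 * C / k * L / s \<ge> 0" using D_nonneg s by (intro divide_nonneg_nonneg) auto
  have "8 * C / k * L / s = (sqrt (8 * C / k * L / s))\<^sup>2" using q by simp
  also have "\<dots> \<le> (rate k L s)\<^sup>2"
    unfolding rate_def using R0 q by (intro power_mono) auto
  finally have "k * s / 4 * (8 * C / k * L / s) \<le> k * s / 4 * (rate k L s)\<^sup>2"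
    using k s by (intro mult_left_mono) auto
  moreover have "k * s / 4 * (8 * C / k * L / s) = C * (2 * L)"
    using k s by (simp add: field_simps)
  ultimately show ?thesis using pos by (simp add: divide_le_eq)
qed

lemma rate_exp_le:
  assumes s: "s > 0"
  shows "exp (C * (2 * L) / (rate k L s)\<^sup>2) - 1 \<le> C * (2 * L) / (rate k L s)\<^sup>2 * exp (k * s / 4)"
proof -
  define y where "y = C * (2 * L) / (rate k L s)\<^sup>2"
  have "exp y - 1 \<le> y * exp y" by (rule exp_minus_one_le)
  also have "\<dots> \<le> y * exp (k * s / 4)"
    using rate_exponent_le[OF s] C L by (intro mult_left_mono) (auto simp: y_def)
  finally show ?thesis by (simp add: y_def)
qed

text \<open>
  The exponent of the weight is a concave function of \<open>s\<close>, hence lies below its tangent at \<open>s\<close>.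
\<close>

lemma weight_fun_concave:
  assumes s: "s > 0" and t: "t \<in> {0..1}"
  shows "weight_fun k L (t * s) \<le> weight_fun k L s * exp (- (2 * rate k L s * s * (1 - t)))"
proof -
  define d where "d = sqrt (8 * C / k * L)"
  have d: "d \<ge> 0" using D_nonneg by (simp add: d_def)
  have 1: "sqrt (8 * C / k * L * x) = d * sqrt x" for x
    by (simp only: d_def real_sqrt_mult[of "8 * C / k * L"])
  have 2: "sqrt (8 * C / k * L / s) * s = d * sqrt s"
    unfolding d_def by (rule sqrt_divide_mult_self[OF s])
  have st: "sqrt (t * s) = sqrt t * sqrt s" by (rule real_sqrt_mult)
  have t1: "sqrt t \<le> 1" "sqrt t \<ge> 0" using t by auto
  have "t = sqrt t * sqrt t" using t by simp
  then have "(1 - t) \<le> 2 * (1 - sqrt t)"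
    using t1 sum_power2_ge_zero[of "1 - sqrt t" 0] by (simp add: power2_eq_square algebra_simps)
  then have "d * sqrt s * (1 - t) \<le> d * sqrt s * (2 * (1 - sqrt t))"
    using d s by (intro mult_left_mono) auto
  then have "2 * R0 * (t * s) + 4 * (d * sqrt (t * s))
     \<le> 2 * R0 * s + 4 * (d * sqrt s) - 2 * (R0 * s + d * sqrt s) * (1 - t)"
    unfolding st by (simp add: algebra_simps)
  also have "R0 * s + d * sqrt s = rate k L s * s"
    unfolding rate_def distrib_right 2 ..
  finally have "2 * R0 * (t * s) + 4 * (d * sqrt (t * s))
     \<le> 2 * R0 * s + 4 * (d * sqrt s) + - (2 * rate k L s * s * (1 - t))"
    by (simp add: mult.assoc)
  then show ?thesis
    unfolding weight_fun_def 1 by (simp only: exp_add[symmetric] exp_le_cancel_iff)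
qed

lemma rate_le_weight: 
  assumes s: "s > 0"
  shows "exp (rate k L s * s) \<le> weight_fun k L s"
proof -
  have "sqrt (8 * C / k * L / s) * s = sqrt (8 * C / k * L) * sqrt s"
    by (rule sqrt_divide_mult_self[OF s])
  also have "\<dots> = sqrt (8 * C / k * L * s)" by (simp only: real_sqrt_mult[of "8 * C / k * L"])
  also have "\<dots> \<le> 4 * sqrt (8 * C / k * L * s)"
  proof -
    have "8 * C / k * L * s \<ge> 0" by (rule mult_nonneg_nonneg[OF D_nonneg]) (use s in simp)
    from real_sqrt_ge_zero[OF this] show ?thesis by linarith
  qed
  finally have "R0 * s + sqrt (8 * C / k * L / s) * s \<le> 2 * R0 * s + 4 * sqrt (8 * C / k * L * s)"
    using mult_pos_pos[OF R0 s] by linarith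
  then show ?thesis
    unfolding rate_def weight_fun_def distrib_right exp_le_cancel_iff .
qed

text \<open>
  At the point of the ray where \<open>|G|\<close> relative to the weight attains its maximum \<open>N\<close>, the equation gives
  \<open>N \<le> 2 Q / k + N / 2\<close>.
\<close>

lemma volterra_growth:
  assumes u: "norm u = 1" "k \<le> Re u" and l: "norm l \<le> L"
    and Gc: "continuous_on cut_plane (G l)"
    and eq: "\<And>\<zeta>. \<zeta> \<in> cut_plane \<Longrightarrow> G l \<zeta> = todd \<zeta> * M1 l \<zeta> + vop todd 0 l (G l) \<zeta>"
    and M1: "\<And>s. s \<in> {0..L} \<Longrightarrow> norm (M1 l (of_real s * u)) \<le> Q * exp (k * s / 4) * weight_fun k L s"
    and s: "s \<in> {0..L}"
  shows "norm (G l (of_real s * u)) \<le> 4 / k * Q * weight_fun k L s"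
proof -
  interpret volterra a R0 C cut_plane 0 todd
    by unfold_locales (auto intro: open_cut_plane zero_in_cut_plane starlike_at_cut_plane todd_holomorphic)
  have ray: "of_real x * u \<in> cut_plane" if "x \<ge> 0" for x
  proof (cases "x = 0")
    case False
    then have "Re (of_real x * u) > 0" using that u(2) k by simp
    then show ?thesis unfolding cut_plane_iff by linarith
  qed (simp add: zero_in_cut_plane)
  define \<Phi> where "\<Phi> = (\<lambda>x. norm (G l (of_real x * u)) / weight_fun k L x)"
  have Wpos: "weight_fun k L x > 0" for x by (simp add: weight_fun_def)
  have "continuous_on {0..L} \<Phi>"
    unfolding \<Phi>_def weight_fun_def
    by (intro continuous_intros continuous_on_compose2[OF Gc]) (auto intro!: ray)
  then obtain x where x: "x \<in> {0..L}" "\<And>y. y \<in> {0..L} \<Longrightarrow> \<Phi> y \<le> \<Phi> x"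
    using continuous_attains_sup[of "{0..L}" \<Phi>] L by auto
  define N where "N = \<Phi> x"
  have N0: "N \<ge> 0" using Wpos[of x] by (simp add: N_def \<Phi>_def)
  have GN: "norm (G l (of_real y * u)) \<le> N * weight_fun k L y" if "y \<in> {0..L}" for y
    using x(2)[OF that] Wpos[of y] by (simp add: N_def \<Phi>_def field_simps)
  have x0: "x \<ge> 0" using x by simp
  define \<zeta> where "\<zeta> = of_real x * u"
  define W where "W = weight_fun k L x"
  have W: "W > 0" using Wpos by (simp add: W_def)
  have Q: "Q \<ge> 0"
  proof -
    have "0 \<le> Q * exp (k * x / 4) * weight_fun k L x"
      using M1[OF x(1)] order_trans[OF norm_ge_zero] by blast
    then show ?thesis using Wpos[of x] by (simp add: zero_le_mult_iff)
  qed
  have T: "norm (todd \<zeta>) \<le> (1 + k * x) / k * exp (- (k * x))"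
    unfolding \<zeta>_def by (rule norm_todd_le[OF k u x0])
  \<comment> \<open>Only half of the decay of the Todd function is needed to absorb the linear factor; a quarter of it is spent
    on the kernel.\<close>
  have E2: "(1 + k * x) * exp (- (k * x)) * exp (k * x / 4) \<le> 2"
  proof -
    have "exp (- (k * x)) * exp (k * x / 4) = exp (- (3 / 4 * (k * x)))"
      by (simp flip: exp_add)
    also have "\<dots> \<le> exp (- (k * x / 2))" using k x0 by simp
    finally have "(1 + k * x) * (exp (- (k * x)) * exp (k * x / 4)) \<le> (1 + k * x) * exp (- (k * x / 2))"
      using k x0 by (intro mult_left_mono) auto
    also have "\<dots> \<le> 2" using k x0 by (intro one_plus_exp_le) simp
    finally show ?thesis by (simp add: mult.assoc)
  qed
  have inh: "norm (todd \<zeta> * M1 l \<zeta>) \<le> 2 / k * Q * W"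
  proof -
    have "norm (todd \<zeta> * M1 l \<zeta>) \<le> (1 + k * x) / k * exp (- (k * x)) * (Q * exp (k * x / 4) * W)"
      unfolding norm_mult W_def using T M1[OF x(1)] k x0 by (intro mult_mono) (auto simp: \<zeta>_def)
    also have "\<dots> = ((1 + k * x) * exp (- (k * x)) * exp (k * x / 4)) * (Q * W / k)"
      by (simp add: field_simps)
    also have "\<dots> \<le> 2 * (Q * W / k)"
      using E2 Q W k by (intro mult_right_mono) auto
    finally show ?thesis by (simp add: field_simps)
  qed
  have vop_le: "norm (vop todd 0 l (G l) \<zeta>) \<le> N * W / 2"
  proof (cases "x = 0")
    case True
    then have "vop todd 0 l (G l) \<zeta> = 0"
      by (simp add: vop_def vkern_def kern_def \<zeta>_def)
    then show ?thesis using N0 W by simp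
  next
    case False
    then have xp: "x > 0" using x0 by simp
    define R where "R = rate k L x"
    have R: "R \<ge> R0" using rate_ge[OF xp] by (simp add: R_def)
    have Rp: "R > 0" using R R0 by simp
    define y where "y = C * (2 * L) / R\<^sup>2"
    have y0: "y \<ge> 0" using C L by (simp add: y_def)
    have yk: "y \<le> k * x / 4" unfolding y_def R_def by (rule rate_exponent_le[OF xp])
    have ey: "exp y - 1 \<le> y * exp (k * x / 4)" unfolding y_def R_def by (rule rate_exp_le[OF xp])
    define q where "q = R * x"
    have q: "q > 0" using Rp xp by (simp add: q_def)
    define b where "b = R * (exp y - 1) * (N * W)"
    have b0: "b \<ge> 0" using Rp y0 N0 W by (simp add: b_def)
    have "norm (contour_integral (linepath 0 1) (\<lambda>t. vkern 0 l \<zeta> t * G l (0 + t * (\<zeta> - 0)))) \<le> b * ((1 - exp (- q)) / q)"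
    proof (rule norm_contour_integral_unit_le[OF continuous_on_vop_integrand[OF Gc]])
      show "\<zeta> \<in> cut_plane" unfolding \<zeta>_def by (rule ray[OF x0])
      show "((\<lambda>t. b * exp (- q * (1 - t))) has_integral b * ((1 - exp (- q)) / q)) {0..1}"
        by (intro has_integral_mult_right has_integral_exp_unit q)
      fix t :: real assume t: "t \<in> {0..1}"
      have tx: "t * x \<in> {0..L}" using t x by (auto intro: order_trans[OF mult_left_le_one_le])
      have pt: "of_real t * \<zeta> = of_real (t * x) * u" by (simp add: \<zeta>_def)
      have "norm (l - of_real t * \<zeta>) \<le> norm l + norm (of_real t * \<zeta>)" by (rule norm_triangle_ineq4)
      also have "norm (of_real t * \<zeta>) = t * x"
        unfolding pt using tx u(1) by (simp only: norm_mult norm_of_real) simp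
      also have "norm l + t * x \<le> 2 * L" using l tx by simp
      finally have arg: "norm (l - of_real t * \<zeta>) \<le> 2 * L" .
      have "norm ((1 - of_real t) * \<zeta>) = (1 - t) * x"
      proof -
        have "(1 - of_real t) * \<zeta> = of_real ((1 - t) * x) * u" by (simp add: \<zeta>_def)
        then show ?thesis using t x0 u(1) by (simp only: norm_mult norm_of_real) simp
      qed
      then have "norm (kern (l - of_real t * \<zeta>) ((1 - of_real t) * \<zeta>)) \<le> R * (exp y - 1) * exp (R * ((1 - t) * x))"
        using norm_kern_le[OF R arg, of "(1 - of_real t) * \<zeta>"] by (simp add: y_def)
      then have K: "norm (vkern 0 l \<zeta> (of_real t)) \<le> R * (exp y - 1) * exp (R * ((1 - t) * x))"
        by (simp add: vkern_def)
      have "norm (G l (of_real (t * x) * u)) \<le> N * weight_fun k L (t * x)" by (rule GN[OF tx])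
      also have "\<dots> \<le> N * (W * exp (- (2 * R * x * (1 - t))))"
        unfolding W_def R_def by (intro mult_left_mono weight_fun_concave xp t N0)
      finally have "norm (vkern 0 l \<zeta> (of_real t) * G l (of_real (t * x) * u))
          \<le> R * (exp y - 1) * exp (R * ((1 - t) * x)) * (N * (W * exp (- (2 * R * x * (1 - t)))))"
        unfolding norm_mult using K Rp y0 by (intro mult_mono) auto
      also have "\<dots> = b * (exp (R * ((1 - t) * x)) * exp (- (2 * R * x * (1 - t))))"
        by (simp add: b_def mult_ac)
      also have "\<dots> = b * exp (- q * (1 - t))"
        by (simp add: q_def algebra_simps flip: exp_add)
      finally show "norm (vkern 0 l \<zeta> (of_real t) * G l (0 + of_real t * (\<zeta> - 0))) \<le> b * exp (- q * (1 - t))"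
        by (simp add: pt)
    qed
    also have "\<dots> \<le> b * (1 / q)" using b0 q by (intro mult_left_mono divide_right_mono) auto
    finally have I: "norm (contour_integral (linepath 0 1) (\<lambda>t. vkern 0 l \<zeta> t * G l (0 + t * (\<zeta> - 0)))) \<le> b * (1 / q)" .
    have "norm (vop todd 0 l (G l) \<zeta>) \<le> (1 + k * x) / k * exp (- (k * x)) * (b * (1 / q))"
      unfolding vop_def norm_mult using T I k x0 by (intro mult_mono) auto
    also have "\<dots> \<le> (1 + k * x) / k * exp (- (k * x)) * ((k * x / 4 * exp (k * x / 4)) * (N * W / x))"
    proof (rule mult_left_mono)
      have "b * (1 / q) = (exp y - 1) * (N * W / x)"
        using Rp xp by (simp add: b_def q_def)
      also have "\<dots> \<le> (k * x / 4 * exp (k * x / 4)) * (N * W / x)"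
      proof (rule mult_right_mono)
        show "exp y - 1 \<le> k * x / 4 * exp (k * x / 4)"
          using ey yk by (meson exp_ge_zero mult_right_mono order_trans)
      qed (use N0 W xp in simp)
      finally show "b * (1 / q) \<le> (k * x / 4 * exp (k * x / 4)) * (N * W / x)" .
    qed (use k x0 in simp)
    also have "(1 + k * x) / k * exp (- (k * x)) * ((k * x / 4 * exp (k * x / 4)) * (N * W / x))
        = ((1 + k * x) * exp (- (k * x)) * exp (k * x / 4)) * (N * W / 4)"
      using k xp by (simp add: field_simps)
    also have "\<dots> \<le> 2 * (N * W / 4)" using E2 N0 W by (intro mult_right_mono) auto
    finally show ?thesis by simp
  qed
  have "G l \<zeta> = todd \<zeta> * M1 l \<zeta> + vop todd 0 l (G l) \<zeta>"
    unfolding \<zeta>_def by (rule eq[OF ray[OF x0]])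
  then have "norm (G l \<zeta>) \<le> 2 / k * Q * W + N * W / 2"
    using inh vop_le norm_triangle_ineq[of "todd \<zeta> * M1 l \<zeta>" "vop todd 0 l (G l) \<zeta>"] by simp
  moreover have "norm (G l \<zeta>) = N * W"
    using W by (simp add: N_def \<Phi>_def W_def \<zeta>_def)
  ultimately have "N * W \<le> (4 / k * Q) * W" by simp
  then have "N \<le> 4 / k * Q" using W by (rule mult_right_le_imp_le)
  then have "N * weight_fun k L s \<le> 4 / k * Q * weight_fun k L s"
    using Wpos[of s] by (intro mult_right_mono) auto
  then show ?thesis using GN[OF s] by linarith
qed

end

end

section \<open>The Borel transforms of the Fatou coordinates\<close>

text \<open>
  If the Taylor coefficients of \<open>K(l, \<cdot>)\<close> are polynomials in \<open>l\<close>, those of \<open>\<zeta> \<mapsto> K(\<zeta>, \<zeta>)\<close> are obtained by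
  collecting powers.  Cauchy's estimate, uniform for \<open>|l| \<le> 1\<close>, controls the remainder.
\<close>

lemma fps_expansion_diagonal:
  assumes K: "hol2 (UNIV \<times> D) K" and D: "open D" "0 \<in> D"
    and p: "\<And>l m. fps_expansion (K l) 0 $ m = poly (p m) l"
  shows "fps_expansion (\<lambda>\<zeta>. K \<zeta> \<zeta>) 0 $ N = (\<Sum>m\<le>N. coeff (p m) (N - m))"
proof -
  obtain r where r: "r > 0" "cball 0 r \<subseteq> D"
    using D open_contains_cball by blast
  have Kh: "K l holomorphic_on D" for l
    by (rule hol2D[OF K D(1), of "\<lambda>_. l" "\<lambda>z. z"]) (auto intro!: holomorphic_intros)
  have Fh: "(\<lambda>\<zeta>. K \<zeta> \<zeta>) holomorphic_on D"
    by (rule hol2D[OF K D(1), of "\<lambda>z. z" "\<lambda>z. z"]) (auto intro!: holomorphic_intros)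
  have Fexp: "(\<lambda>\<zeta>. K \<zeta> \<zeta>) has_fps_expansion fps_expansion (\<lambda>\<zeta>. K \<zeta> \<zeta>) 0"
    by (rule has_fps_expansion_fps_expansion[OF D Fh])
  have "bounded ((\<lambda>q. K (fst q) (snd q)) ` (cball 0 1 \<times> cball 0 r))"
    using r by (intro compact_imp_bounded compact_continuous_image compact_Times
        continuous_on_subset[OF hol2_continuous[OF K]]) auto
  then obtain B where "\<forall>x\<in>(\<lambda>q. K (fst q) (snd q)) ` (cball 0 1 \<times> cball 0 r). norm x \<le> B"
    unfolding bounded_iff by blast
  then have B: "norm (K l \<zeta>) \<le> B" if "norm l \<le> 1" "norm \<zeta> \<le> r" for l \<zeta>
    using that by force
  have B0: "B \<ge> 0" using B[of 0 0] r order_trans[OF norm_ge_zero] by auto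
  have pb: "norm (poly (p m) l) \<le> B / r ^ m" if "norm l \<le> 1" for m l
  proof -
    have "norm ((deriv ^^ m) (K l) 0) \<le> fact m * B / r ^ m"
    proof (rule Cauchy_inequality)
      show "K l holomorphic_on ball 0 r" "continuous_on (cball 0 r) (K l)"
        by (rule holomorphic_on_subset[OF Kh order.trans[OF ball_subset_cball r(2)]],
            rule continuous_on_subset[OF holomorphic_on_imp_continuous_on[OF Kh] r(2)])
    qed (use r B that in auto)
    then show ?thesis
      unfolding p[symmetric] by (simp add: fps_expansion_def norm_divide field_simps)
  qed
  define s where "s = min (r / 2) 1"
  have s: "s > 0" "s \<le> 1" "s \<le> r / 2" using r by (auto simp: s_def)
  let ?d = "\<lambda>\<zeta>. K \<zeta> \<zeta> - (\<Sum>m\<le>N. poly (p m) \<zeta> * \<zeta> ^ m)"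
  have small: "norm (?d \<zeta>) \<le> (2 * B / r ^ Suc N) * norm \<zeta> ^ Suc N" if \<zeta>: "norm \<zeta> < s" for \<zeta>
  proof -
    define x where "x = norm \<zeta> / r"
    have x: "0 \<le> x" "x \<le> 1 / 2" using r \<zeta> s by (auto simp: x_def field_simps)
    have sums: "(\<lambda>m. poly (p m) \<zeta> * \<zeta> ^ m) sums K \<zeta> \<zeta>"
    proof -
      have "K \<zeta> holomorphic_on eball 0 (ereal r)"
        using order.trans[OF ball_subset_cball r(2)] holomorphic_on_subset[OF Kh] by simp
      then show ?thesis
        using has_fps_expansion_imp_sums_complex[OF has_fps_expansion_fps_expansion[OF D Kh], of \<zeta> "ereal r" \<zeta>] \<zeta> s r
        by (simp add: p)
    qed
    have t: "norm (poly (p (m + Suc N)) \<zeta> * \<zeta> ^ (m + Suc N)) \<le> B * x ^ Suc N * (1 / 2) ^ m" for m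
    proof -
      have "norm (poly (p (m + Suc N)) \<zeta> * \<zeta> ^ (m + Suc N)) \<le> B / r ^ (m + Suc N) * norm \<zeta> ^ (m + Suc N)"
        unfolding norm_mult norm_power using \<zeta> s by (intro mult_right_mono pb) auto
      also have "\<dots> = B * x ^ Suc N * x ^ m"
        by (simp add: x_def power_divide power_add mult_ac)
      also have "\<dots> \<le> B * x ^ Suc N * (1 / 2) ^ m"
        using x B0 by (intro mult_left_mono power_mono) auto
      finally show ?thesis .
    qed
    have "?d \<zeta> = (\<Sum>m. poly (p (m + Suc N)) \<zeta> * \<zeta> ^ (m + Suc N))"
      using suminf_minus_initial_segment[OF sums_summable[OF sums], of "Suc N"] sums_unique[OF sums]
      by (simp only: lessThan_Suc_atMost)
    also have "norm \<dots> \<le> (\<Sum>m. B * x ^ Suc N * (1 / 2) ^ m)"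
      by (intro norm_suminf_le t summable_mult summable_geometric) simp
    also have "\<dots> = B * x ^ Suc N * 2"
      by (subst suminf_mult) (simp_all add: summable_geometric suminf_geometric)
    also have "\<dots> = (2 * B / r ^ Suc N) * norm \<zeta> ^ Suc N"
      by (simp add: x_def power_divide)
    finally show ?thesis .
  qed
  have Pexp: "(\<lambda>\<zeta>. poly (p m) \<zeta> * \<zeta> ^ m) has_fps_expansion (fps_of_poly (p m) * fps_X ^ m)" for m
  proof (rule has_fps_expansion_mult)
    have "eval_fps (fps_of_poly (p m)) has_fps_expansion fps_of_poly (p m)"
      by (rule eval_fps_has_fps_expansion) simp
    moreover have "eval_fps (fps_of_poly (p m)) = poly (p m)" by (rule ext) simp
    ultimately show "poly (p m) has_fps_expansion fps_of_poly (p m)" by (simp only:)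
    show "(\<lambda>\<zeta>. \<zeta> ^ m) has_fps_expansion fps_X ^ m" by (rule has_fps_expansion_fps_X_power)
  qed
  have "?d has_fps_expansion (fps_expansion (\<lambda>\<zeta>. K \<zeta> \<zeta>) 0 - (\<Sum>m\<le>N. fps_of_poly (p m) * fps_X ^ m))"
    by (intro has_fps_expansion_diff Fexp has_fps_expansion_sum Pexp)
  then have "(fps_expansion (\<lambda>\<zeta>. K \<zeta> \<zeta>) 0 - (\<Sum>m\<le>N. fps_of_poly (p m) * fps_X ^ m)) $ N = 0"
  proof (rule fps_nth_eq_0_if_small)
    show "\<forall>\<^sub>F \<zeta> in nhds 0. norm (?d \<zeta>) \<le> (2 * B / r ^ Suc N) * norm \<zeta> ^ Suc N"
    proof (rule eventually_mono[OF eventually_nhds_in_open[of "ball 0 s"]])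
      fix \<zeta> :: complex assume "\<zeta> \<in> ball 0 s"
      then show "norm (?d \<zeta>) \<le> (2 * B / r ^ Suc N) * norm \<zeta> ^ Suc N" by (intro small) simp
    qed (use s in auto)
  qed simp
  then show ?thesis
    by (simp add: fps_sum_nth fps_X_power_mult_right_nth)
qed

lemma mem_sector_0:
  assumes \<theta>: "0 < \<theta>\<^sub>0" "\<theta>\<^sub>0 < pi / 2" and \<zeta>: "\<zeta> \<in> sector \<theta>\<^sub>0 0"
  obtains r u where "r > 0" "\<zeta> = of_real r * u" "norm u = 1" "cos \<theta>\<^sub>0 \<le> Re u"
proof -
  obtain r \<alpha> where r: "\<zeta> = of_real r * cis \<alpha>" "r > 0" "- \<theta>\<^sub>0 \<le> \<alpha>" "\<alpha> \<le> \<theta>\<^sub>0"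
    using \<zeta> by (auto simp: sector_def)
  have "cos \<theta>\<^sub>0 \<le> cos \<bar>\<alpha>\<bar>"
    using r \<theta> by (intro cos_monotone_0_pi_le) auto
  then show ?thesis using that[of r "cis \<alpha>"] r by simp
qed

context parabolic begin

text \<open>
  The Borel transform of \<open>a\<close> divided by \<open>\<zeta>\<close>, which corresponds to \<open>kern1\<close> in the equation for \<open>\<psi>\<close>.
\<close>

definition borel1 :: "complex \<Rightarrow> complex" where
  "borel1 \<zeta> = eval_fps (fps_shift 1 (formal_borel a)) \<zeta>"

lemma norm_borel1_coeff_le:
  "norm (fps_shift 1 (formal_borel a) $ m * \<zeta> ^ m) \<le> C * ((R0 * norm \<zeta>) ^ m / fact (Suc m))"
proof -
  have "norm (a $ (m + 2)) \<le> R0 ^ m * C"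
    using norm_power_nth_le[of R0 1 "m + 2"] R0 by (simp add: power_add power2_eq_square)
  then have "norm (a $ (m + 2)) / fact (Suc m) * norm \<zeta> ^ m \<le> R0 ^ m * C / fact (Suc m) * norm \<zeta> ^ m"
    by (intro mult_right_mono divide_right_mono) auto
  then show ?thesis
    by (simp add: formal_borel_nth norm_mult norm_divide norm_power power_mult_distrib mult_ac del: fact_Suc)
qed

lemma borel1_conv_radius: "fps_conv_radius (fps_shift 1 (formal_borel a)) = \<infinity>"
  unfolding fps_conv_radius_def
proof (rule conv_radius_inftyI'')
  fix z :: complex
  show "summable (\<lambda>n. fps_shift 1 (formal_borel a) $ n * z ^ n)"
    by (rule summable_comparison_test'[OF summable_mult[OF shifted_exp_series_le(1)] norm_borel1_coeff_le])
      (use R0 in auto)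
qed

lemma norm_borel1_le: "norm (borel1 \<zeta>) \<le> C * exp (R0 * norm \<zeta>)"
proof -
  have t: "R0 * norm \<zeta> \<ge> 0" using R0 by simp
  have "norm (borel1 \<zeta>) \<le> (\<Sum>m. C * ((R0 * norm \<zeta>) ^ m / fact (Suc m)))"
    unfolding borel1_def eval_fps_def
    by (rule norm_suminf_le[OF norm_borel1_coeff_le summable_mult[OF shifted_exp_series_le(1)[OF t]]])
  also have "\<dots> = C * (\<Sum>m. (R0 * norm \<zeta>) ^ m / fact (Suc m))"
    by (rule suminf_mult[OF shifted_exp_series_le(1)[OF t]])
  also have "\<dots> \<le> C * exp (R0 * norm \<zeta>)"
    by (rule mult_left_mono[OF shifted_exp_series_le(2)[OF t] C])
  finally show ?thesis .
qed

lemma hol2_borel1: "hol2 UNIV (\<lambda>l. borel1)"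
proof -
  have "borel1 holomorphic_on UNIV"
    unfolding borel1_def using borel1_conv_radius by (intro holomorphic_on_eval_fps) auto
  from hol2_snd[OF this, of UNIV] show ?thesis by simp
qed

lemma borel1_has_fps_expansion: "(\<lambda>\<zeta>. \<zeta> * borel1 \<zeta>) has_fps_expansion formal_borel a"
proof -
  have "borel1 has_fps_expansion fps_shift 1 (formal_borel a)"
    unfolding borel1_def by (rule eval_fps_has_fps_expansion) (use borel1_conv_radius in simp)
  then have "(\<lambda>\<zeta>. \<zeta> * borel1 \<zeta>) has_fps_expansion (fps_X * fps_shift 1 (formal_borel a))"
    by (intro has_fps_expansion_mult has_fps_expansion_fps_X)
  also have "fps_X * fps_shift 1 (formal_borel a) = formal_borel a"
  proof (rule fps_ext)
    fix n
    show "(fps_X * fps_shift 1 (formal_borel a)) $ n = formal_borel a $ n"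
      using a1 by (cases n) (simp_all add: formal_borel_nth)
  qed
  finally show ?thesis .
qed

lemma norm_kern1_ray_le:
  assumes k: "0 < k" "k \<le> 1" and u: "norm u = 1" and l: "norm l \<le> L" and s: "s \<in> {0..L}"
  shows "norm (kern1 l (of_real s * u)) \<le> 2 * C * L * exp (k * s / 4) * weight_fun k L s"
proof (cases "s = 0")
  case True
  have L: "L \<ge> 0" using l order_trans[OF norm_ge_zero] by blast
  have "kern1 l 0 = kappa l 1"
    unfolding kern1_def using powser_zero[of "\<lambda>m. kappa l (Suc m) / fact (Suc m)"] by simp
  also have "\<dots> = l * a $ 2 + l\<^sup>2 / 2 * (a * a) $ 2"
    by (simp add: kappa_altdef numeral_2_eq_2 power2_eq_square)
  also have "(a * a) $ 2 = 0"
    using a0 a1 by (simp add: fps_mult_nth numeral_2_eq_2)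
  finally have "norm (kern1 l 0) = norm l * norm (a $ 2)" by (simp add: norm_mult)
  also have "norm (a $ 2) \<le> C" using norm_power_nth_le[of R0 1 2] R0 by simp
  also have "norm l * C \<le> L * C" using l C by (intro mult_right_mono) auto
  also have "\<dots> \<le> 2 * C * L" using mult_nonneg_nonneg[OF C L] by (simp add: mult_ac)
  finally have "norm (kern1 l 0) \<le> 2 * C * L"
    by (simp add: mult_left_mono)
  then show ?thesis using True by (simp add: weight_fun_def)
next
  case False
  then have s: "s > 0" "s \<le> L" using s by auto
  then have L: "L \<ge> 0" by simp
  define R where "R = rate k L s"
  have R: "R \<ge> R0" using rate_ge[OF k L s(1)] by (simp add: R_def)
  have Rp: "R > 0" using R R0 by simp
  have "norm l \<le> 2 * L" using l L by simp
  then have "norm (kern1 l (of_real s * u)) \<le> R\<^sup>2 * (exp (C * (2 * L) / R\<^sup>2) - 1) * exp (R * norm (of_real s * u))"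
    by (rule norm_kern1_le[OF R])
  also have "norm (of_real s * u) = s" using s u by (simp add: norm_mult)
  also have "R\<^sup>2 * (exp (C * (2 * L) / R\<^sup>2) - 1) * exp (R * s) \<le> R\<^sup>2 * (C * (2 * L) / R\<^sup>2 * exp (k * s / 4)) * weight_fun k L s"
  proof (intro mult_mono mult_left_mono)
    show "exp (C * (2 * L) / R\<^sup>2) - 1 \<le> C * (2 * L) / R\<^sup>2 * exp (k * s / 4)"
      unfolding R_def by (rule rate_exp_le[OF k L s(1)])
    show "exp (R * s) \<le> weight_fun k L s"
      unfolding R_def by (rule rate_le_weight[OF k L s(1)])
  qed (use C L in auto)
  also have "R\<^sup>2 * (C * (2 * L) / R\<^sup>2 * exp (k * s / 4)) = 2 * C * L * exp (k * s / 4)"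
    using Rp by simp
  finally show ?thesis .
qed

text \<open>
  \<open>H 0\<close> is the Borel transform of \<open>\<psi>\<^sub>1\<close>, and \<open>G l\<close> that of \<open>exp (l \<psi>\<^sub>1) - 1\<close>.  The factor \<open>e\<^sup>\<zeta>\<close> undoes
  the shift from \<open>\<psi>\<close> to \<open>\<psi>\<^sub>1\<close>.
\<close>

theorem borel_transforms_right_sector:
  assumes \<psi>0: "\<psi> $ 0 = 0" and Abel: "\<psi> \<odot> (1 + a) = 1 + \<psi>" and inv: "\<phi> \<odot> \<psi> = 0"
  obtains g h where "g holomorphic_on cut_plane" "h holomorphic_on cut_plane"
    "fps_expansion g 0 = formal_borel \<phi>" "fps_expansion h 0 = formal_borel \<psi>"
    "extends_to_R (formal_borel \<phi>)" "extends_to_R (formal_borel \<psi>)"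
    "\<And>\<theta>\<^sub>0. 0 < \<theta>\<^sub>0 \<Longrightarrow> \<theta>\<^sub>0 < pi / 2 \<Longrightarrow>
       \<exists>\<tau>>0. exp_type_le g \<tau> (sector \<theta>\<^sub>0 0) \<and> exp_type_le h \<tau> (sector \<theta>\<^sub>0 0)"
proof -
  \<comment> \<open>Shifting by \<open>1\<close> lets the equation be written with \<open>a\<close> itself instead of \<open>a(z - 1)\<close>.\<close>
  define \<psi>1 where "\<psi>1 = fsubst \<psi> 1"
  have \<psi>1: "\<psi>1 $ 0 = 0" by (simp add: \<psi>1_def \<psi>0)
  have unshift: "fsubst \<psi>1 (- 1) = \<psi>"
    by (simp add: \<psi>1_def fsubst_fsubst)
  have "fsubst \<psi>1 a = fsubst \<psi> (1 + a)"
    by (simp add: \<psi>1_def fsubst_fsubst add.commute)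
  then have eq1: "fsubst \<psi>1 (- 1) = a + fsubst \<psi>1 a"
    using Abel by (simp add: unshift fcomp_def)
  obtain G where G: "state cut_plane 0 (\<lambda>l \<zeta>. \<zeta> * kern1 l \<zeta>) G"
    "\<And>l \<zeta>. \<zeta> \<in> cut_plane \<Longrightarrow> G l \<zeta> = todd \<zeta> * kern1 l \<zeta> + vop todd 0 l (G l) \<zeta>"
    by (rule state_cut_plane[OF hol2_kern1]) (rule that)
  obtain H where H: "state cut_plane 0 (\<lambda>l \<zeta>. \<zeta> * borel1 \<zeta>) H"
    "\<And>l \<zeta>. \<zeta> \<in> cut_plane \<Longrightarrow> H l \<zeta> = todd \<zeta> * borel1 \<zeta> + vop todd 0 l (H l) \<zeta>"
    by (rule state_cut_plane[OF hol2_borel1]) (rule that)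
  have hG: "hol2 (UNIV \<times> cut_plane) G" and hH: "hol2 (UNIV \<times> cut_plane) H"
    using G(1) H(1) unfolding state_def by blast+
  have Gh: "G l holomorphic_on cut_plane" and Hh: "H l holomorphic_on cut_plane" for l
    using hol2D[OF hG open_cut_plane, of "\<lambda>_. l" "\<lambda>z. z"] hol2D[OF hH open_cut_plane, of "\<lambda>_. l" "\<lambda>z. z"]
    by (auto intro!: holomorphic_intros)
  have Hexp: "fps_expansion (H 0) 0 = formal_borel \<psi>1"
  proof (rule state_fps_expansion[OF H(1)])
    show "(\<lambda>\<zeta>. \<zeta> * borel1 \<zeta>) has_fps_expansion formal_borel a" by (rule borel1_has_fps_expansion)
    show "fsubst \<psi>1 (- 1) = a + (fps_exp 0 oo a) * fsubst \<psi>1 a" using eq1 by simp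
  qed (use a0 \<psi>1 in auto)
  have Gexp: "fps_expansion (G l) 0 = formal_borel ((fps_exp l oo \<psi>1) - 1)" for l
  proof (rule state_fps_expansion[OF G(1)])
    show "(\<lambda>\<zeta>. \<zeta> * kern1 l \<zeta>) has_fps_expansion formal_borel ((fps_exp l oo a) - 1)"
      using kern_has_fps_expansion[of l] unfolding kern_def [abs_def] .
    have "fsubst (fps_exp l oo \<psi>1) (- 1) = (fps_exp l oo a) * fsubst (fps_exp l oo \<psi>1) a"
      by (rule exp_satisfies_difference_equation[OF \<psi>1 a0 eq1])
    then show "fsubst ((fps_exp l oo \<psi>1) - 1) (- 1)
        = (fps_exp l oo a) - 1 + (fps_exp l oo a) * fsubst ((fps_exp l oo \<psi>1) - 1) a"
      by (simp add: fsubst_diff algebra_simps)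
  qed auto
  have exp_mult: "fps_expansion (\<lambda>\<zeta>. exp \<zeta> * f \<zeta>) 0 = formal_borel (fsubst F (- 1))"
    if "f holomorphic_on cut_plane" "fps_expansion f 0 = formal_borel F" for f F
  proof -
    have "(\<lambda>\<zeta>. exp \<zeta> * f \<zeta>) has_fps_expansion (fps_exp 1 * fps_expansion f 0)"
      by (intro has_fps_expansion_mult has_fps_expansion_exp1
          has_fps_expansion_fps_expansion[OF open_cut_plane zero_in_cut_plane that(1)])
    moreover have "fps_const (- 1) = (- 1 :: complex fps)" by (simp flip: fps_const_neg)
    ultimately show ?thesis
      using formal_borel_fsubst_const[of F "- 1"] that(2) by (metis fps_expansion_eqI minus_minus)
  qed
  define h where "h = (\<lambda>\<zeta>. exp \<zeta> * H 0 \<zeta>)"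
  have h_hol: "h holomorphic_on cut_plane"
    unfolding h_def by (intro holomorphic_intros Hh)
  have h_exp: "fps_expansion h 0 = formal_borel \<psi>"
    unfolding h_def using exp_mult[OF Hh Hexp] unshift by simp
  define K where "K = (\<lambda>l \<zeta>. exp \<zeta> * G l \<zeta>)"
  have hK: "hol2 (UNIV \<times> cut_plane) K"
    unfolding K_def by (intro hol2_mult hG hol2_snd[where D = UNIV]) (auto intro: holomorphic_intros)
  define c where "c = (\<lambda>m j. (\<psi> ^ j) $ Suc m / (fact j * fact m))"
  define p where "p = (\<lambda>m. \<Sum>j\<le>Suc m. monom (c m j) j)"
  have "fps_expansion (K l) 0 $ m = poly (p m) l" for l m
  proof -
    have "fps_expansion (K l) 0 = formal_borel (fsubst ((fps_exp l oo \<psi>1) - 1) (- 1))"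
      unfolding K_def by (rule exp_mult[OF Gh Gexp])
    also have "fsubst ((fps_exp l oo \<psi>1) - 1) (- 1) = (fps_exp l oo \<psi>) - 1"
      using \<psi>1 unshift by (simp add: fsubst_diff fsubst_compose)
    finally have "fps_expansion (K l) 0 $ m = (fps_exp l oo \<psi>) $ Suc m / fact m"
      by (simp add: formal_borel_nth)
    also have "\<dots> = (\<Sum>j\<le>Suc m. c m j * l ^ j)"
      unfolding fps_compose_nth atLeast0AtMost sum_divide_distrib
      by (rule sum.cong) (auto simp: c_def field_simps)
    also have "\<dots> = poly (p m) l"
      by (simp add: p_def poly_sum poly_monom del: sum.atMost_Suc)
    finally show ?thesis .
  qed
  from fps_expansion_diagonal[OF hK open_cut_plane zero_in_cut_plane this]
  have "fps_expansion (\<lambda>\<zeta>. K \<zeta> \<zeta>) 0 $ N = (\<Sum>m\<le>N. (\<psi> ^ (N - m)) $ Suc m / (fact (N - m) * fact m))" for N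
  proof -
    have "coeff (p m) n = c m n" for m n
    proof (cases "n \<le> Suc m")
      case False
      then have "c m n = 0"
        using startsby_zero_power_prefix[OF \<psi>0, rule_format, of "Suc m" n] by (simp add: c_def)
      then show ?thesis using False by (simp add: p_def coeff_sum del: sum.atMost_Suc)
    qed (simp add: p_def coeff_sum del: sum.atMost_Suc)
    then show ?thesis
      using \<open>\<And>N. fps_expansion (\<lambda>\<zeta>. K \<zeta> \<zeta>) 0 $ N = (\<Sum>m\<le>N. coeff (p m) (N - m))\<close> by (simp add: c_def)
  qed
  moreover have "fsubst \<phi> \<psi> = - \<psi>"
    using inv by (simp add: fcomp_def eq_neg_iff_add_eq_0 add.commute)
  ultimately have diag: "fps_expansion (\<lambda>\<zeta>. K \<zeta> \<zeta>) 0 = - (fps_X * formal_borel \<phi>)"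
    by (simp add: lagrange_inversion_borel fps_eq_iff)
  define F where "F = (\<lambda>\<zeta>. K \<zeta> \<zeta>)"
  have Fh: "F holomorphic_on cut_plane"
    unfolding F_def by (rule hol2D[OF hK open_cut_plane]) (auto intro!: holomorphic_intros)
  have Fexp: "F has_fps_expansion - (fps_X * formal_borel \<phi>)"
    using has_fps_expansion_fps_expansion[OF open_cut_plane zero_in_cut_plane Fh] diag by (simp add: F_def)
  then have F0: "F 0 = 0"
    using has_fps_expansion_imp_0_eq_fps_nth_0[OF Fexp] by simp
  define g where "g = (\<lambda>z. - (if z = 0 then deriv F 0 else (F z - F 0) / (z - 0)))"
  have g_hol: "g holomorphic_on cut_plane"
    unfolding g_def by (intro holomorphic_on_minus pole_lemma_open Fh open_cut_plane)
  have g_eq: "g z = - F z / z" if "z \<noteq> 0" for z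
    using that F0 by (simp add: g_def)
  have g_exp: "fps_expansion g 0 = formal_borel \<phi>"
  proof -
    have "(\<lambda>z. z * g z) has_fps_expansion fps_X * fps_expansion g 0"
      by (intro has_fps_expansion_mult has_fps_expansion_fps_X
          has_fps_expansion_fps_expansion[OF open_cut_plane zero_in_cut_plane g_hol])
    moreover have "(\<lambda>z. z * g z) = (\<lambda>z. - F z)"
    proof
      show "z * g z = - F z" for z by (cases "z = 0") (simp_all add: g_eq F0)
    qed
    moreover have "(\<lambda>z. - F z) has_fps_expansion fps_X * formal_borel \<phi>"
      using has_fps_expansion_minus[OF Fexp] by simp
    ultimately have "fps_X * fps_expansion g 0 = fps_X * formal_borel \<phi>"
      using fps_expansion_unique_complex by metis
    then show ?thesis by simp
  qed
  have "extends_to_R (fps_expansion h 0)"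
    by (rule extends_to_R_of_state[OF H(1), where l = "\<lambda>_. 0" and w = exp])
      (auto intro!: holomorphic_intros Hh simp: h_def)
  moreover have "extends_to_R (fps_expansion g 0)"
    by (rule extends_to_R_of_state[OF G(1), where l = "\<lambda>z. z" and w = "\<lambda>z. - exp z / z"])
      (auto intro!: holomorphic_intros g_hol simp: g_eq F_def K_def)
  moreover have "\<exists>\<tau>>0. exp_type_le g \<tau> (sector \<theta>\<^sub>0 0) \<and> exp_type_le h \<tau> (sector \<theta>\<^sub>0 0)"
    if \<theta>: "0 < \<theta>\<^sub>0" "\<theta>\<^sub>0 < pi / 2" for \<theta>\<^sub>0
  proof -
    define k where "k = cos \<theta>\<^sub>0"
    have k: "0 < k" "k \<le> 1" using \<theta> by (auto simp: k_def cos_gt_zero)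
    define \<mu> where "\<mu> = 2 * R0 + 4 * sqrt (8 * C / k)"
    have W: "weight_fun k r r = exp (\<mu> * r)" if "r > 0" for r
    proof -
      have "sqrt (8 * C / k * r * r) = sqrt (8 * C / k) * r"
        using that by (simp only: mult.assoc real_sqrt_mult[of "8 * C / k"]) simp
      then show ?thesis by (simp add: weight_fun_def \<mu>_def algebra_simps)
    qed
    have \<mu>: "\<mu> > 0" using R0 C k by (simp add: \<mu>_def add_pos_nonneg)
    have e: "norm (exp (of_real r * u)) \<le> exp r" if "r > 0" "norm u = 1" for r and u :: complex
      using that complex_Re_le_cmod[of u] mult_left_mono[of "Re u" 1 r] by simp
    have Gc: "continuous_on cut_plane (G l)" "continuous_on cut_plane (H l)" for l
      by (intro holomorphic_on_imp_continuous_on Gh Hh)+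
    have "norm (h \<zeta>) \<le> (4 / k * C) * exp ((1 + \<mu>) * norm \<zeta>)" if sec: "\<zeta> \<in> sector \<theta>\<^sub>0 0" for \<zeta>
    proof -
      obtain r u where r: "r > 0" "\<zeta> = of_real r * u" "norm u = 1" "cos \<theta>\<^sub>0 \<le> Re u"
        by (rule mem_sector_0[OF \<theta> sec]) (rule that)
      note r = r[folded k_def]
      have nz: "norm \<zeta> = r" using r by (simp add: norm_mult)
      have "norm (H 0 (of_real r * u)) \<le> 4 / k * C * weight_fun k r r"
      proof (rule volterra_growth[OF k _ r(3,4) _ Gc(2) H(2)])
        fix s assume s: "s \<in> {0..r}"
        have "norm (borel1 (of_real s * u)) \<le> C * exp (R0 * s)"
          using norm_borel1_le[of "of_real s * u"] s r(3) by (simp add: norm_mult)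
        also have "\<dots> \<le> C * (exp (k * s / 4) * weight_fun k r s)"
        proof (intro mult_left_mono C)
          have "8 * C / k * r * s \<ge> 0" using C k r s by simp
          then have "exp (R0 * s) \<le> weight_fun k r s" using R0 s by (simp add: weight_fun_def)
          also have "\<dots> \<le> exp (k * s / 4) * weight_fun k r s"
          proof -
            have "1 \<le> exp (k * s / 4)" using k s by simp
            from mult_right_mono[OF this, of "weight_fun k r s"] show ?thesis by (simp add: weight_fun_def)
          qed
          finally show "exp (R0 * s) \<le> exp (k * s / 4) * weight_fun k r s" .
        qed
        finally show "norm (borel1 (of_real s * u)) \<le> C * exp (k * s / 4) * weight_fun k r s" by (simp add: mult.assoc)
      qed (use r in auto)
      then have "norm (h \<zeta>) \<le> exp r * (4 / k * C * exp (\<mu> * r))"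
        unfolding h_def norm_mult r(2) W[OF r(1)] using e[OF r(1,3)] by (intro mult_mono) auto
      also have "\<dots> = (4 / k * C) * exp ((1 + \<mu>) * norm \<zeta>)"
        unfolding nz distrib_right exp_add by simp
      finally show ?thesis .
    qed
    then have "exp_type_le h (1 + \<mu>) (sector \<theta>\<^sub>0 0)" unfolding exp_type_le_def by blast
    moreover have "norm (g \<zeta>) \<le> (4 / k * (2 * C)) * exp ((1 + \<mu>) * norm \<zeta>)" if sec: "\<zeta> \<in> sector \<theta>\<^sub>0 0" for \<zeta>
    proof -
      obtain r u where r: "r > 0" "\<zeta> = of_real r * u" "norm u = 1" "cos \<theta>\<^sub>0 \<le> Re u"
        by (rule mem_sector_0[OF \<theta> sec]) (rule that)
      note r = r[folded k_def]
      have nz: "norm \<zeta> = r" using r by (simp add: norm_mult)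
      have "norm (G \<zeta> (of_real r * u)) \<le> 4 / k * (2 * C * r) * weight_fun k r r"
      proof (rule volterra_growth[OF k _ r(3,4) _ Gc(1) G(2)])
        fix s assume "s \<in> {0..r}"
        then show "norm (kern1 \<zeta> (of_real s * u)) \<le> 2 * C * r * exp (k * s / 4) * weight_fun k r s"
          by (intro norm_kern1_ray_le k r) (use nz in auto)
      qed (use r nz in auto)
      then have "norm (F \<zeta>) \<le> exp r * (4 / k * (2 * C * r) * exp (\<mu> * r))"
        unfolding F_def K_def norm_mult W[OF r(1), symmetric] using e[OF r(1,3)] r(2) by (intro mult_mono) auto
      then have "norm (F \<zeta>) / r \<le> exp r * (4 / k * (2 * C * r) * exp (\<mu> * r)) / r"
        using r(1) by (intro divide_right_mono) auto
      also have "\<dots> = (4 / k * (2 * C)) * exp ((1 + \<mu>) * norm \<zeta>)"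
        unfolding nz distrib_right exp_add using r(1) by simp
      also have "norm (F \<zeta>) / r = norm (g \<zeta>)"
      proof -
        have "\<zeta> \<noteq> 0" using nz r(1) by auto
        then show ?thesis by (simp add: g_eq norm_divide nz)
      qed
      finally show ?thesis .
    qed
    then have "exp_type_le g (1 + \<mu>) (sector \<theta>\<^sub>0 0)" unfolding exp_type_le_def by blast
    ultimately show ?thesis using \<mu> by (intro exI[of _ "1 + \<mu>"]) simp
  qed
  ultimately show ?thesis
    using that g_hol h_hol g_exp h_exp by metis
qed

end

section \<open>Reflection and the left half-plane\<close>

text \<open>
  The formal transformation \<open>z + c(z)\<close> conjugated by \<open>z \<mapsto> - z\<close>.
\<close>

definition reflect :: "complex fps \<Rightarrow> complex fps" where
  "reflect F = - (F oo - fps_X)"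

lemma reflect_nth: "reflect F $ n = - ((- 1) ^ n * F $ n)"
  by (simp add: reflect_def fps_compose_uminus')

lemma reflect_add: "reflect (F + G) = reflect F + reflect G"
  by (simp add: reflect_def fps_compose_add_distrib)

lemma fsubst_reflect: "fsubst (reflect F) (reflect c) = reflect (fsubst F c)"
proof -
  let ?n = "- fps_X :: complex fps"
  have n: "?n oo inv_translate (reflect c) = inv_translate c oo ?n"
  proof -
    have "?n oo inv_translate (reflect c) = - inv_translate (reflect c)"
      by (simp add: fps_compose_uminus)
    also have "\<dots> = ?n * inverse (1 + ?n * (c oo ?n))"
      by (simp add: inv_translate_def reflect_def)
    also have "\<dots> = inv_translate c oo ?n"
      by (simp add: inv_translate_def fps_compose_mult_distrib fps_inverse_compose fps_compose_add_distrib)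
    finally show ?thesis .
  qed
  have "fsubst (reflect F) (reflect c) = - ((F oo ?n) oo inv_translate (reflect c))"
    by (simp add: fsubst_conv_compose reflect_def fps_compose_uminus)
  also have "(F oo ?n) oo inv_translate (reflect c) = F oo (?n oo inv_translate (reflect c))"
    by (rule fps_compose_assoc[symmetric]) simp_all
  also have "\<dots> = fsubst F c oo ?n"
    unfolding n fsubst_conv_compose by (rule fps_compose_assoc) simp_all
  finally show ?thesis by (simp add: reflect_def)
qed

lemma fps_conv_radius_reflect: "fps_conv_radius (reflect F) = fps_conv_radius F"
proof -
  have "Abs_fps (\<lambda>n. norm (reflect F $ n)) = Abs_fps (\<lambda>n. norm (F $ n))"
    by (simp add: reflect_nth norm_mult norm_power)
  then show ?thesis
    using fps_conv_radius_norm[of F] fps_conv_radius_norm[of "reflect F"] by metis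
qed

lemma formal_borel_reflect: "formal_borel (reflect F) = formal_borel F oo - fps_X"
  by (rule fps_ext) (simp add: formal_borel_nth reflect_nth fps_compose_uminus')

lemma inv_translate_eq_X: "inv_translate c = fps_X \<Longrightarrow> c = 0"
proof -
  assume "inv_translate c = fps_X"
  then have "fps_X * inverse (1 + fps_X * c) = fps_X * 1" by (simp add: inv_translate_def)
  then have "inverse (1 + fps_X * c) = 1" by (simp only: mult_left_cancel[OF fps_X_neq_zero])
  then have "inverse (inverse (1 + fps_X * c)) = 1" by simp
  then have "1 + fps_X * c = 1" by (subst (asm) fps_inverse_idempotent) simp_all
  then show "c = 0" by simp
qed

text \<open>
  The Taylor series of the holomorphic local inverse is the formal inverse.
\<close>

lemma fps_conv_radius_inv_pos:
  fixes F :: "complex fps"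
  assumes F: "fps_conv_radius F > 0" and F0: "F $ 0 = 0" and F1: "F $ 1 \<noteq> 0"
  shows "fps_conv_radius (fps_inv F) > 0"
proof -
  have e: "eval_fps F has_fps_expansion F" by (rule eval_fps_has_fps_expansion[OF F])
  obtain S where S: "open S" "0 \<in> S" "eval_fps F holomorphic_on S"
    using has_fps_expansion_imp_holomorphic[OF e] by metis
  have "deriv (eval_fps F) 0 \<noteq> 0"
    using fps_nth_fps_expansion[OF e, of 1] F1 by simp
  then obtain r where r: "r > 0" "ball 0 r \<subseteq> S" "inj_on (eval_fps F) (ball 0 r)"
    using has_complex_derivative_locally_injective[OF S(3,2,1)] by blast
  have hol: "eval_fps F holomorphic_on ball 0 r" using S(3) r(2) by (rule holomorphic_on_subset)
  obtain g where g: "g holomorphic_on (eval_fps F ` ball 0 r)" "\<And>z. z \<in> ball 0 r \<Longrightarrow> g (eval_fps F z) = z"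
    using holomorphic_has_inverse[OF hol open_ball r(3)] by metis
  have "open (eval_fps F ` ball 0 r)"
    by (rule open_mapping_thm3[OF hol open_ball r(3)])
  moreover have "0 \<in> eval_fps F ` ball 0 r"
    using r(1) F0 by (intro image_eqI[where x = 0]) (simp_all add: eval_fps_at_0)
  ultimately have G: "g has_fps_expansion fps_expansion g 0"
    using g(1) by (rule has_fps_expansion_fps_expansion)
  have "(g \<circ> eval_fps F) has_fps_expansion (fps_expansion g 0 oo F)"
    by (rule has_fps_expansion_compose[OF G e F0])
  note A = this
  have B: "\<forall>\<^sub>F z in nhds 0. (g \<circ> eval_fps F) z = z"
    by (rule eventually_mono[OF eventually_nhds_in_open[of "ball 0 r"]]) (use r g(2) in auto)
  have "(\<lambda>z. z) has_fps_expansion (fps_expansion g 0 oo F)"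
    by (rule iffD1[OF has_fps_expansion_cong[OF B refl] A])
  then have "fps_expansion g 0 oo F = fps_X"
    by (rule fps_expansion_unique_complex[OF _ has_fps_expansion_fps_X])
  then have "(fps_expansion g 0 oo F) oo fps_inv F = fps_X oo fps_inv F" by simp
  moreover have "(fps_expansion g 0 oo F) oo fps_inv F = fps_expansion g 0 oo (F oo fps_inv F)"
    using F0 by (intro fps_compose_assoc[symmetric]) (simp_all add: fps_inv_def)
  moreover have "fps_X oo fps_inv F = fps_inv F"
    by (rule fps_X_fps_compose_startby0) (simp add: fps_inv_def)
  ultimately have "fps_expansion g 0 = fps_inv F"
    using fps_inv_right[OF F0 F1] by simp
  then show ?thesis using G by (simp add: has_fps_expansion_def)
qed

lemma convergent_inverse_transformation:
  assumes conv: "fps_conv_radius c > 0"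
  obtains d where "fps_conv_radius d > 0" "d + fsubst c d = 0"
proof -
  define F where "F = inv_translate c"
  have F0: "F $ 0 = 0" by (simp add: F_def)
  have F1: "F $ 1 = 1" by (simp add: F_def inv_translate_def)
  have "fps_conv_radius (1 + fps_X * c) > 0"
  proof -
    have "fps_conv_radius (fps_X * c) > 0"
      using fps_conv_radius_mult[of fps_X c] conv by (auto intro: less_le_trans)
    then show ?thesis using fps_conv_radius_add[of 1 "fps_X * c"] by (auto intro: less_le_trans)
  qed
  then have "fps_conv_radius (inverse (1 + fps_X * c)) > 0"
    by (intro fps_conv_radius_inverse_pos) simp_all
  then have "fps_conv_radius F > 0"
    using fps_conv_radius_mult[of fps_X "inverse (1 + fps_X * c)"]
    by (auto simp: F_def inv_translate_def intro: less_le_trans)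
  then have I: "fps_conv_radius (fps_inv F) > 0"
    by (rule fps_conv_radius_inv_pos) (use F0 F1 in simp_all)
  define q where "q = fps_shift 1 (fps_inv F)"
  have Fi0: "fps_inv F $ 0 = 0" by (simp add: fps_inv_def)
  have q: "fps_inv F = fps_X * q"
  proof (rule fps_ext)
    fix n show "fps_inv F $ n = (fps_X * q) $ n" using Fi0 by (cases n) (simp_all add: q_def)
  qed
  have q0: "q $ 0 = 1" using F1 by (simp add: q_def fps_inv_def)
  define d where "d = fps_shift 1 (inverse q)"
  have "1 + fps_X * d = inverse q"
  proof (rule fps_ext)
    fix n show "(1 + fps_X * d) $ n = inverse q $ n" using q0 by (cases n) (simp_all add: d_def)
  qed
  then have "inv_translate d = fps_inv F"
    using q q0 by (simp add: inv_translate_def)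
  then have "inv_translate (d + fsubst c d) = F oo fps_inv F"
    by (simp add: F_def inv_translate_compose[symmetric])
  also have "\<dots> = fps_X" by (rule fps_inv_right) (use F0 F1 in simp_all)
  finally have "d + fsubst c d = 0" by (rule inv_translate_eq_X)
  moreover have "fps_conv_radius d > 0"
    using I q0 fps_conv_radius_inverse_pos[of q] by (simp add: d_def q_def)
  ultimately show ?thesis using that by blast
qed

text \<open>
  Solvability of Abel's equation by a series without constant term forces \<open>a\<close> to start at \<open>z\<^sup>-\<^sup>2\<close>: for
  the reflected germ this saves computing its coefficients.
\<close>

lemma Abel_order:
  assumes "\<psi> $ 0 = 0" "\<psi> \<odot> (1 + a) = 1 + \<psi>"
  shows "a $ 0 = 0" "a $ 1 = 0"
proof -
  have eq: "a + fsubst \<psi> (1 + a) = \<psi>" using assms(2) by (simp add: fcomp_def)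
  show "a $ 0 = 0" using arg_cong[OF eq, of "\<lambda>F. F $ 0"] assms(1) by simp
  have "fsubst \<psi> (1 + a) $ 1 = \<psi> $ 1" using fsubst_nth_leading[of 0 \<psi> "1 + a"] by simp
  then show "a $ 1 = 0" using arg_cong[OF eq, of "\<lambda>F. F $ 1"] by simp
qed

text \<open>
  If \<open>Id + d\<close> is the inverse of \<open>f\<close>, Abel's equation composed with it reads \<open>v(z + d(z)) = v(z) - 1\<close>, and
  conjugation by \<open>z \<mapsto> - z\<close> changes the sign of the constant.
\<close>

lemma reflected_data:
  assumes conv: "fps_conv_radius a > 0" and \<psi>0: "\<psi> $ 0 = 0"
    and Abel: "\<psi> \<odot> (1 + a) = 1 + \<psi>" and inv: "\<phi> \<odot> \<psi> = 0"
  obtains a' where "fps_conv_radius a' > 0" "reflect \<psi> \<odot> (1 + a') = 1 + reflect \<psi>" "reflect \<phi> \<odot> reflect \<psi> = 0"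
proof -
  have "fps_conv_radius (1 + a) > 0"
    using fps_conv_radius_add[of 1 a] conv by (auto intro: less_le_trans)
  then obtain d where d: "fps_conv_radius d > 0" "d + fsubst (1 + a) d = 0"
    by (rule convergent_inverse_transformation)
  have "fsubst (1 + a) d + fsubst \<psi> (d + fsubst (1 + a) d) = 1 + fsubst \<psi> d"
    using arg_cong[OF Abel, of "\<lambda>F. fsubst F d"] by (simp add: fcomp_def fsubst_add fsubst_fsubst)
  then have Abel_inv: "d + fsubst \<psi> d = \<psi> - 1"
  proof -
    have "fsubst (1 + a) d = - d" using d(2) by (simp add: eq_neg_iff_add_eq_0 add.commute)
    then show ?thesis
      using \<open>fsubst (1 + a) d + _ = _\<close> d(2) by (simp add: algebra_simps)
  qed
  define a' where "a' = reflect d - 1"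
  have "fps_conv_radius a' > 0"
    unfolding a'_def using fps_conv_radius_diff[of "reflect d" 1] d(1)
    by (auto simp: fps_conv_radius_reflect intro: less_le_trans)
  moreover have "reflect \<psi> \<odot> (1 + a') = reflect (d + fsubst \<psi> d)"
    by (simp add: fcomp_def a'_def fsubst_reflect reflect_add)
  then have "reflect \<psi> \<odot> (1 + a') = 1 + reflect \<psi>"
    unfolding Abel_inv by (simp add: reflect_def fps_compose_sub_distrib)
  moreover have "reflect \<phi> \<odot> reflect \<psi> = reflect (\<phi> \<odot> \<psi>)"
    by (simp add: fcomp_def fsubst_reflect reflect_add)
  then have "reflect \<phi> \<odot> reflect \<psi> = 0" by (simp add: inv reflect_def)
  ultimately show ?thesis using that by blast
qed

lemma neg_cut_plane: "- z \<in> cut_plane \<longleftrightarrow> z \<in> cut_plane"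
  by (simp add: cut_plane_iff)

text \<open>
  The principal branches of a germ and of its reflection are reflections of each other by the identity theorem.
\<close>

lemma eq_reflected_on_cut_plane:
  assumes g: "g holomorphic_on cut_plane" "fps_expansion g 0 = G"
    and g': "g' holomorphic_on cut_plane" "fps_expansion g' 0 = G oo - fps_X"
    and z: "z \<in> cut_plane"
  shows "g z = g' (- z)"
proof -
  have E: "g has_fps_expansion G" "g' has_fps_expansion (G oo - fps_X)"
    using has_fps_expansion_fps_expansion[OF open_cut_plane zero_in_cut_plane] g g' by metis+
  have "(g' \<circ> uminus) has_fps_expansion ((G oo - fps_X) oo - fps_X)"
    by (rule has_fps_expansion_compose[OF E(2)]) (auto intro: has_fps_expansion_minus has_fps_expansion_fps_X)
  also have "(G oo - fps_X) oo - fps_X = G"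
    by (rule fps_ext) (simp add: fps_compose_uminus' mult.assoc[symmetric] power_mult_distrib[symmetric])
  finally have "(\<lambda>z. g z - (g' \<circ> uminus) z) has_fps_expansion G - G"
    by (intro has_fps_expansion_diff E(1))
  then have "(\<lambda>z. g z - (g' \<circ> uminus) z) has_fps_expansion 0" by simp
  then have "g z - (g' \<circ> uminus) z = 0"
  proof (rule has_fps_expansion_0_analytic_continuation[OF _ _ open_cut_plane _ zero_in_cut_plane z])
    have "(g' \<circ> uminus) holomorphic_on cut_plane"
      by (intro holomorphic_on_compose_gen[OF _ g'(1)]) (auto intro!: holomorphic_intros simp: neg_cut_plane)
    then show "(\<lambda>z. g z - (g' \<circ> uminus) z) holomorphic_on cut_plane"
      by (intro holomorphic_on_diff g(1))
    have "starlike cut_plane"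
      unfolding starlike_def using starlike_at_cut_plane zero_in_cut_plane by (auto simp: starlike_at_def)
    then show "connected cut_plane" by (rule starlike_imp_connected)
  qed
  then show ?thesis by simp
qed

lemma sector_1_neg:
  assumes "\<zeta> \<in> sector \<theta> 1"
  shows "- \<zeta> \<in> sector \<theta> 0"
proof -
  obtain r \<alpha> where r: "\<zeta> = of_real r * cis \<alpha>" "r > 0" "- \<theta> + pi \<le> \<alpha>" "\<alpha> \<le> \<theta> + pi"
    using assms by (auto simp: sector_def)
  have "- \<zeta> = of_real r * cis (\<alpha> - pi)"
    unfolding r(1) by (simp add: cis_divide[symmetric])
  then show ?thesis
    unfolding sector_def using r by (intro CollectI exI[of _ r] exI[of _ "\<alpha> - pi"]) auto
qed

lemma sector_0_subset_cut_plane: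
  assumes "0 < \<theta>" "\<theta> < pi / 2" "\<zeta> \<in> sector \<theta> 0"
  shows "\<zeta> \<in> cut_plane"
proof -
  obtain r u where r: "r > 0" "\<zeta> = of_real r * u" "norm u = 1" "cos \<theta> \<le> Re u"
    by (rule mem_sector_0[OF assms]) (rule that)
  have "cos \<theta> > 0" using assms by (intro cos_gt_zero) auto
  then have "Re \<zeta> > 0" using r by simp
  then show ?thesis unfolding cut_plane_iff by linarith
qed

section \<open>Exponential type in both half-planes\<close>

lemma exp_type_le_mono:
  assumes "exp_type_le g \<tau> S" "\<tau> \<le> \<tau>'"
  shows "exp_type_le g \<tau>' S"
proof -
  obtain C where C: "\<And>z. z \<in> S \<Longrightarrow> norm (g z) \<le> C * exp (\<tau> * norm z)"
    using assms(1) by (auto simp: exp_type_le_def)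
  have "norm (g z) \<le> \<bar>C\<bar> * exp (\<tau>' * norm z)" if "z \<in> S" for z
  proof -
    have "C * exp (\<tau> * norm z) \<le> \<bar>C\<bar> * exp (\<tau>' * norm z)"
      using assms(2) by (intro mult_mono) (auto intro: mult_right_mono)
    then show ?thesis using C[OF that] by linarith
  qed
  then show ?thesis unfolding exp_type_le_def by blast
qed

lemma exp_type_le_reflect:
  assumes ty: "exp_type_le g' \<tau> (sector \<theta> 0)" and \<theta>: "0 < \<theta>" "\<theta> < pi / 2"
    and eq: "\<And>z. z \<in> cut_plane \<Longrightarrow> g z = g' (- z)"
  shows "exp_type_le g \<tau> (sector \<theta> 1)"
proof -
  obtain C where C: "\<And>z. z \<in> sector \<theta> 0 \<Longrightarrow> norm (g' z) \<le> C * exp (\<tau> * norm z)"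
    using ty by (auto simp: exp_type_le_def)
  have "norm (g z) \<le> C * exp (\<tau> * norm z)" if z: "z \<in> sector \<theta> 1" for z
  proof -
    have m: "- z \<in> sector \<theta> 0" by (rule sector_1_neg[OF z])
    then have "z \<in> cut_plane" using sector_0_subset_cut_plane[OF \<theta> m] neg_cut_plane by simp
    then show ?thesis using C[OF m] eq by simp
  qed
  then show ?thesis unfolding exp_type_le_def by blast
qed

text \<open>
  The right-hand sector comes from the germ itself, the left-hand sector from its reflection.  Both
  exponential types are then replaced by their maximum.
\<close>

theorem theorem2:
  fixes a \<phi> \<psi> :: "complex fps"
  assumes a_conv: "fps_conv_radius a > 0"
    and a_order: "fps_nth a 0 = 0" "fps_nth a 1 = 0"
    and \<phi>_order: "fps_nth \<phi> 0 = 0"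
    and \<psi>_order: "fps_nth \<psi> 0 = 0"
    and u_conjugates: "(1 + a) \<odot> \<phi> = \<phi> \<odot> 1"
    and v_inverse_u: "\<phi> \<odot> \<psi> = 0" "\<psi> \<odot> \<phi> = 0"
    and v_Abel: "\<psi> \<odot> (1 + a) = 1 + \<psi>"
  shows "fps_conv_radius (formal_borel \<phi>) > 0 \<and> fps_conv_radius (formal_borel \<psi>) > 0 \<and>
    extends_to_R (formal_borel \<phi>) \<and> extends_to_R (formal_borel \<psi>) \<and>
    (\<exists>g h. principal_branch (formal_borel \<phi>) g \<and> principal_branch (formal_borel \<psi>) h \<and>
       (\<forall>\<theta>\<^sub>0. 0 < \<theta>\<^sub>0 \<and> \<theta>\<^sub>0 < pi / 2 \<longrightarrow>
          (\<exists>\<tau>>0. \<forall>n\<in>{0, 1}.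
             exp_type_le g \<tau> (sector \<theta>\<^sub>0 n) \<and> exp_type_le h \<tau> (sector \<theta>\<^sub>0 n))))"
proof -
  obtain R0 C where "R0 > 0" "C \<ge> 0" "\<And>R k. R \<ge> R0 \<Longrightarrow> (\<Sum>i\<le>k. norm (a $ i) / R ^ i) \<le> C / R\<^sup>2"
    by (rule fps_weight_bound_exists[OF a_conv a_order]) (rule that)
  then interpret right: parabolic a R0 C
    using a_order by unfold_locales
  obtain g h where g: "g holomorphic_on cut_plane" "fps_expansion g 0 = formal_borel \<phi>" "extends_to_R (formal_borel \<phi>)"
    and h: "h holomorphic_on cut_plane" "fps_expansion h 0 = formal_borel \<psi>" "extends_to_R (formal_borel \<psi>)"
    and gh: "\<And>\<theta>\<^sub>0. 0 < \<theta>\<^sub>0 \<Longrightarrow> \<theta>\<^sub>0 < pi / 2 \<Longrightarrow>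
       \<exists>\<tau>>0. exp_type_le g \<tau> (sector \<theta>\<^sub>0 0) \<and> exp_type_le h \<tau> (sector \<theta>\<^sub>0 0)"
    by (rule right.borel_transforms_right_sector[OF \<psi>_order v_Abel v_inverse_u(1)]) (rule that)
  obtain a' where a': "fps_conv_radius a' > 0" "reflect \<psi> \<odot> (1 + a') = 1 + reflect \<psi>" "reflect \<phi> \<odot> reflect \<psi> = 0"
    by (rule reflected_data[OF a_conv \<psi>_order v_Abel v_inverse_u(1)]) (rule that)
  have \<psi>'_order: "reflect \<psi> $ 0 = 0" by (simp add: reflect_nth \<psi>_order)
  note a'_order = Abel_order[OF \<psi>'_order a'(2)]
  obtain R0' C' where "R0' > 0" "C' \<ge> 0" "\<And>R k. R \<ge> R0' \<Longrightarrow> (\<Sum>i\<le>k. norm (a' $ i) / R ^ i) \<le> C' / R\<^sup>2"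
    by (rule fps_weight_bound_exists[OF a'(1) a'_order]) (rule that)
  then interpret left: parabolic a' R0' C'
    using a'_order by unfold_locales
  obtain g' h' where g': "g' holomorphic_on cut_plane" "fps_expansion g' 0 = formal_borel (reflect \<phi>)"
    and h': "h' holomorphic_on cut_plane" "fps_expansion h' 0 = formal_borel (reflect \<psi>)"
    and gh': "\<And>\<theta>\<^sub>0. 0 < \<theta>\<^sub>0 \<Longrightarrow> \<theta>\<^sub>0 < pi / 2 \<Longrightarrow>
       \<exists>\<tau>>0. exp_type_le g' \<tau> (sector \<theta>\<^sub>0 0) \<and> exp_type_le h' \<tau> (sector \<theta>\<^sub>0 0)"
    by (rule left.borel_transforms_right_sector[OF \<psi>'_order a'(2,3)]) (rule that)
  have eqg: "g z = g' (- z)" and eqh: "h z = h' (- z)" if "z \<in> cut_plane" for z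
    by (rule eq_reflected_on_cut_plane[OF g(1,2) g'(1) g'(2)[unfolded formal_borel_reflect] that],
        rule eq_reflected_on_cut_plane[OF h(1,2) h'(1) h'(2)[unfolded formal_borel_reflect] that])
  have pos: "fps_conv_radius (fps_expansion f 0) > 0" if "f holomorphic_on cut_plane" for f
    using has_fps_expansion_fps_expansion[OF open_cut_plane zero_in_cut_plane that]
    by (simp add: has_fps_expansion_def)
  have pb: "principal_branch (fps_expansion f 0) f" if "f holomorphic_on cut_plane" for f
    by (rule principal_branch_fps_expansion[OF open_cut_plane starlike_at_cut_plane that])
  have growth: "\<exists>\<tau>>0. \<forall>n\<in>{0, 1}. exp_type_le g \<tau> (sector \<theta>\<^sub>0 n) \<and> exp_type_le h \<tau> (sector \<theta>\<^sub>0 n)"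
    if \<theta>: "0 < \<theta>\<^sub>0" "\<theta>\<^sub>0 < pi / 2" for \<theta>\<^sub>0
  proof -
    obtain \<tau>1 where \<tau>1: "\<tau>1 > 0" "exp_type_le g \<tau>1 (sector \<theta>\<^sub>0 0)" "exp_type_le h \<tau>1 (sector \<theta>\<^sub>0 0)"
      using gh[OF \<theta>] by blast
    obtain \<tau>2 where \<tau>2: "\<tau>2 > 0" "exp_type_le g' \<tau>2 (sector \<theta>\<^sub>0 0)" "exp_type_le h' \<tau>2 (sector \<theta>\<^sub>0 0)"
      using gh'[OF \<theta>] by blast
    have "exp_type_le g \<tau>2 (sector \<theta>\<^sub>0 1)" "exp_type_le h \<tau>2 (sector \<theta>\<^sub>0 1)"
      by (rule exp_type_le_reflect[OF \<tau>2(2) \<theta> eqg], assumption, rule exp_type_le_reflect[OF \<tau>2(3) \<theta> eqh], assumption)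
    then show ?thesis
      using \<tau>1 by (intro exI[of _ "max \<tau>1 \<tau>2"]) (auto intro: exp_type_le_mono)
  qed
  show ?thesis
    using pos[OF g(1)] pos[OF h(1)] pb[OF g(1)] pb[OF h(1)] g(2,3) h(2,3) growth by auto
qed

end
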